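(* Let $\mathcal K$ be an oriented regular virtual knot and $\pi$ an index on the diagrams of $\mathcal K$ with coefficients in an abelian group $A$. Then the formula $$\delta^\pi_D=\sum_{v\in\mathcal V(D)}\mathrm{sgn}(v)\,\pi_D(v)\cdot D^-_v$$ defines an invariant 1-cycle $\delta^\pi_D$ on the diagrams of $\mathcal K$, and the formula $$p^\pi_D(v)=\sum_{v'\in\mathcal V(D)}\mathrm{sgn}(v')\,\pi_D(v')\cdot(D^l_v\cdot D^-_{v'})$$ defines an oriented parity $p^\pi$ on the diagrams $D$ of the regular knot $\mathcal K$ with coefficients in the group $\bar A=A/\langle\sigma(\pi)\rangle$, where $\sigma(\pi)=-\sum_{v\in\mathcal V(D)}\pi_D(v)\cdot ip_D(v)\in A$ is the signature of $\pi$ (which does not depend on the diagram $D$ of $\mathcal K$).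
   Context: Diagrams. A virtual knot diagram $D$ is a generic oriented closed curve in the plane whose double points are marked classical (with over/under information) or virtual. A regular virtual knot is a class of virtual knot diagrams modulo isotopy, second and third classical Reidemeister moves R2, R3, and detour moves (replacing a path containing only virtual crossings by another path with the same ends containing only virtual crossings); first Reidemeister moves are not allowed. "Moves" below means these moves. $\mathcal V(D)$ is the set of classical crossings and $\mathrm{sgn}(v)=\pm1$ the usual sign (local writhe) of $v$; $\mathcal A(D)$ is the set of arcs, i.e. pieces of $D$ between consecutive classical crossings (one closed arc if there are no classical crossings). A move $f\colon D\to D'$ induces a partial bijection $f_*\colon\mathcal V(D)\to\mathcal V(D')$ between surviving crossings. Arcs $a\in\mathcal A(D)$, $a'\in\mathcal A(D')$ are correspondent under a Reidemeister move if they share a point outside the region of the move; isotopies and detour moves induce a bijection of arcs. Local picture. Draw a classical crossing $v$ with both strands directed upward: the incoming arcs are SW, SE, the outgoing ones NW, NE, and the strands run SW$\to$NE and SE$\to$NW. The oriented smoothing at $v$ splits $D$ into the left half $D^l_v$ (leaving $v$ along NW, returning along SW) and the right half $D^r_v$ (leaving along NE, returning along SE). Signed halves: $D^-_v=D^r_v$ if $\mathrm{sgn}(v)=+1$ and $D^-_v=D^l_v$ if $\mathrm{sgn}(v)=-1$. Chains. $C_1(D,A)$ is the group of $A$-linear combinations of arcs, i.e. 1-chains of the graph $\tilde D$ with vertices $\mathcal V(D)$ and edges $\mathcal A(D)$ oriented along $D$; $H_1(D,A)$ is its subgroup of 1-cycles. $\tilde D$ is embedded in the closed oriented surface $AD(D)$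 obtained by gluing discs to the boundary of the ribbon surface that is the (immersed) neighbourhood of $D$ (virtual crossings not being vertices). $C_1\cdot C_2$ denotes the intersection number in $AD(D)$, a transverse intersection counting $+1$ when (tangent of $C_1$, tangent of $C_2$) is positively oriented. The index parity is $ip_D(v)=-(D^l_v\cdot D)\in\mathbb Z$. A family $\gamma_D\in C_1(D,A)$ is invariant if $\gamma_D(a)=\gamma_{D'}(a')$ for every move $D\to D'$ and all correspondent arcs $a,a'$. Index. A family of maps $\pi_D\colon\mathcal V(D)\to A$ for all diagrams of $\mathcal K$ such that: (I0) $\pi_D(v)=\pi_{D'}(f_*(v))$ for any Reidemeister move $f\colon D\to D'$ (of type R2 or R3) and any $v$ for which $f_*(v)$ exists; (I2) $\pi_D(v_1)=\pi_D(v_2)$ for any $v_1,v_2$ to which a decreasing R2 can be applied. Oriented parity (on a regular knot) with coefficients in an abelian group $B$. A family of maps $p_D\colon\mathcal V(D)\to B$ such that: (P0) $p_D(v)=p_{D'}(f_*(v))$ for every move $f\colon D\to D'$ and every $v$ for which $f_*(v)$ exists; (P2) $p_D(v_1)+p_D(v_2)=0$ if $v_1,v_2$ disappear in a decreasing R2; (P3+) $\sum_{i=1}^3\epsilon_\Delta(v_i)p_D(v_i)=0$ if $v_1,v_2,v_3$ are the vertices of the disappearing triangle $\Delta$ of an R3, where $\epsilon_\Delta(v)=+1$ if $\Delta$ lies to the left or right of $v$ in the local picture (between SW and NW, or between SE and NE) and $-1$ if it lies above or below $v$. (The R1 axiom of parities is void.)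
   Formalization: In (I0) the index is required to be invariant under all moves, isotopies and detour moves included, not only R2 and R3; otherwise π_D(v) = number of virtual crossings of D (A = ℤ) would be an index whose δ^π changes under detour moves. *)

theory Defs
  imports "HOL-Analysis.Analysis" "HOL-Algebra.Generated_Groups" "HOL-Algebra.FiniteProduct"
    "HOL-Algebra.Coset"
begin

section \<open>Virtual knot diagrams\<close>

text \<open>
  The closed curve is parametrised by the reals with period 1. The marking of the double points is
  encoded by the set of parameters in \<open>[0,1)\<close> at which the curve runs through a classical
  crossing on the over-strand; a double point without such a parameter is virtual.
\<close>

record vdiag =
  curve :: "real \<Rightarrow> complex"
  over :: "real set"

definition velocity :: "vdiag \<Rightarrow> real \<Rightarrow> complex" where
  "velocity D t = vector_derivative (curve D) (at t)"

text \<open>\<open>wedge z w > 0\<close> iff the pair \<open>(z, w)\<close> is a positively oriented frame of the plane.\<close>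

definition wedge :: "complex \<Rightarrow> complex \<Rightarrow> real" where
  "wedge z w = Re z * Im w - Im z * Re w"

definition double_params :: "vdiag \<Rightarrow> real set" where
  "double_params D = {t \<in> {0..<1}. \<exists>t' \<in> {0..<1}. t' \<noteq> t \<and> curve D t' = curve D t}"

definition is_diagram :: "vdiag \<Rightarrow> bool" where
  "is_diagram D \<longleftrightarrow>
     (\<forall>t. curve D (t + 1) = curve D t) \<and>
     (\<forall>t. curve D differentiable at t) \<and> continuous_on UNIV (velocity D) \<and>
     (\<forall>t. velocity D t \<noteq> 0) \<and>
     finite (double_params D) \<and>
     (\<forall>t1 \<in> {0..<1}. \<forall>t2 \<in> {0..<1}. \<forall>t3 \<in> {0..<1}.
        curve D t1 = curve D t2 \<and> curve D t2 = curve D t3 \<longrightarrow> t1 = t2 \<or> t2 = t3 \<or> t1 = t3) \<and>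
     (\<forall>t1 \<in> {0..<1}. \<forall>t2 \<in> {0..<1}.
        curve D t1 = curve D t2 \<and> t1 \<noteq> t2 \<longrightarrow> wedge (velocity D t1) (velocity D t2) \<noteq> 0) \<and>
     over D \<subseteq> double_params D \<and>
     inj_on (curve D) (over D)"

definition classical :: "vdiag \<Rightarrow> complex set" where
  "classical D = curve D ` over D"

text \<open>
  At a crossing drawn with both strands directed upward, the strand from SW to NE and the strand
  from SE to NW (in this order) have positively oriented tangents. The parameters at which the
  two strands pass through the crossing:
\<close>

definition ne_param :: "vdiag \<Rightarrow> complex \<Rightarrow> real" where
  "ne_param D v = (THE p. p \<in> {0..<1} \<and> curve D p = v \<and>
     (\<exists>q \<in> {0..<1}. curve D q = v \<and> wedge (velocity D p) (velocity D q) > 0))"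

definition nw_param :: "vdiag \<Rightarrow> complex \<Rightarrow> real" where
  "nw_param D v = (THE q. q \<in> {0..<1} \<and> curve D q = v \<and>
     (\<exists>p \<in> {0..<1}. curve D p = v \<and> wedge (velocity D p) (velocity D q) > 0))"

text \<open>A crossing is positive iff (over-tangent, under-tangent) is positively oriented.\<close>

definition writhe :: "vdiag \<Rightarrow> complex \<Rightarrow> int" where
  "writhe D v = (if ne_param D v \<in> over D then 1 else - 1)"

subsection \<open>Arcs\<close>

definition passages :: "vdiag \<Rightarrow> real set" where
  "passages D = {t. curve D t \<in> classical D}"

text \<open>
  An arc is represented by the set of all its parameters, which is invariant under integer
  translations. Points of the diagram are thus understood as points of the parametrised curve: at
  a virtual crossing, the two strands do not share a point.
\<close>

definition arc_at :: "vdiag \<Rightarrow> real \<Rightarrow> real set" where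
  "arc_at D t = {t'. \<exists>n::int. closed_segment t (t' + of_int n) \<inter> passages D = {}}"

definition arcs :: "vdiag \<Rightarrow> real set set" where
  "arcs D = arc_at D ` (- passages D)"

definition arc_out :: "vdiag \<Rightarrow> real \<Rightarrow> real set" where
  "arc_out D p = (THE a. a \<in> arcs D \<and> (\<exists>e>0. {p<..<p + e} \<subseteq> a))"

definition arc_in :: "vdiag \<Rightarrow> real \<Rightarrow> real set" where
  "arc_in D p = (THE a. a \<in> arcs D \<and> (\<exists>e>0. {p - e<..<p} \<subseteq> a))"


section \<open>Moves\<close>

subsection \<open>Isotopies and detour moves\<close>

definition ambient_isotopy :: "(real \<Rightarrow> complex \<Rightarrow> complex) \<Rightarrow> bool" where
  "ambient_isotopy H \<longleftrightarrow>
     (\<forall>z. H 0 z = z) \<and> (\<forall>s \<in> {0..1}. bij (H s)) \<and>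
     continuous_on ({0..1} \<times> UNIV) (\<lambda>(s, z). H s z) \<and>
     (\<exists>H'. (\<forall>s \<in> {0..1}. \<forall>z. (H s has_derivative H' s z) (at z) \<and> wedge (H' s z 1) (H' s z \<i>) \<noteq> 0) \<and>
        (\<forall>w. continuous_on ({0..1} \<times> UNIV) (\<lambda>(s, z). H' s z w)))"

definition circle_reparam :: "(real \<Rightarrow> real) \<Rightarrow> bool" where
  "circle_reparam r \<longleftrightarrow> (\<forall>t. r (t + 1) = r t + 1) \<and>
     (\<exists>r'. (\<forall>t. (r has_real_derivative r' t) (at t) \<and> r' t > 0) \<and> continuous_on UNIV r')"

definition isotopy_move ::
  "vdiag \<Rightarrow> vdiag \<Rightarrow> (real \<Rightarrow> complex \<Rightarrow> complex) \<Rightarrow> (real \<Rightarrow> real) \<Rightarrow> bool" where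
  "isotopy_move D D' H r \<longleftrightarrow> is_diagram D \<and> is_diagram D' \<and> ambient_isotopy H \<and> circle_reparam r \<and>
     (\<forall>t. curve D' t = H 1 (curve D (r t))) \<and>
     over D' = {t \<in> {0..<1}. frac (r t) \<in> over D}"

definition detour_move :: "vdiag \<Rightarrow> vdiag \<Rightarrow> bool" where
  "detour_move D D' \<longleftrightarrow> is_diagram D \<and> is_diagram D' \<and>
     (\<exists>s e. s < e \<and> e < s + 1 \<and>
        (\<forall>t. (\<forall>n::int. t + of_int n \<notin> {s..e}) \<longrightarrow> curve D' t = curve D t) \<and>
        over D' = over D \<and>
        {s..e} \<inter> passages D = {} \<and> {s..e} \<inter> passages D' = {})"

subsection \<open>Local pictures of the second and third Reidemeister moves\<close>

text \<open>
  The region of a move is the image of the square \<open>[-1,1]\<^sup>2\<close> under an orientation preserving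
  \<open>C\<^sup>1\<close> embedding of a neighbourhood of the square. In these coordinates the strands inside the
  region are graphs of functions \<open>f i\<close> over \<open>[-1,1]\<close>. Strand \<open>i\<close> occupies the parameter interval
  from \<open>start i\<close> to \<open>stop i\<close>, and runs from left to right if \<open>dir i = 1\<close> and from right to left if
  \<open>dir i = -1\<close>, at constant horizontal speed; this is no restriction because reparametrisations
  are isotopies. Strands with greater \<open>layer\<close> pass over those with smaller \<open>layer\<close>.
\<close>

record region =
  emb :: "complex \<Rightarrow> complex"
  start :: "nat \<Rightarrow> real"
  stop :: "nat \<Rightarrow> real"
  dir :: "nat \<Rightarrow> real"
  layer :: "nat \<Rightarrow> nat"

definition square :: "complex set" where
  "square = {z. \<bar>Re z\<bar> \<le> 1 \<and> \<bar>Im z\<bar> \<le> 1}"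

definition domain_of :: "region \<Rightarrow> complex set" where
  "domain_of T = emb T ` square"

definition is_chart :: "(complex \<Rightarrow> complex) \<Rightarrow> bool" where
  "is_chart \<psi> \<longleftrightarrow> (\<exists>U. open U \<and> square \<subseteq> U \<and> inj_on \<psi> U \<and>
     (\<exists>\<psi>'. (\<forall>z \<in> U. (\<psi> has_derivative \<psi>' z) (at z) \<and> wedge (\<psi>' z 1) (\<psi>' z \<i>) > 0) \<and>
        (\<forall>w. continuous_on U (\<lambda>z. \<psi>' z w))))"

definition strand_time :: "region \<Rightarrow> nat \<Rightarrow> real \<Rightarrow> real" where
  "strand_time T i x = start T i + (stop T i - start T i) * (dir T i * x + 1) / 2"

definition graph_point :: "region \<Rightarrow> (nat \<Rightarrow> real \<Rightarrow> real) \<Rightarrow> nat \<Rightarrow> real \<Rightarrow> complex" where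
  "graph_point T f i x = emb T (Complex x (f i x))"

definition is_region :: "region \<Rightarrow> nat \<Rightarrow> bool" where
  "is_region T n \<longleftrightarrow> is_chart (emb T) \<and> inj_on (layer T) {..<n} \<and>
     (\<forall>i<n. start T i < stop T i \<and> stop T i < start T i + 1 \<and> dir T i \<in> {1, - 1}) \<and>
     (\<forall>i<n. \<forall>j<n. \<forall>k::int. i \<noteq> j \<longrightarrow>
        {start T i..stop T i} \<inter> {start T j + of_int k..stop T j + of_int k} = {})"

definition local_picture :: "vdiag \<Rightarrow> region \<Rightarrow> nat \<Rightarrow> (nat \<Rightarrow> real \<Rightarrow> real) \<Rightarrow> bool" where
  "local_picture D T n f \<longleftrightarrow>
     {t. curve D t \<in> domain_of T} =
       (\<Union>i<n. \<Union>k::int. {start T i + of_int k..stop T i + of_int k}) \<and>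
     (\<forall>i<n. f i differentiable_on {-1..1} \<and>
        (\<forall>x \<in> {-1..1}. \<bar>f i x\<bar> < 1 \<and> curve D (strand_time T i x) = graph_point T f i x)) \<and>
     (\<forall>i<n. \<forall>j<n. \<forall>x \<in> {-1..1}. layer T i < layer T j \<and> f i x = f j x \<longrightarrow>
        frac (strand_time T j x) \<in> over D)"

definition local_move ::
  "vdiag \<Rightarrow> vdiag \<Rightarrow> region \<Rightarrow> nat \<Rightarrow> (nat \<Rightarrow> real \<Rightarrow> real) \<Rightarrow> (nat \<Rightarrow> real \<Rightarrow> real) \<Rightarrow> bool" where
  "local_move D D' T n f f' \<longleftrightarrow> is_diagram D \<and> is_diagram D' \<and> is_region T n \<and>
     local_picture D T n f \<and> local_picture D' T n f' \<and>
     (\<forall>t. curve D t \<notin> domain_of T \<longrightarrow> curve D' t = curve D t) \<and>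
     {t \<in> over D. curve D t \<notin> domain_of T} = {t \<in> over D'. curve D' t \<notin> domain_of T}"

definition R2_move :: "vdiag \<Rightarrow> vdiag \<Rightarrow> region \<Rightarrow> bool" where
  "R2_move D D' T \<longleftrightarrow> (\<exists>f f'. local_move D D' T 2 f f' \<and>
     card {x \<in> {-1..1}. f 0 x = f 1 x} = 2 \<and> {x \<in> {-1..1}. f' 0 x = f' 1 x} = {})"

text \<open>
  In an R3 move each two of the three strands cross once. With suitable numbering of the strands
  the crossings appear from left to right in the order 01, 02, 12 on one side of the move, and in
  the reverse order on the other side.
\<close>

definition R3_move ::
  "vdiag \<Rightarrow> vdiag \<Rightarrow> region \<Rightarrow> (nat \<Rightarrow> real \<Rightarrow> real) \<Rightarrow> (nat \<Rightarrow> real \<Rightarrow> real) \<Rightarrow>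
   (nat \<Rightarrow> nat \<Rightarrow> real) \<Rightarrow> (nat \<Rightarrow> nat \<Rightarrow> real) \<Rightarrow> bool" where
  "R3_move D D' T f f' X X' \<longleftrightarrow> local_move D D' T 3 f f' \<and>
     (\<forall>i<3. \<forall>j<3. i \<noteq> j \<longrightarrow> {x \<in> {-1..1}. f i x = f j x} = {X i j}) \<and>
     (\<forall>i<3. \<forall>j<3. i \<noteq> j \<longrightarrow> {x \<in> {-1..1}. f' i x = f' j x} = {X' i j}) \<and>
     (X 0 1 < X 0 2 \<and> X 0 2 < X 1 2 \<and> X' 1 2 < X' 0 2 \<and> X' 0 2 < X' 0 1 \<or>
      X' 0 1 < X' 0 2 \<and> X' 0 2 < X' 1 2 \<and> X 1 2 < X 0 2 \<and> X 0 2 < X 0 1)"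

text \<open>
  \<open>triangle_sign T X i j k\<close> belongs to the crossing of the strands \<open>i\<close> and \<open>j\<close>; the sides of the
  triangle at this crossing run along \<open>i\<close> and \<open>j\<close> to the crossings with \<open>k\<close>. The triangle lies
  between NW and NE or between SW and SE iff both sides leave the crossing or both arrive at it;
  otherwise it lies between SW and NW or between SE and NE.
\<close>

definition side_leaves :: "region \<Rightarrow> (nat \<Rightarrow> nat \<Rightarrow> real) \<Rightarrow> nat \<Rightarrow> nat \<Rightarrow> nat \<Rightarrow> bool" where
  "side_leaves T X i j k \<longleftrightarrow> strand_time T i (X i j) < strand_time T i (X i k)"

definition triangle_sign :: "region \<Rightarrow> (nat \<Rightarrow> nat \<Rightarrow> real) \<Rightarrow> nat \<Rightarrow> nat \<Rightarrow> nat \<Rightarrow> int" where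
  "triangle_sign T X i j k = (if side_leaves T X i j k = side_leaves T X j i k then - 1 else 1)"

definition local_arc_corr :: "vdiag \<Rightarrow> vdiag \<Rightarrow> region \<Rightarrow> (real set \<times> real set) set" where
  "local_arc_corr D D' T =
     {(a, a'). a \<in> arcs D \<and> a' \<in> arcs D' \<and> (\<exists>t \<in> a \<inter> a'. curve D t \<notin> domain_of T)}"

subsection \<open>Moves and regular virtual knots\<close>

text \<open>
  \<open>vmove D D' F C\<close>: a move from \<open>D\<close> to \<open>D'\<close> with the graph \<open>F\<close> of the induced partial
  bijection of classical crossings and the correspondence \<open>C\<close> of arcs.
\<close>

inductive vmove ::
  "vdiag \<Rightarrow> vdiag \<Rightarrow> (complex \<times> complex) set \<Rightarrow> (real set \<times> real set) set \<Rightarrow> bool" where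
  isotopy: "isotopy_move D D' H r \<Longrightarrow>
    vmove D D' {(v, H 1 v) | v. v \<in> classical D}
      {(a, a'). a \<in> arcs D \<and> a' \<in> arcs D' \<and> a = r ` a'}"
| detour: "detour_move D D' \<Longrightarrow> vmove D D' (Id_on (classical D)) (Id_on (arcs D))"
| R2: "R2_move D D' T \<Longrightarrow>
    vmove D D' (Id_on (classical D - domain_of T)) (local_arc_corr D D' T)"
| R3: "R3_move D D' T f f' X X' \<Longrightarrow>
    vmove D D'
      (Id_on (classical D - domain_of T) \<union>
        {(graph_point T f i (X i j), graph_point T f' i (X' i j)) | i j. i < 3 \<and> j < 3 \<and> i \<noteq> j})
      (local_arc_corr D D' T)"
| inverse: "vmove D D' F C \<Longrightarrow> vmove D' D (converse F) (converse C)"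

definition move_equiv :: "(vdiag \<times> vdiag) set" where
  "move_equiv = {(D, D'). is_diagram D \<and> is_diagram D' \<and> (\<lambda>D1 D2. \<exists>F C. vmove D1 D2 F C)\<^sup>*\<^sup>* D D'}"

definition regular_virtual_knots :: "vdiag set set" where
  "regular_virtual_knots = Collect is_diagram // move_equiv"


section \<open>Chains, halves, intersection numbers\<close>

definition chains :: "('g, 'b) monoid_scheme \<Rightarrow> vdiag \<Rightarrow> (real set \<Rightarrow> 'g) set" where
  "chains A D = arcs D \<rightarrow>\<^sub>E carrier A"

definition cycles :: "('g, 'b) monoid_scheme \<Rightarrow> vdiag \<Rightarrow> (real set \<Rightarrow> 'g) set" where
  "cycles A D = {c \<in> chains A D. \<forall>v \<in> classical D.
     c (arc_in D (ne_param D v)) \<otimes>\<^bsub>A\<^esub> c (arc_in D (nw_param D v)) =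
     c (arc_out D (ne_param D v)) \<otimes>\<^bsub>A\<^esub> c (arc_out D (nw_param D v))}"

text \<open>The parameters strictly between \<open>p\<close> and \<open>q\<close> along the oriented closed curve.\<close>

definition between :: "real \<Rightarrow> real \<Rightarrow> real set" where
  "between p q = {t. 0 < frac (t - p) \<and> frac (t - p) < frac (q - p)}"

definition whole :: "vdiag \<Rightarrow> real set \<Rightarrow> int" where
  "whole D = (\<lambda>a \<in> arcs D. 1)"

definition left_half :: "vdiag \<Rightarrow> complex \<Rightarrow> real set \<Rightarrow> int" where
  "left_half D v = (\<lambda>a \<in> arcs D. if a \<subseteq> between (nw_param D v) (ne_param D v) then 1 else 0)"

definition right_half :: "vdiag \<Rightarrow> complex \<Rightarrow> real set \<Rightarrow> int" where
  "right_half D v = (\<lambda>a \<in> arcs D. if a \<subseteq> between (ne_param D v) (nw_param D v) then 1 else 0)"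

definition minus_half :: "vdiag \<Rightarrow> complex \<Rightarrow> real set \<Rightarrow> int" where
  "minus_half D v = (if writhe D v = 1 then right_half D v else left_half D v)"

text \<open>
  If two chains cross the boundary circle of an oriented disc in pairwise different points, which
  in counterclockwise order carry the outward flows \<open>(x\<^sub>i, y\<^sub>i)\<close> (at each point at most one of the
  two is nonzero) and \<open>\<Sum> x\<^sub>i = \<Sum> y\<^sub>i = 0\<close>, then their intersection number inside the disc is the
  sum of \<open>x\<^sub>i y\<^sub>j\<close> over \<open>i < j\<close>, wherever on the circle the enumeration starts.
\<close>

definition disc_intersection :: "(int \<times> int) list \<Rightarrow> int" where
  "disc_intersection F = (\<Sum>j<length F. \<Sum>i<j. fst (F ! i) * snd (F ! j))"

text \<open>Two diameters, the first from SW to NE and the second from SE to NW, intersect with sign \<open>+1\<close>.\<close>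

lemma "disc_intersection [(1, 0), (0, 1), (-1, 0), (0, -1)] = 1"
  by (simp add: disc_intersection_def numeral_eq_Suc)

lemma disc_intersection_rotate:
  assumes "(\<Sum>p\<leftarrow>F. fst p) + x = 0" "(\<Sum>p\<leftarrow>F. snd p) + y = 0" "x * y = 0"
  shows "disc_intersection (F @ [(x, y)]) = disc_intersection ((x, y) # F)"
proof -
  have fs: "(\<Sum>i<length F. fst (F ! i)) = - x" "(\<Sum>i<length F. snd (F ! i)) = - y"
    using assms(1,2) by (simp_all add: sum_list_sum_nth atLeast0LessThan)
  have l: "disc_intersection (F @ [(x, y)]) = disc_intersection F + (\<Sum>i<length F. fst (F ! i)) * y"
    by (simp add: disc_intersection_def nth_append sum_distrib_right)
  have r: "disc_intersection ((x, y) # F) = disc_intersection F + x * (\<Sum>j<length F. snd (F ! j))"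
    by (simp add: disc_intersection_def sum.lessThan_Suc_shift sum.distrib sum_distrib_left
        del: sum.lessThan_Suc)
  show ?thesis
    unfolding l r fs using assms(3) by (simp add: mult.commute)
qed

text \<open>
  The intersection number, in the closed surface carrying the graph, of two integral 1-cycles. The
  second cycle is made transverse to the first by pushing it slightly to the left of the oriented
  diagram, so that all intersections lie in disc neighbourhoods of the vertices. The neighbourhood
  of a vertex inherits its orientation from the plane, so the counterclockwise order of the
  half-edges is NE, NW, SW, SE. The pushed half-edge is counterclockwise next to an outgoing
  half-edge (NE, NW) and clockwise next to an incoming one (SW, SE).
\<close>

definition local_intersection ::
  "vdiag \<Rightarrow> (real set \<Rightarrow> int) \<Rightarrow> (real set \<Rightarrow> int) \<Rightarrow> complex \<Rightarrow> int" where
  "local_intersection D c1 c2 v =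
     (let ne = arc_out D (ne_param D v); nw = arc_out D (nw_param D v);
          sw = arc_in D (ne_param D v); se = arc_in D (nw_param D v)
      in disc_intersection
           [(c1 ne, 0), (0, c2 ne), (c1 nw, 0), (0, c2 nw),
            (0, - c2 sw), (- c1 sw, 0), (0, - c2 se), (- c1 se, 0)])"

definition intersection_number ::
  "vdiag \<Rightarrow> (real set \<Rightarrow> int) \<Rightarrow> (real set \<Rightarrow> int) \<Rightarrow> int" where
  "intersection_number D c1 c2 = (\<Sum>v \<in> classical D. local_intersection D c1 c2 v)"

definition index_parity :: "vdiag \<Rightarrow> complex \<Rightarrow> int" where
  "index_parity D v = - intersection_number D (left_half D v) (whole D)"


section \<open>Indices, oriented parities, invariant cycles\<close>

text \<open>
  Coefficient groups are abelian groups in the sense of HOL-Algebra and are written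
  multiplicatively; integer multiples become integer powers.
\<close>

definition knot_index ::
  "('g, 'b) monoid_scheme \<Rightarrow> vdiag set \<Rightarrow> (vdiag \<Rightarrow> complex \<Rightarrow> 'g) \<Rightarrow> bool" where
  "knot_index A K \<pi> \<longleftrightarrow>
     (\<forall>D \<in> K. \<forall>v \<in> classical D. \<pi> D v \<in> carrier A) \<and>
     (\<forall>D \<in> K. \<forall>D' F C. vmove D D' F C \<longrightarrow> (\<forall>(v, v') \<in> F. \<pi> D v = \<pi> D' v')) \<and>
     (\<forall>D \<in> K. \<forall>D' T. R2_move D D' T \<longrightarrow>
        (\<forall>v1 \<in> classical D \<inter> domain_of T. \<forall>v2 \<in> classical D \<inter> domain_of T. \<pi> D v1 = \<pi> D v2))"

definition oriented_parity ::
  "('g, 'b) monoid_scheme \<Rightarrow> vdiag set \<Rightarrow> (vdiag \<Rightarrow> complex \<Rightarrow> 'g) \<Rightarrow> bool" where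
  "oriented_parity B K p \<longleftrightarrow>
     comm_group B \<and>
     (\<forall>D \<in> K. \<forall>v \<in> classical D. p D v \<in> carrier B) \<and>
     (\<forall>D \<in> K. \<forall>D' F C. vmove D D' F C \<longrightarrow> (\<forall>(v, v') \<in> F. p D v = p D' v')) \<and>
     (\<forall>D \<in> K. \<forall>D' T. R2_move D D' T \<longrightarrow>
        (\<forall>v1 \<in> classical D \<inter> domain_of T. \<forall>v2 \<in> classical D \<inter> domain_of T.
           v1 \<noteq> v2 \<longrightarrow> p D v1 \<otimes>\<^bsub>B\<^esub> p D v2 = \<one>\<^bsub>B\<^esub>)) \<and>
     (\<forall>D \<in> K. \<forall>D' T f f' X X'. R3_move D D' T f f' X X' \<longrightarrow>
        p D (graph_point T f 0 (X 0 1)) [^]\<^bsub>B\<^esub> triangle_sign T X 0 1 2 \<otimes>\<^bsub>B\<^esub>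
        p D (graph_point T f 0 (X 0 2)) [^]\<^bsub>B\<^esub> triangle_sign T X 0 2 1 \<otimes>\<^bsub>B\<^esub>
        p D (graph_point T f 1 (X 1 2)) [^]\<^bsub>B\<^esub> triangle_sign T X 1 2 0 = \<one>\<^bsub>B\<^esub>)"

definition invariant_cycle ::
  "('g, 'b) monoid_scheme \<Rightarrow> vdiag set \<Rightarrow> (vdiag \<Rightarrow> real set \<Rightarrow> 'g) \<Rightarrow> bool" where
  "invariant_cycle A K \<gamma> \<longleftrightarrow>
     (\<forall>D \<in> K. \<gamma> D \<in> cycles A D) \<and>
     (\<forall>D \<in> K. \<forall>D' F C. vmove D D' F C \<longrightarrow> (\<forall>(a, a') \<in> C. \<gamma> D a = \<gamma> D' a'))"

definition index_cycle ::
  "('g, 'b) monoid_scheme \<Rightarrow> (vdiag \<Rightarrow> complex \<Rightarrow> 'g) \<Rightarrow> vdiag \<Rightarrow> real set \<Rightarrow> 'g" where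
  "index_cycle A \<pi> D = (\<lambda>a \<in> arcs D.
     \<Otimes>\<^bsub>A\<^esub>v \<in> classical D. \<pi> D v [^]\<^bsub>A\<^esub> (writhe D v * minus_half D v a))"

definition signature ::
  "('g, 'b) monoid_scheme \<Rightarrow> (vdiag \<Rightarrow> complex \<Rightarrow> 'g) \<Rightarrow> vdiag \<Rightarrow> 'g" where
  "signature A \<pi> D = inv\<^bsub>A\<^esub> (\<Otimes>\<^bsub>A\<^esub>v \<in> classical D. \<pi> D v [^]\<^bsub>A\<^esub> index_parity D v)"

definition parity_sum ::
  "('g, 'b) monoid_scheme \<Rightarrow> (vdiag \<Rightarrow> complex \<Rightarrow> 'g) \<Rightarrow> vdiag \<Rightarrow> complex \<Rightarrow> 'g" where
  "parity_sum A \<pi> D v = (\<Otimes>\<^bsub>A\<^esub>v' \<in> classical D.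
     \<pi> D v' [^]\<^bsub>A\<^esub> (writhe D v' * intersection_number D (left_half D v) (minus_half D v')))"

text \<open>The class of \<open>parity_sum\<close> in the quotient of \<open>A\<close> by the subgroup generated by \<open>s\<close>.\<close>

definition index_to_parity ::
  "('g, 'b) monoid_scheme \<Rightarrow> 'g \<Rightarrow> (vdiag \<Rightarrow> complex \<Rightarrow> 'g) \<Rightarrow> vdiag \<Rightarrow> complex \<Rightarrow> 'g set" where
  "index_to_parity A s \<pi> D v = generate A {s} #>\<^bsub>A\<^esub> parity_sum A \<pi> D v"

end

theory Submission
  imports Defs
begin

text \<open>
  The index enters the cycle, the signature and the parity only through products
  \<open>\<Prod>\<^sub>u \<pi>(u) [^] n(u)\<close> over the crossings \<open>u\<close> with integer exponents: for the cycle \<open>n(u)\<close> is the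
  multiplicity of \<open>sgn(u) D\<^sup>-\<^sub>u\<close> on an arc, for the signature \<open>- ip(u) = D\<^sup>l\<^sub>u \<cdot> D\<close>, for the parity
  of \<open>v\<close> it is \<open>sgn(u) (D\<^sup>l\<^sub>v \<cdot> D\<^sup>-\<^sub>u)\<close>. So all claims are about integers: the exponents must be
  preserved by moves, and the two crossings that disappear in a second Reidemeister move, whose
  indices agree, must have opposite exponents.

  These integers depend only on the cyclic order in which the closed curve passes its classical
  crossings and on which passage is the NE one and which runs over. Isotopies preserve the cyclic
  order, detour moves touch no passage, and a Reidemeister move permutes passages only inside the
  parameter intervals of the strands in its region. As seen from an arc outside of the region a half of the diagram
  therefore does not change, and the halves \<open>D\<^sup>-\<close> of the two crossings of a bigon, which have
  opposite signs, agree. This gives the invariance of the cycle.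

  For intersection numbers the region has to be looked into. Pushing the second cycle to the left
  gives at each crossing the contribution \<open>h(SW) c(SE) - h(NW) c(NE)\<close> of two cycles \<open>h\<close>, \<open>c\<close>. The
  values of a cycle on the arcs inside the region are determined by the values at which the
  strands enter and by one integer per crossing, the jump along the NE strand. Adding up the
  contributions of the crossings inside the region shows two facts, which carry the proof:
  two pairs of cycles that correspond under the move have the same intersection number
  (\<open>R2_intersection\<close>, \<open>R3_intersection\<close>), and a cycle that vanishes outside of the region has
  intersection number 0 with every cycle, because it runs around a bigon or triangle
  (\<open>R2_vanish\<close>, \<open>R3_vanish\<close>).

  The first fact yields the invariance of \<open>ip\<close>, hence of the signature, and of the parity. The
  second fact yields the relations between the parities of the crossings in a region: outside of
  it, the left halves of the two crossings of a bigon add up to the whole diagram, and the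
  left halves of the corners of a triangle, with the signs \<open>\<epsilon>\<^sub>\<Delta>\<close>, add up to a multiple \<open>m D\<close>
  (\<open>pair_halves\<close>, \<open>triangle_halves\<close>). The left hand sides of the parity relations thus have the
  exponents \<open>m sgn(u) (D \<cdot> D\<^sup>-\<^sub>u)\<close>. Since \<open>sgn(u) (D \<cdot> D\<^sup>-\<^sub>u) = D\<^sup>l\<^sub>u \<cdot> D\<close> (\<open>whole_minus_half\<close>), they are
  powers of the signature, which is trivial in the quotient.

  The geometric input is the sign of a crossing of two strands of a region. Strands are graphs of
  functions over an interval, so the sign is that of the slope of a difference of two functions at
  a simple zero, and it can be read off from the positions of the strands elsewhere.
\<close>

section \<open>Cyclic order on the parameter circle\<close>

lemma between_shift [simp]:
  "t + of_int n \<in> between p q \<longleftrightarrow> t \<in> between p q"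
  "t \<in> between (p + of_int n) q \<longleftrightarrow> t \<in> between p q"
  "t \<in> between p (q + of_int n) \<longleftrightarrow> t \<in> between p q"
proof -
  have *: "frac (x + of_int n - y) = frac (x - y)" "frac (x - (y + of_int n)) = frac (x - y)" for x y :: real
    using frac_add_of_int_right[of "x - y" n] frac_add_of_int_right[of "x - y" "-n"]
    by (simp_all add: algebra_simps)
  show "t + of_int n \<in> between p q \<longleftrightarrow> t \<in> between p q"
    "t \<in> between (p + of_int n) q \<longleftrightarrow> t \<in> between p q"
    "t \<in> between p (q + of_int n) \<longleftrightarrow> t \<in> between p q"
    unfolding between_def by (simp_all only: mem_Collect_eq *)
qed

lemma frac_shift: "frac x = x + of_int (- \<lfloor>x\<rfloor>)"
  by (simp add: frac_def)

lemma between_frac [simp]: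
  "t \<in> between (frac p) q \<longleftrightarrow> t \<in> between p q"
  "t \<in> between p (frac q) \<longleftrightarrow> t \<in> between p q"
  "frac t \<in> between p q \<longleftrightarrow> t \<in> between p q"
  by (simp_all only: frac_shift between_shift)

lemma between_iff:
  assumes "p \<le> t" "t < p + 1" "p \<le> q" "q < p + 1"
  shows "t \<in> between p q \<longleftrightarrow> p < t \<and> t < q"
proof -
  have "frac (t - p) = t - p" "frac (q - p) = q - p"
    using assms by (simp_all add: frac_eq)
  then show ?thesis by (simp add: between_def del: frac_gt_0_iff)
qed

lemma representative_after:
  fixes s t :: real
  obtains n :: int where "s \<le> t + of_int n" "t + of_int n < s + 1"
proof
  show "s \<le> t + of_int (- \<lfloor>t - s\<rfloor>)" "t + of_int (- \<lfloor>t - s\<rfloor>) < s + 1"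
    by (simp_all, linarith+)
qed

lemma frac_eq_int: "frac x = frac y \<longleftrightarrow> (\<exists>n::int. x = y + of_int n)"
proof
  assume "frac x = frac y"
  then show "\<exists>n::int. x = y + of_int n"
    by (intro exI[of _ "\<lfloor>x\<rfloor> - \<lfloor>y\<rfloor>"]) (simp add: frac_def)
qed auto

text \<open>
  Moving \<open>p\<close> inside an interval is invisible from outside of it. This is why a local move does not
  change which outer points lie in a half of the diagram.
\<close>

lemma between_move_left:
  assumes e: "e < s + 1" and p: "p \<in> {s..e}" "p' \<in> {s..e}"
    and t: "\<And>n::int. t + of_int n \<notin> {s..e}" and q: "\<And>n::int. q + of_int n \<notin> {s..e}"
  shows "t \<in> between p q \<longleftrightarrow> t \<in> between p' q"
proof -
  obtain n where n: "s \<le> t + of_int n" "t + of_int n < s + 1" by (rule representative_after)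
  obtain m where m: "s \<le> q + of_int m" "q + of_int m < s + 1" by (rule representative_after)
  have "t + of_int n > e" "q + of_int m > e" using t[of n] q[of m] n m by auto
  then have "t + of_int n \<in> between x (q + of_int m) \<longleftrightarrow> t + of_int n < q + of_int m"
    if "x \<in> {s..e}" for x
    using that n m by (subst between_iff) auto
  from this[OF p(1)] this[OF p(2)] show ?thesis by simp
qed

lemma between_compl:
  assumes "frac t \<noteq> frac p" "frac t \<noteq> frac q" "frac p \<noteq> frac q"
  shows "t \<in> between q p \<longleftrightarrow> t \<notin> between p q"
proof -
  obtain n where n: "p \<le> t + of_int n" "t + of_int n < p + 1" by (rule representative_after)
  obtain m where m: "p \<le> q + of_int m" "q + of_int m < p + 1" by (rule representative_after)
  define T where "T = t + of_int n"
  define Q where "Q = q + of_int m"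
  have ne: "T \<noteq> p" "T \<noteq> Q" "p \<noteq> Q"
    using assms unfolding T_def Q_def
    by (metis frac_add_of_int_right)+
  have 1: "t \<in> between p q \<longleftrightarrow> T \<in> between p Q" by (simp add: T_def Q_def)
  have 2: "T \<in> between p Q \<longleftrightarrow> T < Q"
    using n m ne by (subst between_iff) (auto simp: T_def Q_def)
  have 3: "t \<in> between q p \<longleftrightarrow> T \<in> between Q (p + of_int 1)"
    "t \<in> between q p \<longleftrightarrow> T + of_int 1 \<in> between Q (p + of_int 1)"
    by (simp_all only: T_def Q_def between_shift)
  show ?thesis
  proof (cases "T < Q")
    case True
    have "T + of_int 1 \<in> between Q (p + of_int 1) \<longleftrightarrow> False"
      using n m ne True by (subst between_iff) (auto simp: T_def Q_def)
    then show ?thesis using 1 2 3 True by blast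
  next
    case False
    have "T \<in> between Q (p + of_int 1) \<longleftrightarrow> True"
      using n m ne False by (subst between_iff) (auto simp: T_def Q_def)
    then show ?thesis using 1 2 3 False by blast
  qed
qed

lemma between_move_right:
  assumes e: "e < s + 1" and p: "p \<in> {s..e}" "p' \<in> {s..e}"
    and t: "\<And>n::int. t + of_int n \<notin> {s..e}" and q: "\<And>n::int. q + of_int n \<notin> {s..e}"
    and tq: "frac t \<noteq> frac q"
  shows "t \<in> between q p \<longleftrightarrow> t \<in> between q p'"
proof -
  have ne: "frac t \<noteq> frac x" "frac x \<noteq> frac q" if "x \<in> {s..e}" for x
    using t q that by (metis frac_eq_int)+
  show ?thesis
    using between_compl[of t p q] between_compl[of t p' q] ne[OF p(1)] ne[OF p(2)] tq
      between_move_left[OF e p t q] by blast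
qed

text \<open>
  Going from \<open>x0\<close> to \<open>x1\<close>, on to \<open>x2\<close> and back to \<open>x0\<close> winds around the circle once or twice,
  depending on the cyclic order of the three points, and passes every other point equally often.
\<close>

lemma between_three:
  assumes d: "frac x0 \<noteq> frac x1" "frac x0 \<noteq> frac x2" "frac x1 \<noteq> frac x2"
    and t: "frac t \<noteq> frac x0" "frac t \<noteq> frac x1" "frac t \<noteq> frac x2"
  shows "of_bool (t \<in> between x0 x1) + of_bool (t \<in> between x1 x2) + of_bool (t \<in> between x2 x0)
    = (if x1 \<in> between x0 x2 then 1 else 2 :: int)"
proof -
  obtain n where n: "x0 \<le> t + of_int n" "t + of_int n < x0 + 1" by (rule representative_after)
  obtain m1 where m1: "x0 \<le> x1 + of_int m1" "x1 + of_int m1 < x0 + 1" by (rule representative_after)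
  obtain m2 where m2: "x0 \<le> x2 + of_int m2" "x2 + of_int m2 < x0 + 1" by (rule representative_after)
  define T X1 X2 where "T = t + of_int n" and "X1 = x1 + of_int m1" and "X2 = x2 + of_int m2"
  have ne: "T \<noteq> x0" "T \<noteq> X1" "T \<noteq> X2" "X1 \<noteq> X2" "x0 \<noteq> X1" "x0 \<noteq> X2"
    using assms unfolding T_def X1_def X2_def by (metis frac_add_of_int_right)+
  have bd: "x0 < T" "x0 < X1" "x0 < X2" "T < x0 + 1" "X1 < x0 + 1" "X2 < x0 + 1"
    using ne n m1 m2 by (auto simp: T_def X1_def X2_def)
  have 1: "t \<in> between x0 x1 \<longleftrightarrow> T < X1" "t \<in> between x0 x2 \<longleftrightarrow> T < X2"
     "x1 \<in> between x0 x2 \<longleftrightarrow> X1 < X2"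
    using between_iff[of x0 T X1] between_iff[of x0 T X2] between_iff[of x0 X1 X2] bd
    by (auto simp: T_def X1_def X2_def)
  have 2: "t \<in> between x2 x0 \<longleftrightarrow> \<not> T < X2"
    using between_compl[OF t(1,3) d(2)] 1 by auto
  have 3: "t \<in> between x1 x2 \<longleftrightarrow> (if X1 < X2 then X1 < T \<and> T < X2 else X1 < T \<or> T < X2)"
  proof -
    have "t \<in> between x1 x2 \<longleftrightarrow> T \<in> between X1 X2"
      "t \<in> between x1 x2 \<longleftrightarrow> T + of_int 1 \<in> between X1 X2"
      "t \<in> between x1 x2 \<longleftrightarrow> T \<in> between X1 (X2 + of_int 1)"
      "t \<in> between x1 x2 \<longleftrightarrow> T + of_int 1 \<in> between X1 (X2 + of_int 1)"
      by (simp_all only: T_def X1_def X2_def between_shift)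
    then show ?thesis
      using between_iff[of X1 T X2] between_iff[of X1 "T + of_int 1" X2]
        between_iff[of X1 T "X2 + of_int 1"] between_iff[of X1 "T + of_int 1" "X2 + of_int 1"] bd ne
      by (smt (verit) of_int_1)
  qed
  show ?thesis using 1 2 3 ne by auto
qed

text \<open>
  A path can leave an arc of the circle only through one of its two end points.
\<close>

lemma between_segment:
  assumes t: "t \<in> between p q"
    and seg: "\<And>n::int. p + of_int n \<notin> closed_segment t t'" "\<And>n::int. q + of_int n \<notin> closed_segment t t'"
  shows "t' \<in> between p q"
proof -
  obtain n where n: "p \<le> t + of_int n" "t + of_int n < p + 1" by (rule representative_after)
  obtain m where m: "p \<le> q + of_int m" "q + of_int m < p + 1" by (rule representative_after)
  define T T' Q where "T = t + of_int n" and "T' = t' + of_int n" and "Q = q + of_int m"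
  have "T \<in> between p Q" using t by (simp add: T_def Q_def)
  then have T: "p < T" "T < Q" using between_iff[of p T Q] n m by (auto simp: T_def Q_def)
  have "p + of_int (-n) \<notin> closed_segment t t'" "q + of_int (m - n) \<notin> closed_segment t t'"
    using seg by blast+
  then have "p < T'" "T' < Q"
    using T unfolding T_def T'_def Q_def closed_segment_eq_real_ivl
    by (auto split: if_splits)
  then have "T' \<in> between p Q" using m by (subst between_iff) (auto simp: Q_def)
  then show ?thesis by (simp add: T'_def Q_def)
qed

section \<open>Crossings and their two parameters\<close>

locale diagram =
  fixes D :: vdiag
  assumes is_diagram: "is_diagram D"
begin

lemma curve_shift [simp]: "curve D (t + of_int n) = curve D t"
proof -
  have *: "curve D (t + 1) = curve D t" for t
    using is_diagram by (simp add: is_diagram_def)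
  show ?thesis
  proof (induction n rule: int_induct[where k = 0])
    case (step1 i)
    then show ?case using *[of "t + of_int i"] by (simp add: algebra_simps)
  next
    case (step2 i)
    then show ?case using *[of "t + of_int (i - 1)"] by (simp add: algebra_simps)
  qed simp
qed

lemma curve_frac [simp]: "curve D (frac t) = curve D t"
  by (simp only: frac_shift curve_shift)

lemma has_velocity: "(curve D has_vector_derivative velocity D t) (at t)"
  using is_diagram unfolding is_diagram_def velocity_def
  by (simp add: vector_derivative_works[symmetric])

lemma velocity_shift [simp]: "velocity D (t + of_int n) = velocity D t"
proof -
  have "((\<lambda>s. s + of_int n) has_vector_derivative 1) (at t)"
    by (auto intro!: derivative_eq_intros)
  then have "((curve D \<circ> (\<lambda>s. s + of_int n)) has_vector_derivative 1 *\<^sub>R velocity D (t + of_int n)) (at t)"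
    using has_velocity[of "t + of_int n"] by (rule vector_diff_chain_at)
  then have "(curve D has_vector_derivative velocity D (t + of_int n)) (at t)"
    by (simp add: o_def)
  then show ?thesis
    using has_velocity[of t] by (rule vector_derivative_unique_at)
qed

lemma velocity_frac [simp]: "velocity D (frac t) = velocity D t"
  by (simp only: frac_shift velocity_shift)

lemma wedge_flip: "wedge z w = - wedge w z"
  by (simp add: wedge_def)

lemma wedge_self: "wedge z z = 0"
  by (simp add: wedge_def)

lemma over_bounds: "p \<in> over D \<Longrightarrow> 0 \<le> p \<and> p < 1"
  using is_diagram unfolding is_diagram_def double_params_def by force

lemma no_triple:
  assumes "t1 \<in> {0..<1}" "t2 \<in> {0..<1}" "t3 \<in> {0..<1}"
    "curve D t1 = v" "curve D t2 = v" "curve D t3 = v"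
  shows "t1 = t2 \<or> t2 = t3 \<or> t1 = t3"
  using is_diagram assms unfolding is_diagram_def by metis

lemma transversal:
  assumes "t1 \<in> {0..<1}" "t2 \<in> {0..<1}" "curve D t1 = curve D t2" "t1 \<noteq> t2"
  shows "wedge (velocity D t1) (velocity D t2) \<noteq> 0"
  using is_diagram assms unfolding is_diagram_def by metis

lemma params_eqI:
  assumes p: "p \<in> {0..<1}" "curve D p = v" and q: "q \<in> {0..<1}" "curve D q = v"
    and pos: "wedge (velocity D p) (velocity D q) > 0"
  shows "ne_param D v = p" "nw_param D v = q"
proof -
  have pq: "p \<noteq> q" using pos by (auto simp: wedge_def)
  have any: "t = p \<or> t = q" if "t \<in> {0..<1}" "curve D t = v" for t
    using no_triple[of p q t v] p q that pq by auto
  have neg: "\<not> wedge (velocity D q) (velocity D p) > 0" "\<not> wedge (velocity D p) (velocity D p) > 0"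
    "\<not> wedge (velocity D q) (velocity D q) > 0"
    using pos wedge_flip[of "velocity D q" "velocity D p"] wedge_self by auto
  show "ne_param D v = p" unfolding ne_param_def
    by (rule the_equality) (use p q pos any neg in blast)+
  show "nw_param D v = q" unfolding nw_param_def
    by (rule the_equality) (use p q pos any neg in blast)+
qed

lemma crossing:
  assumes "v \<in> classical D"
  shows ne_param_in: "ne_param D v \<in> {0..<1}" and nw_param_in: "nw_param D v \<in> {0..<1}"
    and curve_ne [simp]: "curve D (ne_param D v) = v" and curve_nw [simp]: "curve D (nw_param D v) = v"
    and wedge_params: "wedge (velocity D (ne_param D v)) (velocity D (nw_param D v)) > 0"
proof -
  obtain p where p: "p \<in> over D" "curve D p = v" using assms by (auto simp: classical_def)
  then have "p \<in> double_params D" using is_diagram by (auto simp: is_diagram_def)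
  then obtain q where q: "p \<in> {0..<1}" "q \<in> {0..<1}" "q \<noteq> p" "curve D q = v"
    using p by (auto simp: double_params_def)
  have ne0: "wedge (velocity D p) (velocity D q) \<noteq> 0" using transversal[of p q] p q by auto
  have "(ne_param D v = p \<and> nw_param D v = q) \<or> (ne_param D v = q \<and> nw_param D v = p)"
    and pos: "wedge (velocity D (ne_param D v)) (velocity D (nw_param D v)) > 0"
  proof (atomize (full), cases "wedge (velocity D p) (velocity D q) > 0")
    case True
    then show "(ne_param D v = p \<and> nw_param D v = q \<or> ne_param D v = q \<and> nw_param D v = p) \<and>
      0 < wedge (velocity D (ne_param D v)) (velocity D (nw_param D v))"
      using params_eqI[of p v q] p q by simp
  next
    case False
    then have "wedge (velocity D q) (velocity D p) > 0"
      using ne0 wedge_flip[of "velocity D p" "velocity D q"] by simp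
    then show "(ne_param D v = p \<and> nw_param D v = q \<or> ne_param D v = q \<and> nw_param D v = p) \<and>
      0 < wedge (velocity D (ne_param D v)) (velocity D (nw_param D v))"
      using params_eqI[of q v p] p q by simp
  qed
  then show "ne_param D v \<in> {0..<1}" "nw_param D v \<in> {0..<1}" "curve D (ne_param D v) = v"
    "curve D (nw_param D v) = v" "wedge (velocity D (ne_param D v)) (velocity D (nw_param D v)) > 0"
    using p q by auto
qed

abbreviation params_are :: "complex \<Rightarrow> real \<Rightarrow> real \<Rightarrow> bool" where
  "params_are v p q \<equiv> ne_param D v = p \<and> nw_param D v = q"

lemma ne_neq_nw: "v \<in> classical D \<Longrightarrow> ne_param D v \<noteq> nw_param D v"
  using wedge_params[of v] by (auto simp: wedge_def)

lemma frac_params [simp]: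
  assumes "v \<in> classical D"
  shows "frac (ne_param D v) = ne_param D v" "frac (nw_param D v) = nw_param D v"
  using ne_param_in[OF assms] nw_param_in[OF assms] by simp_all

lemma param_cases:
  assumes "v \<in> classical D" "curve D t = v"
  shows "frac t = ne_param D v \<or> frac t = nw_param D v"
proof -
  have "frac t \<in> {0..<1}" by (simp add: frac_lt_1)
  then show ?thesis
    using no_triple[of "ne_param D v" "nw_param D v" "frac t" v] ne_param_in nw_param_in
      crossing(3,4) assms ne_neq_nw by auto
qed

lemma passages_iff:
  "t \<in> passages D \<longleftrightarrow> (\<exists>v \<in> classical D. frac t = ne_param D v \<or> frac t = nw_param D v)"
proof
  assume "t \<in> passages D"
  then show "\<exists>v \<in> classical D. frac t = ne_param D v \<or> frac t = nw_param D v"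
    using param_cases by (auto simp: passages_def)
next
  assume "\<exists>v \<in> classical D. frac t = ne_param D v \<or> frac t = nw_param D v"
  then obtain v where "v \<in> classical D" "frac t = ne_param D v \<or> frac t = nw_param D v" by blast
  then have "curve D (frac t) = v" using crossing(3,4) by metis
  then show "t \<in> passages D" using \<open>v \<in> classical D\<close> by (simp add: passages_def)
qed

lemma params_passages:
  "v \<in> classical D \<Longrightarrow> ne_param D v \<in> passages D"
  "v \<in> classical D \<Longrightarrow> nw_param D v \<in> passages D"
  by (simp_all add: passages_def)

lemma passages_shift [simp]: "t + of_int n \<in> passages D \<longleftrightarrow> t \<in> passages D"
  by (simp add: passages_def)

lemma finite_classical: "finite (classical D)"
  using is_diagram finite_subset[of "over D" "double_params D"]
  by (auto simp: is_diagram_def classical_def)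

lemma finite_passages: "finite (passages D \<inter> {a..b})"
proof -
  define P where "P = ne_param D ` classical D \<union> nw_param D ` classical D"
  have "passages D \<inter> {a..b} \<subseteq> (\<lambda>(x, n). x + of_int n) ` (P \<times> {\<lfloor>a\<rfloor>..\<lfloor>b\<rfloor>})"
  proof
    fix t assume t: "t \<in> passages D \<inter> {a..b}"
    then have "frac t \<in> P" by (auto simp: passages_iff P_def)
    moreover have "\<lfloor>t\<rfloor> \<in> {\<lfloor>a\<rfloor>..\<lfloor>b\<rfloor>}" using t by (auto intro: floor_mono)
    moreover have "t = frac t + of_int \<lfloor>t\<rfloor>" by (simp add: frac_def)
    ultimately show "t \<in> (\<lambda>(x, n). x + of_int n) ` (P \<times> {\<lfloor>a\<rfloor>..\<lfloor>b\<rfloor>})" by force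
  qed
  moreover have "finite P" unfolding P_def using finite_classical by simp
  ultimately show ?thesis by (meson finite_subset finite_imageI finite_SigmaI finite_atLeastAtMost_int)
qed

lemma passages_isolated:
  obtains e where "e > 0" "\<And>t. t \<noteq> p \<Longrightarrow> \<bar>t - p\<bar> < e \<Longrightarrow> t \<notin> passages D"
proof -
  obtain d where d: "d > 0" "\<forall>x \<in> passages D \<inter> {p - 1..p + 1}. x \<noteq> p \<longrightarrow> d \<le> dist p x"
    using finite_set_avoid[OF finite_passages] by blast
  show ?thesis
  proof
    show "min d 1 > 0" using d by simp
    show "t \<notin> passages D" if "t \<noteq> p" "\<bar>t - p\<bar> < min d 1" for t
    proof
      assume "t \<in> passages D"
      moreover have "t \<in> {p - 1..p + 1}" using that by auto
      ultimately have "d \<le> dist p t" using d(2) that(1) by blast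
      then show False using that by (simp add: dist_real_def abs_minus_commute)
    qed
qed
qed

lemma clear_after:
  assumes "e > 0"
  obtains t where "p < t" "t < p + e" "{p<..t} \<inter> passages D = {}"
proof -
  obtain d where d: "d > 0" "\<And>t. t \<noteq> p \<Longrightarrow> \<bar>t - p\<bar> < d \<Longrightarrow> t \<notin> passages D"
    using passages_isolated[of p] by blast
  show ?thesis
    using d assms by (intro that[of "p + min d e / 2"]) (auto simp: min_def abs_if split: if_splits)
qed

lemma clear_before:
  assumes "e > 0"
  obtains t where "t < p" "p - e < t" "{t..<p} \<inter> passages D = {}"
proof -
  obtain d where d: "d > 0" "\<And>t. t \<noteq> p \<Longrightarrow> \<bar>t - p\<bar> < d \<Longrightarrow> t \<notin> passages D"
    using passages_isolated[of p] by blast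
  show ?thesis
    using d assms by (intro that[of "p - min d e / 2"]) (auto simp: min_def abs_if split: if_splits)
qed


section \<open>Arcs\<close>

lemma arc_at_self: "t \<notin> passages D \<Longrightarrow> t \<in> arc_at D t"
  unfolding arc_at_def by (auto intro!: exI[of _ 0])

lemma arc_atI: "closed_segment t t' \<inter> passages D = {} \<Longrightarrow> t' \<in> arc_at D t"
  unfolding arc_at_def by (auto intro!: exI[of _ 0])

lemma segment_shift:
  "closed_segment (a + of_int n) (b + of_int n) \<inter> passages D = {} \<longleftrightarrow>
    closed_segment a b \<inter> passages D = {}"
proof -
  have "closed_segment (a + of_int n) (b + of_int n) = (\<lambda>x. x + of_int n) ` closed_segment a b"
    using closed_segment_translation[of "of_int n" a b] by (simp add: add.commute)
  then show ?thesis by auto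
qed

lemma arc_at_sym: "t' \<in> arc_at D t \<Longrightarrow> t \<in> arc_at D t'"
proof -
  assume "t' \<in> arc_at D t"
  then obtain n :: int where "closed_segment t (t' + of_int n) \<inter> passages D = {}"
    by (auto simp: arc_at_def)
  then have "closed_segment (t + of_int (-n)) (t' + of_int n + of_int (-n)) \<inter> passages D = {}"
    by (simp only: segment_shift)
  then have "closed_segment t' (t + of_int (-n)) \<inter> passages D = {}"
    by (simp add: closed_segment_commute)
  then show ?thesis unfolding arc_at_def by blast
qed

lemma arc_at_trans:
  assumes "t' \<in> arc_at D t" "t'' \<in> arc_at D t'"
  shows "t'' \<in> arc_at D t"
proof -
  obtain n :: int where n: "closed_segment t (t' + of_int n) \<inter> passages D = {}"
    using assms by (auto simp: arc_at_def)
  obtain m :: int where "closed_segment t' (t'' + of_int m) \<inter> passages D = {}"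
    using assms by (auto simp: arc_at_def)
  then have "closed_segment (t' + of_int n) (t'' + of_int m + of_int n) \<inter> passages D = {}"
    by (simp only: segment_shift)
  moreover have "closed_segment t (t'' + of_int m + of_int n) \<subseteq>
    closed_segment t (t' + of_int n) \<union> closed_segment (t' + of_int n) (t'' + of_int m + of_int n)"
    by (auto simp: closed_segment_eq_real_ivl)
  ultimately have "closed_segment t (t'' + of_int m + of_int n) \<inter> passages D = {}"
    using n by blast
  then have "closed_segment t (t'' + of_int (m + n)) \<inter> passages D = {}"
    by (simp add: algebra_simps)
  then show ?thesis unfolding arc_at_def by blast
qed

lemma arc_at_eq: "t' \<in> arc_at D t \<Longrightarrow> arc_at D t' = arc_at D t"
  using arc_at_sym arc_at_trans by blast

lemma arc_at_shift_mem: "t \<notin> passages D \<Longrightarrow> t + of_int n \<in> arc_at D t"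
  unfolding arc_at_def by (auto intro!: exI[of _ "-n"])

lemma arc_at_passage: "t \<in> passages D \<Longrightarrow> arc_at D t = {}"
  unfolding arc_at_def by auto

lemma arc_at_shift [simp]: "arc_at D (t + of_int n) = arc_at D t"
  using arc_at_eq[OF arc_at_shift_mem, of t n] arc_at_passage[of t] arc_at_passage[of "t + of_int n"]
  by (cases "t \<in> passages D") auto

lemma arcs_at: "a \<in> arcs D \<Longrightarrow> t \<in> a \<Longrightarrow> a = arc_at D t"
  unfolding arcs_def using arc_at_eq by auto

lemma arcs_no_passage: "a \<in> arcs D \<Longrightarrow> t \<in> a \<Longrightarrow> t \<notin> passages D"
  using arcs_at arc_at_passage by blast

lemma arc_at_in: "t \<notin> passages D \<Longrightarrow> arc_at D t \<in> arcs D"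
  unfolding arcs_def by auto

lemma arc_at_clear:
  "t \<le> t' \<Longrightarrow> {t..t'} \<inter> passages D = {} \<Longrightarrow> arc_at D t' = arc_at D t"
  by (rule arc_at_eq, rule arc_atI) (simp add: closed_segment_eq_real_ivl)

text \<open>
  The arc after \<open>p\<close> can be found from any later parameter that is reached without a passage. All
  values of chains at crossings are computed through this fact and its mirror image.
\<close>

lemma arc_out_eq:
  assumes "p < t" "{p<..t} \<inter> passages D = {}"
  shows "arc_out D p = arc_at D t"
  unfolding arc_out_def
proof (rule the_equality)
  have sub: "x \<in> arc_at D t" if "x \<in> {p<..t}" for x
    using that assms by (intro arc_atI) (auto simp: closed_segment_eq_real_ivl disjoint_iff)
  then have "{p<..<p + (t - p)} \<subseteq> arc_at D t" by force
  then show "arc_at D t \<in> arcs D \<and> (\<exists>e>0. {p<..<p + e} \<subseteq> arc_at D t)"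
    using assms by (intro conjI exI[of _ "t - p"] arc_at_in) auto
  fix a assume a: "a \<in> arcs D \<and> (\<exists>e>0. {p<..<p + e} \<subseteq> a)"
  then obtain e where e: "e > 0" "{p<..<p + e} \<subseteq> a" by blast
  define x where "x = p + min e (t - p) / 2"
  have "x \<in> {p<..<p + e}" "x \<in> {p<..t}"
    using e(1) assms(1) by (auto simp: x_def min_def field_simps)
  then show "a = arc_at D t" using arcs_at[of a x] a e sub[of x] arc_at_eq by blast
qed

lemma arc_in_eq:
  assumes "t < p" "{t..<p} \<inter> passages D = {}"
  shows "arc_in D p = arc_at D t"
  unfolding arc_in_def
proof (rule the_equality)
  have sub: "x \<in> arc_at D t" if "x \<in> {t..<p}" for x
    using that assms by (intro arc_atI) (auto simp: closed_segment_eq_real_ivl disjoint_iff)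
  then have "{p - (p - t)<..<p} \<subseteq> arc_at D t" by force
  then show "arc_at D t \<in> arcs D \<and> (\<exists>e>0. {p - e<..<p} \<subseteq> arc_at D t)"
    using assms by (intro conjI exI[of _ "p - t"] arc_at_in) auto
  fix a assume a: "a \<in> arcs D \<and> (\<exists>e>0. {p - e<..<p} \<subseteq> a)"
  then obtain e where e: "e > 0" "{p - e<..<p} \<subseteq> a" by blast
  define x where "x = p - min e (p - t) / 2"
  have "x \<in> {p - e<..<p}" "x \<in> {t..<p}"
    using e(1) assms(1) by (auto simp: x_def min_def field_simps)
  then show "a = arc_at D t" using arcs_at[of a x] a e sub[of x] arc_at_eq by blast
qed

lemma clear_shift:
  "{a<..b} \<inter> passages D = {} \<Longrightarrow> {a + of_int n<..b + of_int n} \<inter> passages D = {}"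
  "{a..<b} \<inter> passages D = {} \<Longrightarrow> {a + of_int n..<b + of_int n} \<inter> passages D = {}"
proof -
  have *: "x + of_int (- n) \<in> passages D" if "x \<in> passages D" for x
    using that by (simp only: passages_shift)
  show "{a<..b} \<inter> passages D = {} \<Longrightarrow> {a + of_int n<..b + of_int n} \<inter> passages D = {}"
    "{a..<b} \<inter> passages D = {} \<Longrightarrow> {a + of_int n..<b + of_int n} \<inter> passages D = {}"
    using * by (fastforce simp: disjoint_iff)+
qed

lemma arc_out_shift [simp]: "arc_out D (p + of_int n) = arc_out D p"
proof -
  obtain t where t: "p < t" "{p<..t} \<inter> passages D = {}" using clear_after[of 1 p] by auto
  have "{p + of_int n<..t + of_int n} \<inter> passages D = {}"
    using t(2) by (rule clear_shift)
  then show ?thesis using arc_out_eq[OF t] arc_out_eq[of "p + of_int n" "t + of_int n"] t by simp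
qed

lemma arc_in_shift [simp]: "arc_in D (p + of_int n) = arc_in D p"
proof -
  obtain t where t: "t < p" "{t..<p} \<inter> passages D = {}" using clear_before[of 1 p] by auto
  have "{t + of_int n..<p + of_int n} \<inter> passages D = {}"
    using t(2) by (rule clear_shift)
  then show ?thesis using arc_in_eq[OF t] arc_in_eq[of "t + of_int n" "p + of_int n"] t by simp
qed

lemma arc_out_frac [simp]: "arc_out D (frac p) = arc_out D p"
  and arc_in_frac [simp]: "arc_in D (frac p) = arc_in D p"
  by (simp_all only: frac_shift arc_out_shift arc_in_shift)

lemma arc_out_in_arcs [simp]: "arc_out D p \<in> arcs D"
proof -
  obtain t where t: "p < t" "{p<..t} \<inter> passages D = {}" using clear_after[of 1 p] by auto
  then show ?thesis unfolding arc_out_eq[OF t] by (intro arc_at_in) auto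
qed

lemma arc_in_in_arcs [simp]: "arc_in D p \<in> arcs D"
proof -
  obtain t where t: "t < p" "{t..<p} \<inter> passages D = {}" using clear_before[of 1 p] by auto
  then show ?thesis unfolding arc_in_eq[OF t] by (intro arc_at_in) auto
qed


section \<open>Halves as cycles\<close>

lemma arc_subset_between:
  assumes "t \<notin> passages D" "p \<in> passages D" "q \<in> passages D"
  shows "arc_at D t \<subseteq> between p q \<longleftrightarrow> t \<in> between p q"
proof
  show "arc_at D t \<subseteq> between p q \<Longrightarrow> t \<in> between p q" using arc_at_self[OF assms(1)] by blast
  assume t: "t \<in> between p q"
  show "arc_at D t \<subseteq> between p q"
  proof
    fix t' assume "t' \<in> arc_at D t"
    then obtain n :: int where n: "closed_segment t (t' + of_int n) \<inter> passages D = {}"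
      by (auto simp: arc_at_def)
    have "t' + of_int n \<in> between p q"
      using t by (rule between_segment) (use n assms passages_shift in blast)+
    then show "t' \<in> between p q" by simp
  qed
qed

lemma left_half_at:
  "v \<in> classical D \<Longrightarrow> t \<notin> passages D \<Longrightarrow>
    left_half D v (arc_at D t) = of_bool (t \<in> between (nw_param D v) (ne_param D v))"
  unfolding left_half_def by (simp add: arc_at_in arc_subset_between params_passages)

lemma right_half_at:
  assumes "v \<in> classical D" "t \<notin> passages D"
  shows "right_half D v (arc_at D t) = 1 - left_half D v (arc_at D t)"
proof -
  have "frac t \<noteq> frac (nw_param D v)" "frac t \<noteq> frac (ne_param D v)"
    using assms passages_iff by auto
  moreover have "frac (nw_param D v) \<noteq> frac (ne_param D v)"
    using assms(1) ne_neq_nw[of v] by auto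
  ultimately have "t \<in> between (ne_param D v) (nw_param D v) \<longleftrightarrow>
    t \<notin> between (nw_param D v) (ne_param D v)"
    by (rule between_compl)
  then show ?thesis
    unfolding left_half_at[OF assms]
    using assms by (simp add: right_half_def arc_at_in arc_subset_between params_passages)
qed

lemma right_half_eq:
  assumes "v \<in> classical D" "a \<in> arcs D"
  shows "right_half D v a = 1 - left_half D v a"
  using assms right_half_at[OF assms(1)] unfolding arcs_def by auto

text \<open>
  A half runs straight through every crossing except its own, where it turns.
\<close>

lemma left_half_through:
  assumes v: "v \<in> classical D" and p: "frac p \<noteq> nw_param D v" "frac p \<noteq> ne_param D v"
  shows "left_half D v (arc_in D p) = left_half D v (arc_out D p)"
proof -
  obtain t where t: "t < p" "{t..<p} \<inter> passages D = {}" using clear_before[of 1 p] by auto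
  obtain t' where t': "p < t'" "{p<..t'} \<inter> passages D = {}" using clear_after[of 1 p] by auto
  have np: "t \<notin> passages D" "t' \<notin> passages D" using t t' by auto
  have "x \<notin> closed_segment t t'" if "x \<in> passages D" "x \<noteq> p" for x
    using that t t' by (cases "x < p") (auto simp: closed_segment_eq_real_ivl disjoint_iff)
  moreover have "nw_param D v + of_int n \<noteq> p" "ne_param D v + of_int n \<noteq> p" for n
    using p frac_params[OF v] frac_add_of_int_right by metis+
  ultimately have seg: "nw_param D v + of_int n \<notin> closed_segment t t'"
    "ne_param D v + of_int n \<notin> closed_segment t t'" for n
    using params_passages[OF v] by simp_all
  have "t \<in> between (nw_param D v) (ne_param D v) \<longleftrightarrow> t' \<in> between (nw_param D v) (ne_param D v)"
    using between_segment[of t _ _ t'] between_segment[of t' _ _ t] seg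
    by (metis closed_segment_commute)
  then show ?thesis
    unfolding arc_in_eq[OF t] arc_out_eq[OF t'] left_half_at[OF v np(1)] left_half_at[OF v np(2)]
    by simp
qed

lemma left_half_turn:
  assumes v: "v \<in> classical D"
  shows "left_half D v (arc_out D (nw_param D v)) = 1" "left_half D v (arc_in D (nw_param D v)) = 0"
    "left_half D v (arc_in D (ne_param D v)) = 1" "left_half D v (arc_out D (ne_param D v)) = 0"
proof -
  let ?p = "nw_param D v" and ?q0 = "ne_param D v"
  obtain n where n: "?p \<le> ?q0 + of_int n" "?q0 + of_int n < ?p + 1" by (rule representative_after)
  define q where "q = ?q0 + of_int n"
  have qp: "q \<noteq> ?p"
    using ne_neq_nw[OF v] frac_params[OF v] unfolding q_def by (metis frac_add_of_int_right)
  have q: "?p < q" "q < ?p + 1" using n qp by (auto simp: q_def)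
  have betw: "t \<in> between ?p ?q0 \<longleftrightarrow> t \<in> between ?p q" for t by (simp add: q_def)
  have arcs_q: "arc_in D ?q0 = arc_in D q" "arc_out D ?q0 = arc_out D q" by (simp_all add: q_def)
  obtain t where t: "?p < t" "t < ?p + (q - ?p)" "{?p<..t} \<inter> passages D = {}"
    using clear_after[of "q - ?p" ?p] q by auto
  show "left_half D v (arc_out D ?p) = 1"
    unfolding arc_out_eq[OF t(1,3)]
    by (subst left_half_at[OF v]) (use t q between_iff[of ?p t q] betw in auto)
  obtain t where t: "t < q" "q - (q - ?p) < t" "{t..<q} \<inter> passages D = {}"
    using clear_before[of "q - ?p" q] q by auto
  show "left_half D v (arc_in D ?q0) = 1"
    unfolding arcs_q arc_in_eq[OF t(1,3)]
    by (subst left_half_at[OF v]) (use t q between_iff[of ?p t q] betw in auto)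
  obtain t where t: "q < t" "t < q + (?p + 1 - q)" "{q<..t} \<inter> passages D = {}"
    using clear_after[of "?p + 1 - q" q] q by auto
  show "left_half D v (arc_out D ?q0) = 0"
    unfolding arcs_q arc_out_eq[OF t(1,3)]
    by (subst left_half_at[OF v]) (use t q between_iff[of ?p t q] betw in auto)
  have "?p + 1 - q > 0" using q by simp
  then obtain t where t: "t < ?p + of_int 1" "?p + of_int 1 - (?p + 1 - q) < t"
    "{t..<?p + of_int 1} \<inter> passages D = {}"
    using clear_before[of "?p + 1 - q" "?p + of_int 1"] by blast
  have "arc_in D ?p = arc_at D t" using arc_in_eq[OF t(1,3)] arc_in_shift[of ?p 1] by simp
  then show "left_half D v (arc_in D ?p) = 0"
    by (simp only:, subst left_half_at[OF v]) (use t q between_iff[of ?p t q] betw in auto)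
qed

lemma params_of_other:
  assumes "v \<in> classical D" "w \<in> classical D" "v \<noteq> w"
  shows "ne_param D v \<noteq> ne_param D w" "ne_param D v \<noteq> nw_param D w"
    "nw_param D v \<noteq> ne_param D w" "nw_param D v \<noteq> nw_param D w"
  using crossing(3,4)[OF assms(1)] crossing(3,4)[OF assms(2)] assms(3) by metis+

text \<open>
  The condition of \<open>cycles\<close> for integral chains. Extensionality is left out because it would not
  survive forming linear combinations of the halves.
\<close>

definition int_cycle :: "(real set \<Rightarrow> int) \<Rightarrow> bool" where
  "int_cycle c \<longleftrightarrow> (\<forall>w \<in> classical D.
     c (arc_in D (ne_param D w)) + c (arc_in D (nw_param D w)) =
     c (arc_out D (ne_param D w)) + c (arc_out D (nw_param D w)))"

lemma int_cycle_left_half: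
  assumes "v \<in> classical D"
  shows "int_cycle (left_half D v)"
  unfolding int_cycle_def
proof
  fix w assume w: "w \<in> classical D"
  show "left_half D v (arc_in D (ne_param D w)) + left_half D v (arc_in D (nw_param D w)) =
     left_half D v (arc_out D (ne_param D w)) + left_half D v (arc_out D (nw_param D w))"
  proof (cases "w = v")
    case True
    then show ?thesis using left_half_turn[OF assms] by simp
  next
    case False
    then show ?thesis
      using left_half_through[OF assms] params_of_other[OF w assms False] frac_params[OF w] by simp
  qed
qed

lemma int_cycle_whole: "int_cycle (whole D)"
  by (simp add: int_cycle_def whole_def)

lemma int_cycle_right_half: "v \<in> classical D \<Longrightarrow> int_cycle (right_half D v)"
  using int_cycle_left_half[of v] by (fastforce simp: int_cycle_def right_half_eq)

lemma int_cycle_minus_half: "v \<in> classical D \<Longrightarrow> int_cycle (minus_half D v)"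
  using int_cycle_left_half int_cycle_right_half by (simp add: minus_half_def)

lemma int_cycle_add: "int_cycle c \<Longrightarrow> int_cycle c' \<Longrightarrow> int_cycle (\<lambda>a. c a + c' a)"
  by (fastforce simp: int_cycle_def)

lemma int_cycle_scale: "int_cycle c \<Longrightarrow> int_cycle (\<lambda>a. m * c a)"
  unfolding int_cycle_def by (simp add: distrib_left[symmetric])


section \<open>The intersection form\<close>

text \<open>
  What remains of the local intersection number if \<open>c\<close> is a cycle: the half-edge NE precedes the
  whole flow of \<open>c\<close>, which is 0 in total, and the half-edge SE precedes none of it.
\<close>

definition crossing_isect :: "(real set \<Rightarrow> int) \<Rightarrow> (real set \<Rightarrow> int) \<Rightarrow> complex \<Rightarrow> int" where
  "crossing_isect h c w = h (arc_in D (ne_param D w)) * c (arc_in D (nw_param D w))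
     - h (arc_out D (nw_param D w)) * c (arc_out D (ne_param D w))"

lemma local_intersection_cycle:
  assumes "int_cycle c" "w \<in> classical D"
  shows "local_intersection D h c w = crossing_isect h c w"
proof -
  have *: "c (arc_out D (nw_param D w)) = c (arc_in D (ne_param D w)) + c (arc_in D (nw_param D w))
      - c (arc_out D (ne_param D w))"
    using assms by (simp add: int_cycle_def)
  show ?thesis
    unfolding local_intersection_def crossing_isect_def Let_def disc_intersection_def
    by (simp add: numeral_eq_Suc * algebra_simps)
qed

lemma intersection_cycle:
  "int_cycle c \<Longrightarrow> intersection_number D h c = (\<Sum>w \<in> classical D. crossing_isect h c w)"
  unfolding intersection_number_def by (simp add: local_intersection_cycle)

lemma intersection_add_left:
  "int_cycle c \<Longrightarrow> intersection_number D (\<lambda>a. h a + h' a) c =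
    intersection_number D h c + intersection_number D h' c"
  by (simp add: intersection_cycle crossing_isect_def algebra_simps sum.distrib sum_subtractf)

lemma intersection_scale_left:
  "int_cycle c \<Longrightarrow> intersection_number D (\<lambda>a. m * h a) c = m * intersection_number D h c"
  by (simp add: intersection_cycle crossing_isect_def algebra_simps sum_distrib_left)

lemma intersection_add_right:
  "int_cycle c \<Longrightarrow> int_cycle c' \<Longrightarrow> intersection_number D h (\<lambda>a. c a + c' a) =
    intersection_number D h c + intersection_number D h c'"
  using int_cycle_add[of c c']
  by (simp add: intersection_cycle crossing_isect_def algebra_simps sum.distrib sum_subtractf)

lemma intersection_scale_right:
  "int_cycle c \<Longrightarrow> intersection_number D h (\<lambda>a. m * c a) = m * intersection_number D h c"
  using int_cycle_scale[of c m]
  by (simp add: intersection_cycle crossing_isect_def algebra_simps sum_distrib_left)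

text \<open>
  Against the whole diagram, which is constant 1, antisymmetry holds at every single crossing.
\<close>

lemma intersection_whole_left:
  assumes "int_cycle c"
  shows "intersection_number D (whole D) c = - intersection_number D c (whole D)"
proof -
  have "crossing_isect (whole D) c w = - crossing_isect c (whole D) w" if "w \<in> classical D" for w
    using assms that by (fastforce simp: crossing_isect_def whole_def int_cycle_def)
  then show ?thesis
    by (simp add: intersection_cycle assms int_cycle_whole sum_negf[symmetric])
qed

text \<open>
  The two halves add up to the whole diagram, whose self-intersection number is 0. So
  exchanging the halves changes the sign of the intersection number, and this is compensated by
  the writhe, which decides between the halves.
\<close>

lemma whole_minus_half:
  assumes u: "u \<in> classical D"
  shows "writhe D u * intersection_number D (whole D) (minus_half D u)
    = intersection_number D (left_half D u) (whole D)"
proof (cases "writhe D u = 1")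
  case True
  have "crossing_isect (right_half D u) (whole D) w = - crossing_isect (left_half D u) (whole D) w"
    if "w \<in> classical D" for w
    using int_cycle_left_half[OF u] that
    by (simp add: crossing_isect_def whole_def right_half_eq[OF u])
  then have "intersection_number D (right_half D u) (whole D) = - intersection_number D (left_half D u) (whole D)"
    by (simp add: intersection_cycle int_cycle_whole sum_negf[symmetric])
  then show ?thesis
    using True intersection_whole_left[OF int_cycle_right_half[OF u]] by (simp add: minus_half_def)
next
  case False
  then have "writhe D u = -1" by (simp add: writhe_def split: if_splits)
  then show ?thesis
    using intersection_whole_left[OF int_cycle_left_half[OF u]] by (simp add: minus_half_def)
qed

end

section \<open>The inside of a region\<close>

text \<open>
  The integer translates of an interval shorter than 1 leave a gap on the left of every point that
  they do not cover, and of the point \<open>s\<close> where one of them begins.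
\<close>

lemma eventually_left_gap:
  fixes s e c :: real
  assumes "e < s + 1" and c: "(\<forall>k::int. c \<notin> {s + of_int k..e + of_int k}) \<or> c = s"
  shows "eventually (\<lambda>t. \<forall>k::int. t \<notin> {s + of_int k..e + of_int k}) (at_left c)"
proof -
  \<comment> \<open>\<open>m\<close> is the index of the last translate that ends before \<open>c\<close>.\<close>
  obtain m :: int where m: "e + of_int m < c" "c \<le> s + of_int m + 1"
  proof (cases "c = s")
    case True
    then show ?thesis using assms(1) that[of "-1"] by simp
  next
    case False
    have "s + of_int \<lfloor>c - s\<rfloor> \<le> c" "c < s + of_int \<lfloor>c - s\<rfloor> + 1" by linarith+
    then show ?thesis using c False that[of "\<lfloor>c - s\<rfloor>"] by fastforce
  qed
  have "t \<notin> {s + of_int k..e + of_int k}" if t: "e + of_int m < t" "t < c" for t and k :: int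
  proof (cases "k \<le> m")
    case True
    then have "real_of_int k \<le> of_int m" by simp
    then show ?thesis using t by auto
  next
    case False
    then have "real_of_int k \<ge> of_int m + 1" by linarith
    then show ?thesis using t m by auto
  qed
  then show ?thesis using m(1) unfolding eventually_at_left_field by blast
qed

lemma eventually_right_gap:
  fixes s e c :: real
  assumes "e < s + 1" and c: "(\<forall>k::int. c \<notin> {s + of_int k..e + of_int k}) \<or> c = e"
  shows "eventually (\<lambda>t. \<forall>k::int. t \<notin> {s + of_int k..e + of_int k}) (at_right c)"
proof -
  obtain m :: int where m: "e + of_int m \<le> c" "c < s + of_int m + 1"
  proof (cases "c = e")
    case True
    then show ?thesis using assms(1) that[of 0] by simp
  next
    case False
    have "s + of_int \<lfloor>c - s\<rfloor> \<le> c" "c < s + of_int \<lfloor>c - s\<rfloor> + 1" by linarith+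
    then show ?thesis using c False that[of "\<lfloor>c - s\<rfloor>"] by fastforce
  qed
  have "t \<notin> {s + of_int k..e + of_int k}" if t: "c < t" "t < s + of_int m + 1" for t and k :: int
  proof (cases "k \<le> m")
    case True
    then have "real_of_int k \<le> of_int m" by simp
    then show ?thesis using t m by auto
  next
    case False
    then have "real_of_int k \<ge> of_int m + 1" by linarith
    then show ?thesis using t m by auto
  qed
  then show ?thesis using m(2) unfolding eventually_at_right_field by blast
qed

lemma no_zero_same_sign:
  fixes g :: "real \<Rightarrow> real"
  assumes "a \<le> b" "continuous_on {a..b} g" "\<And>z. z \<in> {a..b} \<Longrightarrow> g z \<noteq> 0"
  shows "g a > 0 \<longleftrightarrow> g b > 0"
proof (rule ccontr)
  assume "(g a > 0) \<noteq> (g b > 0)"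
  then have "g a \<le> 0 \<and> 0 \<le> g b \<or> g b \<le> 0 \<and> 0 \<le> g a" by auto
  then obtain z where "z \<in> {a..b}" "g z = 0"
    using IVT'[of g a 0 b] IVT2'[of g b 0 a] assms(1,2) by auto
  then show False using assms(3) by blast
qed

text \<open>
  Used for the difference \<open>g\<close> of two strands: the sign of their crossing can be seen at any later
  position \<open>y\<close>, as long as the strands do not meet again before.
\<close>

lemma deriv_sign_right:
  fixes g :: "real \<Rightarrow> real"
  assumes g: "(g has_real_derivative m) (at x)" "m \<noteq> 0" "g x = 0"
    and y: "x < y" "continuous_on {x..y} g" "\<And>z. z \<in> {x<..y} \<Longrightarrow> g z \<noteq> 0"
  shows "m > 0 \<longleftrightarrow> g y > 0"
proof -
  have same: "g z > 0 \<longleftrightarrow> g y > 0" if "x < z" "z \<le> y" for z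
    by (rule no_zero_same_sign) (use that y continuous_on_subset[OF y(2)] in auto)

  show ?thesis
  proof (cases "m > 0")
    case True
    then obtain d where d: "d > 0" "\<And>h. 0 < h \<Longrightarrow> h < d \<Longrightarrow> g x < g (x + h)"
      using DERIV_pos_inc_right[OF g(1)] by blast
    define h where "h = min d (y - x) / 2"
    have "0 < h" "h < d" "x < x + h" "x + h \<le> y" using d(1) y(1) by (simp_all add: h_def min_def field_simps)
    then show ?thesis using True same[of "x + h"] d(2)[of h] g(3) by simp
  next
    case False
    then have "m < 0" using g(2) by simp
    then obtain d where d: "d > 0" "\<And>h. 0 < h \<Longrightarrow> h < d \<Longrightarrow> g x > g (x + h)"
      using DERIV_neg_dec_right[OF g(1)] by blast
    define h where "h = min d (y - x) / 2"
    have "0 < h" "h < d" "x < x + h" "x + h \<le> y" using d(1) y(1) by (simp_all add: h_def min_def field_simps)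
    then show ?thesis using False same[of "x + h"] d(2)[of h] g(3) by simp
  qed
qed

lemma deriv_sign_left:
  fixes g :: "real \<Rightarrow> real"
  assumes g: "(g has_real_derivative m) (at x)" "m \<noteq> 0" "g x = 0"
    and y: "y < x" "continuous_on {y..x} g" "\<And>z. z \<in> {y..<x} \<Longrightarrow> g z \<noteq> 0"
  shows "m > 0 \<longleftrightarrow> g y < 0"
proof -
  have "((\<lambda>z. g (- z)) has_real_derivative - m) (at (- x))"
    using DERIV_mirror[of g m x] g(1) by (metis DERIV_mirror minus_minus)
  moreover have "continuous_on {- x..- y} (\<lambda>z. g (- z))"
    by (rule continuous_on_compose2[OF y(2)]) (auto intro!: continuous_intros)
  ultimately have "- m > 0 \<longleftrightarrow> g (- (- y)) > 0"
    using g(2,3) y(1,3) by (intro deriv_sign_right[where x = "- x"]) auto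
  moreover have "g y \<noteq> 0" using y by auto
  ultimately show ?thesis using g(2) by auto
qed

lemma wedge_scale: "wedge (r *\<^sub>R z) (s *\<^sub>R w) = r * s * wedge z w"
  by (simp add: wedge_def algebra_simps)

lemma wedge_linear:
  assumes "linear L"
  shows "wedge (L z) (L w) = wedge (L 1) (L \<i>) * wedge z w"
proof -
  have *: "L z = Re z *\<^sub>R L 1 + Im z *\<^sub>R L \<i>" for z
  proof -
    have "z = Re z *\<^sub>R 1 + Im z *\<^sub>R \<i>" by (simp add: complex_eq_iff)
    then show ?thesis using linear_add[OF assms] linear_scale[OF assms] by metis
  qed
  show ?thesis unfolding *[of z] *[of w] by (simp add: wedge_def algebra_simps)
qed

text \<open>
  A local picture alone does not exclude that two strands meet on the boundary of the region; the
  locale \<open>picture\<close> below does. For the diagrams of a move this is a consequence of having two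
  pictures with the same boundary values.
\<close>

locale picture_no_ends = diagram D for D :: vdiag +
  fixes T :: region and n :: nat and f :: "nat \<Rightarrow> real \<Rightarrow> real"
  assumes region: "is_region T n" and picture: "local_picture D T n f"
begin

abbreviation st :: "nat \<Rightarrow> real \<Rightarrow> real" where "st \<equiv> strand_time T"

lemma strand_bounds:
  assumes "i < n"
  shows "start T i < stop T i" "stop T i < start T i + 1"
  using assms region by (auto simp: is_region_def)

lemma dir_cases: "i < n \<Longrightarrow> dir T i = 1 \<or> dir T i = - 1"
  using region by (auto simp: is_region_def)

lemma strands_disjoint:
  assumes "i < n" "j < n" "i \<noteq> j" "t \<in> {start T i..stop T i}"
  shows "t + of_int k \<notin> {start T j..stop T j}" "t \<notin> {start T j + of_int k..stop T j + of_int k}"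
proof -
  have *: "t \<notin> {start T j + of_int k..stop T j + of_int k}" for k
    using region assms unfolding is_region_def by blast
  from *[of k] show "t \<notin> {start T j + of_int k..stop T j + of_int k}" .
  from *[of "- k"] show "t + of_int k \<notin> {start T j..stop T j}" by auto
qed

lemma st_bounds:
  assumes "i < n" "x \<in> {-1..1}"
  shows "st i x \<in> {start T i..stop T i}"
proof -
  have "0 \<le> (dir T i * x + 1) / 2" "(dir T i * x + 1) / 2 \<le> 1"
    using dir_cases[OF assms(1)] assms(2) by auto
  then have "0 \<le> (stop T i - start T i) * ((dir T i * x + 1) / 2)"
    "(stop T i - start T i) * ((dir T i * x + 1) / 2) \<le> (stop T i - start T i) * 1"
    using strand_bounds(1)[OF assms(1)] by (intro mult_nonneg_nonneg mult_left_mono; simp)+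
  then show ?thesis by (simp add: strand_time_def)
qed

lemma st_less: "i < n \<Longrightarrow> st i x < st i y \<longleftrightarrow> dir T i * x < dir T i * y"
  using strand_bounds(1)[of i] by (simp add: strand_time_def divide_strict_right_mono
      flip: mult_less_cancel_left_pos[of "stop T i - start T i" "dir T i * x + 1" "dir T i * y + 1"])

lemma st_surj:
  assumes "i < n" "t \<in> {start T i..stop T i}"
  obtains x where "x \<in> {-1..1}" "t = st i x"
proof
  define y where "y = (t - start T i) / (stop T i - start T i)"
  have y: "0 \<le> y" "y \<le> 1" "t = start T i + (stop T i - start T i) * y"
    using strand_bounds[OF assms(1)] assms(2) by (auto simp: y_def field_simps)
  let ?x = "dir T i * (2 * y - 1)"
  show "?x \<in> {-1..1}" "t = st i ?x"
    using y dir_cases[OF assms(1)] by (auto simp: strand_time_def field_simps)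
qed

lemma st_inj:
  assumes "i < n" "j < n" "x \<in> {-1..1}" "y \<in> {-1..1}" "frac (st i x) = frac (st j y)"
  shows "i = j \<and> x = y"
proof -
  obtain k :: int where k: "st i x = st j y + of_int k" using assms(5) frac_eq_int by blast
  show ?thesis
  proof (cases "i = j")
    case True
    have "\<bar>st i x - st i y\<bar> < 1"
      using st_bounds[OF assms(1,3)] st_bounds[OF assms(1,4)] strand_bounds[OF assms(1)] by auto
    then have "k = 0" using k True by simp
    then have "\<not> st i x < st i y" "\<not> st i y < st i x" using k True by auto
    then have "\<not> dir T i * x < dir T i * y" "\<not> dir T i * y < dir T i * x"
      using st_less[OF assms(1)] by metis+
    then show ?thesis using True dir_cases[OF assms(1)] by auto
  next
    case False
    have "st j y + of_int k \<in> {start T i..stop T i}" using st_bounds[OF assms(1,3)] k by simp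
    then show ?thesis
      using strands_disjoint(1)[of j i "st j y" k] st_bounds[OF assms(2,4)] assms(1,2) False by blast
  qed
qed

lemma inside_iff:
  "curve D t \<in> domain_of T \<longleftrightarrow>
    (\<exists>i<n. \<exists>k::int. t \<in> {start T i + of_int k..stop T i + of_int k})"
  using picture unfolding local_picture_def by (auto simp: set_eq_iff)

lemma insideE:
  assumes "curve D t \<in> domain_of T"
  obtains i x k where "i < n" "x \<in> {-1..1}" "t = st i x + of_int k" "frac t = frac (st i x)"
proof -
  obtain i and k :: int where i: "i < n" "t \<in> {start T i + of_int k..stop T i + of_int k}"
    using assms inside_iff by auto
  then have "t - of_int k \<in> {start T i..stop T i}" by auto
  then obtain x where x: "x \<in> {-1..1}" "t - of_int k = st i x" using st_surj[OF i(1)] by blast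
  then have t: "t = st i x + of_int k" by simp
  then show ?thesis using that[OF i(1) x(1) t] by simp
qed

lemma outside_shift:
  assumes "curve D t \<notin> domain_of T" "i < n"
  shows "t + of_int k \<notin> {start T i..stop T i}"
proof
  assume "t + of_int k \<in> {start T i..stop T i}"
  then have "t \<in> {start T i + of_int (- k)..stop T i + of_int (- k)}" by auto
  then show False using assms inside_iff by blast
qed

lemma curve_st:
  assumes "i < n" "x \<in> {-1..1}"
  shows "curve D (st i x) = graph_point T f i x" "\<bar>f i x\<bar> < 1"
  using picture assms unfolding local_picture_def by auto

lemma chart:
  shows emb_inj: "inj_on (emb T) square"
    and emb_derivative: "\<forall>z \<in> square. \<exists>L. (emb T has_derivative L) (at z) \<and> wedge (L 1) (L \<i>) > 0"
proof -
  have "is_chart (emb T)" using region by (simp add: is_region_def)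
  then obtain U L where "open U \<and> square \<subseteq> U \<and> inj_on (emb T) U"
    "\<forall>z \<in> U. (emb T has_derivative L z) (at z) \<and> wedge (L z 1) (L z \<i>) > 0"
    unfolding is_chart_def by metis
  then show "inj_on (emb T) square"
    "\<forall>z \<in> square. \<exists>L. (emb T has_derivative L) (at z) \<and> wedge (L 1) (L \<i>) > 0"
    by (auto intro: inj_on_subset)
qed

lemma in_square:
  assumes "i < n" "x \<in> {-1..1}"
  shows "Complex x (f i x) \<in> square"
  using curve_st(2)[OF assms] assms(2) by (auto simp: square_def)

lemma graph_point_inj:
  assumes "i < n" "j < n" "x \<in> {-1..1}" "y \<in> {-1..1}" "graph_point T f i x = graph_point T f j y"
  shows "x = y \<and> f i x = f j y"
proof -
  have "Complex x (f i x) = Complex y (f j y)"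
    using inj_onD[OF emb_inj] in_square assms unfolding graph_point_def by blast
  then show ?thesis unfolding complex.inject .
qed

lemma isCont_curve: "isCont (curve D) t"
  using has_vector_derivative_continuous[OF has_velocity] .

text \<open>
  The curve is outside of the region just before a strand begins, because the parameter intervals
  of the strands are closed and disjoint.
\<close>

lemma outside_before:
  assumes "i < n"
  shows "eventually (\<lambda>t. curve D t \<notin> domain_of T) (at_left (start T i))"
proof -
  have "\<forall>j \<in> {..<n}. eventually (\<lambda>t. \<forall>k::int. t \<notin> {start T j + of_int k..stop T j + of_int k}) (at_left (start T i))"
  proof
    fix j assume "j \<in> {..<n}"
    then show "eventually (\<lambda>t. \<forall>k::int. t \<notin> {start T j + of_int k..stop T j + of_int k}) (at_left (start T i))"
      using strands_disjoint(2)[OF assms, of j "start T i"] strand_bounds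
      by (intro eventually_left_gap) (auto simp: less_imp_le assms)
  qed
  then have "eventually (\<lambda>t. \<forall>j \<in> {..<n}. \<forall>k::int. t \<notin> {start T j + of_int k..stop T j + of_int k}) (at_left (start T i))"
    by (simp add: eventually_ball_finite)
  then show ?thesis by (rule eventually_mono) (use inside_iff in blast)
qed

lemma outside_after:
  assumes "i < n"
  shows "eventually (\<lambda>t. curve D t \<notin> domain_of T) (at_right (stop T i))"
proof -
  have "\<forall>j \<in> {..<n}. eventually (\<lambda>t. \<forall>k::int. t \<notin> {start T j + of_int k..stop T j + of_int k}) (at_right (stop T i))"
  proof
    fix j assume "j \<in> {..<n}"
    then show "eventually (\<lambda>t. \<forall>k::int. t \<notin> {start T j + of_int k..stop T j + of_int k}) (at_right (stop T i))"
      using strands_disjoint(2)[OF assms, of j "stop T i"] strand_bounds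
      by (intro eventually_right_gap) (auto simp: less_imp_le assms)
  qed
  then have "eventually (\<lambda>t. \<forall>j \<in> {..<n}. \<forall>k::int. t \<notin> {start T j + of_int k..stop T j + of_int k}) (at_right (stop T i))"
    by (simp add: eventually_ball_finite)
  then show ?thesis by (rule eventually_mono) (use inside_iff in blast)
qed

text \<open>
  The strand is the image of a graph under the chart; comparing both expressions for its
  derivative expresses the velocity through the slope of the graph.
\<close>

lemma velocity_st:
  assumes i: "i < n" and x: "-1 < x" "x < 1"
    and L: "(emb T has_derivative L) (at (Complex x (f i x)))"
    and m: "(f i has_real_derivative m) (at x)"
  shows "velocity D (st i x) = (2 * dir T i / (stop T i - start T i)) *\<^sub>R L (Complex 1 m)"
proof -
  define r where "r = (stop T i - start T i) * dir T i / 2"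
  have "(st i has_vector_derivative r) (at x)"
    unfolding strand_time_def r_def
    by (auto simp: has_real_derivative_iff_has_vector_derivative[symmetric] intro!: derivative_eq_intros)
  then have 1: "((curve D \<circ> st i) has_vector_derivative r *\<^sub>R velocity D (st i x)) (at x)"
    using has_velocity by (rule vector_diff_chain_at)
  have "((\<lambda>y. y *\<^sub>R 1 + f i y *\<^sub>R \<i>) has_vector_derivative 1 *\<^sub>R 1 + m *\<^sub>R \<i>) (at x)"
    using m by (intro derivative_intros) (auto intro!: derivative_eq_intros
      simp: has_real_derivative_iff_has_vector_derivative)
  moreover have cplx: "y *\<^sub>R 1 + z *\<^sub>R \<i> = Complex y z" for y z :: real
    by (simp add: complex_eq_iff)
  ultimately have "((\<lambda>y. Complex y (f i y)) has_vector_derivative Complex 1 m) (at x)"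
    by (simp only: cplx)
  then have "((emb T \<circ> (\<lambda>y. Complex y (f i y))) has_vector_derivative L (Complex 1 m)) (at x)"
    by (rule vector_derivative_diff_chain_within) (use L has_derivative_at_withinI in auto)
  then have "((curve D \<circ> st i) has_vector_derivative L (Complex 1 m)) (at x)"
    by (rule has_vector_derivative_transform_within_open[where S = "{-1<..<1}"])
      (use x curve_st[OF i] in \<open>auto simp: graph_point_def\<close>)
  then have "r *\<^sub>R velocity D (st i x) = L (Complex 1 m)"
    using 1 vector_derivative_unique_at by blast
  moreover have "r \<noteq> 0" using strand_bounds(1)[OF i] dir_cases[OF i] by (auto simp: r_def)
  then have "(1 / r) *\<^sub>R (r *\<^sub>R velocity D (st i x)) = velocity D (st i x)" by simp
  ultimately have "velocity D (st i x) = (1 / r) *\<^sub>R L (Complex 1 m)" by simp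
  also have "1 / r = 2 * dir T i / (stop T i - start T i)"
    using dir_cases[OF i] strand_bounds(1)[OF i] by (auto simp: r_def divide_simps)
  finally show ?thesis .
qed

lemma crossing_frac_neq:
  assumes "i < n" "j < n" "i \<noteq> j" "x \<in> {-1..1}"
  shows "frac (st i x) \<noteq> frac (st j x)"
  using st_inj[OF assms(1,2,4,4)] assms(3) by blast

lemma meet_same_point:
  assumes "f i x = f j x"
  shows "graph_point T f i x = graph_point T f j x"
  using assms by (simp add: graph_point_def)

text \<open>
  The picture puts the upper strand into \<open>over\<close>; at most one strand can be there, since the curve
  is injective on \<open>over\<close>.
\<close>

lemma over_crossing:
  assumes "i < n" "j < n" "i \<noteq> j" "x \<in> {-1..1}" "f i x = f j x"
  shows "frac (st j x) \<in> over D \<longleftrightarrow> layer T i < layer T j"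
proof -
  have lay: "layer T i \<noteq> layer T j"
    using region assms unfolding is_region_def inj_on_def by blast
  have *: "frac (st l x) \<in> over D" if "k < n" "l < n" "layer T k < layer T l" "f k x = f l x" for k l
    using picture that assms(4) unfolding local_picture_def by blast
  have "frac (st i x) \<notin> over D \<or> frac (st j x) \<notin> over D"
    using is_diagram crossing_frac_neq[OF assms(1-4)] curve_st(1) assms meet_same_point[OF assms(5)]
    unfolding is_diagram_def inj_on_def by (metis curve_frac)
  then show ?thesis
    using *[OF assms(1,2) _ assms(5)] *[OF assms(2,1) _ assms(5)[symmetric]] lay
    by (metis linorder_neqE_nat less_asym)
qed

lemma meet_classical:
  assumes "i < n" "j < n" "i \<noteq> j" "x \<in> {-1..1}" "f i x = f j x"
  shows "graph_point T f i x \<in> classical D"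
proof -
  have "frac (st i x) \<in> over D \<or> frac (st j x) \<in> over D"
    using over_crossing[OF assms] over_crossing[of j i x] assms region
    unfolding is_region_def inj_on_def by (metis lessThan_iff linorder_neqE_nat)
  moreover have "curve D (frac (st i x)) = graph_point T f i x" "curve D (frac (st j x)) = graph_point T f i x"
    using curve_st(1) meet_same_point[OF assms(5)] assms by auto
  ultimately show ?thesis unfolding classical_def by (metis imageI)
qed

lemma meet_domain: "i < n \<Longrightarrow> x \<in> {-1..1} \<Longrightarrow> graph_point T f i x \<in> domain_of T"
  unfolding domain_of_def graph_point_def using in_square by blast

lemma classical_inside:
  assumes "v \<in> classical D" "v \<in> domain_of T"
  obtains i j x where "i < n" "j < n" "i \<noteq> j" "x \<in> {-1..1}" "f i x = f j x" "v = graph_point T f i x"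
    "ne_param D v = frac (st i x)" "nw_param D v = frac (st j x)"
proof -
  obtain i x where i: "i < n" "x \<in> {-1..1}" "ne_param D v = frac (st i x)"
    using insideE[of "ne_param D v"] assms frac_params crossing(3) by metis
  obtain j y where j: "j < n" "y \<in> {-1..1}" "nw_param D v = frac (st j y)"
    using insideE[of "nw_param D v"] assms frac_params crossing(4) by metis
  have v: "v = graph_point T f i x" "v = graph_point T f j y"
    using crossing(3,4)[OF assms(1)] i j curve_st(1) by auto
  then have xy: "x = y" "f i x = f j y" using graph_point_inj i j by metis+
  moreover have "i \<noteq> j" using xy i j ne_neq_nw[OF assms(1)] by auto
  ultimately show ?thesis using that i j v by blast
qed

lemma passage_st:
  assumes "i < n" "x \<in> {-1..1}"
  shows "st i x \<in> passages D \<longleftrightarrow> (\<exists>j<n. j \<noteq> i \<and> f j x = f i x)"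
proof
  assume "st i x \<in> passages D"
  then have v: "graph_point T f i x \<in> classical D" using curve_st(1)[OF assms] by (simp add: passages_def)
  then obtain j k y where *: "j < n" "k < n" "j \<noteq> k" "y \<in> {-1..1}" "f j y = f k y"
    "graph_point T f i x = graph_point T f j y"
    using classical_inside[OF v meet_domain[OF assms]] by metis
  then have "x = y" "f i x = f j y" using graph_point_inj assms by metis+
  then show "\<exists>j<n. j \<noteq> i \<and> f j x = f i x" using * by metis
next
  assume "\<exists>j<n. j \<noteq> i \<and> f j x = f i x"
  then show "st i x \<in> passages D"
    using meet_classical[OF assms(1) _ _ assms(2)] curve_st(1)[OF assms] by (auto simp: passages_def)
qed

lemma outer_params:
  assumes "v \<in> classical D" "v \<notin> domain_of T"
  shows "curve D (ne_param D v) \<notin> domain_of T" "curve D (nw_param D v) \<notin> domain_of T"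
  using crossing(3,4)[OF assms(1)] assms(2) by auto

lemma outside_open:
  assumes "curve D p \<notin> domain_of T"
  obtains e where "e > 0" "\<And>t. \<bar>t - p\<bar> < e \<Longrightarrow> curve D t \<notin> domain_of T"
proof -
  have sq: "square = cbox (Complex (-1) (-1)) (Complex 1 1)"
    by (auto simp: square_def in_cbox_complex_iff abs_le_iff)
  have "continuous_on square (emb T)"
    using emb_derivative by (metis continuous_at_imp_continuous_on has_derivative_continuous)
  then have "compact (domain_of T)"
    unfolding domain_of_def sq by (intro compact_continuous_image) auto
  then have "open (curve D -` (- domain_of T))"
    using isCont_curve by (intro open_vimage) (auto simp: compact_imp_closed continuous_at_imp_continuous_on open_Compl)
  then obtain e where "e > 0" "\<And>t. dist t p < e \<Longrightarrow> t \<in> curve D -` (- domain_of T)"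
    using assms by (metis Compl_iff open_dist vimageI2)
  then show ?thesis using that by (auto simp: dist_real_def)
qed

end

locale picture = picture_no_ends +
  assumes ends: "\<And>i j x. i < n \<Longrightarrow> j < n \<Longrightarrow> i \<noteq> j \<Longrightarrow> x \<in> {-1, 1} \<Longrightarrow> f i x \<noteq> f j x"
begin

lemma meet_inner:
  assumes "i < n" "j < n" "i \<noteq> j" "x \<in> {-1..1}" "f i x = f j x"
  shows "-1 < x" "x < 1"
proof -
  have "x \<noteq> -1" "x \<noteq> 1" using ends[OF assms(1-3), of x] assms(5) by auto
  then show "-1 < x" "x < 1" using assms(4) by auto
qed

lemma strand_continuous: "i < n \<Longrightarrow> continuous_on {-1..1} (f i)"
  using picture unfolding local_picture_def by (auto intro: differentiable_imp_continuous_on)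

text \<open>
  The chart preserves orientation, so the sign of a crossing is that of the difference of the two
  slopes, corrected by the directions in which the strands run.
\<close>

lemma crossing_slope:
  assumes ij: "i < n" "j < n" "i \<noteq> j" and x: "x \<in> {-1..1}" "f i x = f j x"
  obtains m where "((\<lambda>y. f j y - f i y) has_real_derivative m) (at x)" "m \<noteq> 0"
    "wedge (velocity D (st i x)) (velocity D (st j x)) > 0 \<longleftrightarrow> dir T i * dir T j * m > 0"
proof -
  have inner: "-1 < x" "x < 1" using meet_inner[OF ij x] .
  have diff: "\<exists>m. (f k has_real_derivative m) (at x)" if "k < n" for k
  proof -
    have "f k differentiable (at x within {-1..1})"
      using picture that x unfolding local_picture_def differentiable_on_def by auto
    then have "f k differentiable (at x)"
      using inner at_within_interior[of x "{-1..1}"] by (simp add: interior_atLeastAtMost_real)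
    then show ?thesis by (simp add: real_differentiable_def)
  qed
  obtain mi where mi: "(f i has_real_derivative mi) (at x)" using diff ij by blast
  obtain mj where mj: "(f j has_real_derivative mj) (at x)" using diff ij by blast
  obtain L where Li: "(emb T has_derivative L) (at (Complex x (f i x)))" and L: "wedge (L 1) (L \<i>) > 0"
    using emb_derivative in_square[OF ij(1) x(1)] by blast
  have Lj: "(emb T has_derivative L) (at (Complex x (f j x)))" using Li x(2) by simp
  define ci where "ci = 2 / (stop T i - start T i)"
  define cj where "cj = 2 / (stop T j - start T j)"
  define d where "d = wedge (L 1) (L \<i>)"
  have pos: "ci > 0" "cj > 0" "d > 0"
    using strand_bounds(1) ij L by (auto simp: ci_def cj_def d_def)
  have w: "wedge (velocity D (st i x)) (velocity D (st j x))
    = (ci * cj * d) * (dir T i * dir T j * (mj - mi))"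
    unfolding velocity_st[OF ij(1) inner Li mi] velocity_st[OF ij(2) inner Lj mj] wedge_scale
      wedge_linear[OF has_derivative_linear[OF Li], of "Complex 1 mi" "Complex 1 mj"]
    by (simp add: ci_def cj_def d_def wedge_def[of "Complex 1 mi"] mult_ac)
  have "curve D (frac (st i x)) = curve D (frac (st j x))"
    using curve_st(1) meet_same_point[OF x(2)] ij x by simp
  then have "wedge (velocity D (st i x)) (velocity D (st j x)) \<noteq> 0"
    using transversal[of "frac (st i x)" "frac (st j x)"] crossing_frac_neq[OF ij x(1)]
    by (simp add: frac_lt_1)
  then have "mj - mi \<noteq> 0" using w by auto
  moreover have "((\<lambda>y. f j y - f i y) has_real_derivative mj - mi) (at x)"
    using mi mj by (auto intro!: derivative_eq_intros)
  moreover have "wedge (velocity D (st i x)) (velocity D (st j x)) > 0 \<longleftrightarrow> dir T i * dir T j * (mj - mi) > 0"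
    unfolding w zero_less_mult_iff[of "ci * cj * d"]
    using mult_pos_pos[OF mult_pos_pos[OF pos(1,2)] pos(3)] by (metis less_asym)
  ultimately show ?thesis using that by blast
qed

lemma params_of_meet:
  assumes ij: "i < n" "j < n" "i \<noteq> j" and x: "x \<in> {-1..1}" "f i x = f j x"
  shows "if wedge (velocity D (st i x)) (velocity D (st j x)) > 0
    then params_are (graph_point T f i x) (frac (st i x)) (frac (st j x))
    else params_are (graph_point T f i x) (frac (st j x)) (frac (st i x))"
proof -
  have p: "frac (st i x) \<in> {0..<1}" "frac (st j x) \<in> {0..<1}" by (simp_all add: frac_lt_1)
  have c: "curve D (frac (st i x)) = graph_point T f i x" "curve D (frac (st j x)) = graph_point T f i x"
    using curve_st(1) meet_same_point[OF x(2)] ij x by auto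
  have "wedge (velocity D (st i x)) (velocity D (st j x)) \<noteq> 0"
    using transversal[OF p] crossing_frac_neq[OF ij x(1)] c by simp
  then show ?thesis
    using params_eqI[OF p(1) c(1) p(2) c(2)] params_eqI[OF p(2) c(2) p(1) c(1)]
      wedge_flip[of "velocity D (st i x)" "velocity D (st j x)"] by auto
qed

text \<open>
  The NE strand at a crossing, read off at any position \<open>y\<close> to the right of it up to which the two
  strands do not meet again.
\<close>

lemma params_right:
  assumes ij: "i < n" "j < n" "i \<noteq> j" and x: "x \<in> {-1..1}" "f i x = f j x"
    and y: "x < y" "y \<le> 1" "\<And>z. x < z \<Longrightarrow> z \<le> y \<Longrightarrow> f i z \<noteq> f j z"
  shows "if dir T i * dir T j * (f j y - f i y) > 0
    then params_are (graph_point T f i x) (frac (st i x)) (frac (st j x))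
    else params_are (graph_point T f i x) (frac (st j x)) (frac (st i x))"
proof -
  obtain m where m: "((\<lambda>y. f j y - f i y) has_real_derivative m) (at x)" "m \<noteq> 0"
    "wedge (velocity D (st i x)) (velocity D (st j x)) > 0 \<longleftrightarrow> dir T i * dir T j * m > 0"
    using crossing_slope[OF ij x] .
  have "m > 0 \<longleftrightarrow> f j y - f i y > 0"
  proof (rule deriv_sign_right[OF m(1,2)])
    show "continuous_on {x..y} (\<lambda>y. f j y - f i y)"
      using ij x y(2) by (intro continuous_on_diff continuous_on_subset[OF strand_continuous]) auto
    show "f j z - f i z \<noteq> 0" if "z \<in> {x<..y}" for z using y(3)[of z] that by auto
  qed (use x y in auto)
  moreover have "f j y - f i y \<noteq> 0" using y(3)[OF y(1) order_refl] by simp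
  ultimately have "dir T i * dir T j * m > 0 \<longleftrightarrow> dir T i * dir T j * (f j y - f i y) > 0"
    using m(2) dir_cases[OF ij(1)] dir_cases[OF ij(2)] by auto
  then show ?thesis using params_of_meet[OF ij x] m(3) by simp
qed

lemma params_left:
  assumes ij: "i < n" "j < n" "i \<noteq> j" and x: "x \<in> {-1..1}" "f i x = f j x"
    and y: "y < x" "-1 \<le> y" "\<And>z. y \<le> z \<Longrightarrow> z < x \<Longrightarrow> f i z \<noteq> f j z"
  shows "if dir T i * dir T j * (f j y - f i y) < 0
    then params_are (graph_point T f i x) (frac (st i x)) (frac (st j x))
    else params_are (graph_point T f i x) (frac (st j x)) (frac (st i x))"
proof -
  obtain m where m: "((\<lambda>y. f j y - f i y) has_real_derivative m) (at x)" "m \<noteq> 0"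
    "wedge (velocity D (st i x)) (velocity D (st j x)) > 0 \<longleftrightarrow> dir T i * dir T j * m > 0"
    using crossing_slope[OF ij x] .
  have "m > 0 \<longleftrightarrow> f j y - f i y < 0"
  proof (rule deriv_sign_left[OF m(1,2)])
    show "continuous_on {y..x} (\<lambda>y. f j y - f i y)"
      using ij x y(2) by (intro continuous_on_diff continuous_on_subset[OF strand_continuous]) auto
    show "f j z - f i z \<noteq> 0" if "z \<in> {y..<x}" for z using y(3)[of z] that by auto
  qed (use x y in auto)
  moreover have "f j y - f i y \<noteq> 0" using y(3)[OF order_refl y(1)] by simp
  ultimately have "dir T i * dir T j * m > 0 \<longleftrightarrow> dir T i * dir T j * (f j y - f i y) < 0"
    using m(2) dir_cases[OF ij(1)] dir_cases[OF ij(2)] by auto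
  then show ?thesis using params_of_meet[OF ij x] m(3) by simp
qed

lemma strand_ends_clear: "i < n \<Longrightarrow> start T i \<notin> passages D \<and> stop T i \<notin> passages D"
proof -
  assume i: "i < n"
  have "st i (- dir T i) = start T i" "st i (dir T i) = stop T i"
    using dir_cases[OF i] by (auto simp: strand_time_def field_simps)
  moreover have "st i x \<notin> passages D" if "x = -1 \<or> x = 1" for x
    using passage_st[OF i, of x] ends[OF _ i, of _ x] that by auto
  ultimately show ?thesis using dir_cases[OF i] by (metis add.inverse_inverse)
qed

lemma passage_between:
  assumes "i < n" "t \<in> passages D" "start T i \<le> t" "t \<le> stop T i"
  obtains x j where "x \<in> {-1..1}" "t = st i x" "j < n" "j \<noteq> i" "f j x = f i x"
  using st_surj[OF assms(1), of t] passage_st[OF assms(1)] assms by (metis atLeastAtMost_iff)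

end

context picture
begin

text \<open>
  An extension of the strand on both sides that contains no passages but those on the strand
  itself. Its end points represent the arcs on which the strand enters and leaves the region.
\<close>

definition margin :: "nat \<Rightarrow> real \<Rightarrow> real \<Rightarrow> bool" where
  "margin i a b \<longleftrightarrow> a < start T i \<and> stop T i < b \<and>
    {a..start T i} \<inter> passages D = {} \<and> {stop T i..b} \<inter> passages D = {}"

text \<open>
  A strand with two crossings consists of parts of three arcs only.
\<close>

lemma strand_walk:
  assumes i: "i < n" and ab: "margin i a b" and x: "x \<in> {-1..1}" "y \<in> {-1..1}" "st i x < st i y"
    and only: "\<And>z j. z \<in> {-1..1} \<Longrightarrow> j < n \<Longrightarrow> j \<noteq> i \<Longrightarrow> f j z = f i z \<Longrightarrow> z = x \<or> z = y"
  shows "arc_in D (st i x) = arc_at D a" "arc_out D (st i x) = arc_in D (st i y)"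
    "arc_out D (st i y) = arc_at D b"
proof -
  have bd: "start T i \<le> st i x" "st i x \<le> stop T i" "start T i \<le> st i y" "st i y \<le> stop T i"
    using st_bounds[OF i] x by auto
  have clear: "t = st i x \<or> t = st i y" if t: "t \<in> passages D" "a \<le> t" "t \<le> b" for t
  proof (cases "start T i \<le> t \<and> t \<le> stop T i")
    case True
    then obtain z j where "z \<in> {-1..1}" "t = st i z" "j < n" "j \<noteq> i" "f j z = f i z"
      using passage_between[OF i t(1)] by blast
    then show ?thesis using only by blast
  next
    case False
    then show ?thesis using ab t by (auto simp: margin_def disjoint_iff)
  qed
  show "arc_in D (st i x) = arc_at D a"
    by (rule arc_in_eq) (use ab bd clear x(3) in \<open>auto simp: margin_def disjoint_iff\<close>, fastforce)
  show "arc_out D (st i y) = arc_at D b"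
    by (rule arc_out_eq) (use ab bd clear x(3) in \<open>auto simp: margin_def disjoint_iff\<close>, fastforce)
  define t where "t = (st i x + st i y) / 2"
  have t: "st i x < t" "t < st i y" using x(3) by (auto simp: t_def)
  have "arc_out D (st i x) = arc_at D t"
    by (rule arc_out_eq) (use ab bd clear t in \<open>auto simp: margin_def disjoint_iff\<close>, fastforce)
  moreover have "arc_in D (st i y) = arc_at D t"
    by (rule arc_in_eq) (use ab bd clear t in \<open>auto simp: margin_def disjoint_iff\<close>, fastforce)
  ultimately show "arc_out D (st i x) = arc_in D (st i y)" by simp
qed

lemma strand_walk_uncrossed:
  assumes i: "i < n" and ab: "margin i a b"
    and none: "\<And>z j. z \<in> {-1..1} \<Longrightarrow> j < n \<Longrightarrow> j \<noteq> i \<Longrightarrow> f j z \<noteq> f i z"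
  shows "arc_at D b = arc_at D a"
proof (rule arc_at_clear)
  show "a \<le> b" using ab strand_bounds(1)[OF i] by (auto simp: margin_def)
  have "t \<notin> passages D" if "a \<le> t" "t \<le> b" for t
  proof (cases "start T i \<le> t \<and> t \<le> stop T i")
    case True
    then show ?thesis using passage_between[OF i, of t] none by metis
  next
    case False
    then show ?thesis using ab that by (auto simp: margin_def disjoint_iff)
  qed
  then show "{a..b} \<inter> passages D = {}" by auto
qed

text \<open>
  Seen from outside, all points of a strand are as good as its starting point. In this normal form
  halves on both sides of a move can be compared.
\<close>

lemma start_between:
  assumes i: "i < n" and j: "j < n" "i \<noteq> j" and x: "x \<in> {-1..1}" "y \<in> {-1..1}"
    and t: "curve D t \<notin> domain_of T"
  shows "t \<in> between (st j y) (st i x) \<longleftrightarrow> t \<in> between (start T j) (start T i)"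
proof -
  have s: "start T k \<in> {start T k..stop T k}" if "k < n" for k using strand_bounds(1)[OF that] by simp
  have ne: "frac t \<noteq> frac (start T j)"
    using outside_shift[OF t j(1)] s[OF j(1)] frac_eq_int by metis
  have "t \<in> between (st j y) (st i x) \<longleftrightarrow> t \<in> between (start T j) (st i x)"
    using between_move_left[OF strand_bounds(2)[OF j(1)] st_bounds[OF j(1) x(2)] s[OF j(1)]
        outside_shift[OF t j(1)] strands_disjoint(1)[OF i j st_bounds[OF i x(1)]]] .
  also have "\<dots> \<longleftrightarrow> t \<in> between (start T j) (start T i)"
    using between_move_right[OF strand_bounds(2)[OF i] st_bounds[OF i x(1)] s[OF i]
        outside_shift[OF t i] strands_disjoint(1)[OF j(1) i j(2)[symmetric] s[OF j(1)]] ne] .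
  finally show ?thesis .
qed

lemma left_half_outside:
  assumes "v \<in> classical D" "ne_param D v = frac (st i x)" "nw_param D v = frac (st j y)"
    "i < n" "j < n" "i \<noteq> j" "x \<in> {-1..1}" "y \<in> {-1..1}"
    and t: "curve D t \<notin> domain_of T" "t \<notin> passages D"
  shows "left_half D v (arc_at D t) = of_bool (t \<in> between (start T j) (start T i))"
  using left_half_at[OF assms(1) t(2)] start_between[OF assms(4-8) t(1)] assms(2,3) by simp

lemma between_starts_flip:
  assumes "i < n" "j < n" "i \<noteq> j" and t: "curve D t \<notin> domain_of T"
  shows "t \<in> between (start T j) (start T i) \<longleftrightarrow> t \<notin> between (start T i) (start T j)"
proof (rule between_compl)
  have s: "start T k \<in> {start T k..stop T k}" if "k < n" for k using strand_bounds(1)[OF that] by simp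
  show "frac t \<noteq> frac (start T i)" "frac t \<noteq> frac (start T j)"
    using outside_shift[OF t] s assms frac_eq_int by metis+
  show "frac (start T i) \<noteq> frac (start T j)"
    using strands_disjoint(1)[OF assms(2,1) _ s[OF assms(2)]] s[OF assms(1)] assms(3) frac_eq_int by metis
qed

lemma between_starts_three:
  assumes "n = 3"
  obtains k where "\<And>t. curve D t \<notin> domain_of T \<Longrightarrow>
    of_bool (t \<in> between (start T 0) (start T 1)) + of_bool (t \<in> between (start T 1) (start T 2))
      + of_bool (t \<in> between (start T 2) (start T 0)) = (k :: int)"
proof
  fix t assume t: "curve D t \<notin> domain_of T"
  have s: "start T k \<in> {start T k..stop T k}" if "k < n" for k using strand_bounds(1)[OF that] by simp
  have ne: "frac (start T i) \<noteq> frac (start T j)" if "i < n" "j < n" "i \<noteq> j" for i j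
    using strands_disjoint(1)[OF that(2,1) _ s[OF that(2)]] s[OF that(1)] that(3) frac_eq_int by metis
  have net: "frac t \<noteq> frac (start T i)" if "i < n" for i
    using outside_shift[OF t] s that frac_eq_int by metis
  show "of_bool (t \<in> between (start T 0) (start T 1)) + of_bool (t \<in> between (start T 1) (start T 2))
      + of_bool (t \<in> between (start T 2) (start T 0))
    = (if start T 1 \<in> between (start T 0) (start T 2) then 1 else 2 :: int)"
    by (rule between_three) (use ne net assms in auto)
qed

end

section \<open>Diagrams that agree outside of a region\<close>

locale picture_pair = P: picture D T n f + P': picture D' T n f'
  for D D' :: vdiag and T :: region and n :: nat and f f' :: "nat \<Rightarrow> real \<Rightarrow> real" +
  assumes agree: "\<And>t. curve D t \<notin> domain_of T \<Longrightarrow> curve D' t = curve D t"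
    and agree_over: "{t \<in> over D. curve D t \<notin> domain_of T} = {t \<in> over D'. curve D' t \<notin> domain_of T}"
begin

lemma inside_same: "curve D' t \<in> domain_of T \<longleftrightarrow> curve D t \<in> domain_of T"
  using P.inside_iff P'.inside_iff by blast

lemma outer_classical: "classical D' - domain_of T = classical D - domain_of T"
proof -
  have "classical D - domain_of T = curve D ` {t \<in> over D. curve D t \<notin> domain_of T}"
    by (auto simp: classical_def)
  also have "\<dots> = curve D' ` {t \<in> over D. curve D t \<notin> domain_of T}"
    using agree by (auto simp: image_iff)
  also have "\<dots> = classical D' - domain_of T"
    unfolding agree_over by (auto simp: classical_def)
  finally show ?thesis ..
qed

lemma outer_classical_iff: "v \<notin> domain_of T \<Longrightarrow> v \<in> classical D' \<longleftrightarrow> v \<in> classical D"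
  using outer_classical by blast

lemma outer_velocity:
  assumes "curve D t \<notin> domain_of T"
  shows "velocity D' t = velocity D t"
proof -
  obtain e where e: "e > 0" "\<And>s. \<bar>s - t\<bar> < e \<Longrightarrow> curve D s \<notin> domain_of T"
    using P.outside_open[OF assms] by blast
  have "(curve D' has_vector_derivative velocity D t) (at t)"
    by (rule has_vector_derivative_transform_within_open[OF P.has_velocity, where S = "{t - e<..<t + e}"])
      (use e agree in auto)
  then show ?thesis using P'.has_velocity vector_derivative_unique_at by blast
qed

lemma outer_passages:
  assumes "curve D t \<notin> domain_of T"
  shows "t \<in> passages D' \<longleftrightarrow> t \<in> passages D"
  using agree[OF assms] outer_classical_iff[OF assms] by (simp add: passages_def)

lemma outer_params:
  assumes v: "v \<in> classical D" "v \<notin> domain_of T"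
  shows "ne_param D' v = ne_param D v" "nw_param D' v = nw_param D v" "writhe D' v = writhe D v"
proof -
  note o = P.outer_params[OF v]
  show ne: "ne_param D' v = ne_param D v" and "nw_param D' v = nw_param D v"
    using P'.params_eqI[of "ne_param D v" v "nw_param D v"] P.crossing[OF v(1)]
      outer_velocity[OF o(1)] outer_velocity[OF o(2)] agree[OF o(1)] agree[OF o(2)] by auto
  have "ne_param D v \<in> over D \<longleftrightarrow> ne_param D v \<in> over D'"
    using agree_over o(1) inside_same by (auto simp: set_eq_iff)
  then show "writhe D' v = writhe D v" by (simp add: writhe_def ne)
qed

text \<open>
  Agreement on arcs that have a point outside of the region in common, expressed through such
  points.
\<close>

definition match :: "(real set \<Rightarrow> 'z) \<Rightarrow> (real set \<Rightarrow> 'z) \<Rightarrow> bool" where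
  "match h h' \<longleftrightarrow> (\<forall>t. curve D t \<notin> domain_of T \<longrightarrow> t \<notin> passages D \<longrightarrow> h (arc_at D t) = h' (arc_at D' t))"

lemma match_corr:
  "match h h' \<longleftrightarrow> (\<forall>(a, a') \<in> local_arc_corr D D' T. h a = h' a')"
proof
  assume m: "match h h'"
  show "\<forall>(a, a') \<in> local_arc_corr D D' T. h a = h' a'"
  proof clarify
    fix a a' assume "(a, a') \<in> local_arc_corr D D' T"
    then obtain t where t: "a \<in> arcs D" "a' \<in> arcs D'" "t \<in> a" "t \<in> a'" "curve D t \<notin> domain_of T"
      by (auto simp: local_arc_corr_def)
    then show "h a = h' a'"
      using m P.arcs_at[OF t(1,3)] P'.arcs_at[OF t(2,4)] P.arcs_no_passage[OF t(1,3)] by (simp add: match_def)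
  qed
next
  assume c: "\<forall>(a, a') \<in> local_arc_corr D D' T. h a = h' a'"
  show "match h h'"
    unfolding match_def
  proof (intro allI impI)
    fix t assume t: "curve D t \<notin> domain_of T" "t \<notin> passages D"
    then have "t \<notin> passages D'" using outer_passages by blast
    then have "(arc_at D t, arc_at D' t) \<in> local_arc_corr D D' T"
      using t P.arc_at_self P'.arc_at_self P.arc_at_in P'.arc_at_in by (auto simp: local_arc_corr_def)
    then show "h (arc_at D t) = h' (arc_at D' t)" using c by blast
  qed
qed

lemma match_passage:
  assumes p: "curve D p \<notin> domain_of T" and m: "match h h'"
  shows "h (arc_in D p) = h' (arc_in D' p)" "h (arc_out D p) = h' (arc_out D' p)"
proof -
  obtain e where e: "e > 0" "\<And>s. \<bar>s - p\<bar> < e \<Longrightarrow> curve D s \<notin> domain_of T"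
    using P.outside_open[OF p] by blast
  obtain t1 where t1: "t1 < p" "p - e < t1" "{t1..<p} \<inter> passages D = {}" using P.clear_before[OF e(1)] by blast
  then obtain t where t: "t < p" "p - (p - t1) < t" "{t..<p} \<inter> passages D' = {}"
    using P'.clear_before[of "p - t1" p] by auto
  have "{t..<p} \<inter> passages D = {}" "t \<notin> passages D" "curve D t \<notin> domain_of T"
    using t t1 e(2)[of t] by (auto simp: disjoint_iff)
  then show "h (arc_in D p) = h' (arc_in D' p)"
    using P.arc_in_eq[OF t(1)] P'.arc_in_eq[OF t(1,3)] m by (simp add: match_def)
  obtain t1 where t1: "p < t1" "t1 < p + e" "{p<..t1} \<inter> passages D = {}" using P.clear_after[OF e(1)] by blast
  then obtain t where t: "p < t" "t < p + (t1 - p)" "{p<..t} \<inter> passages D' = {}"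
    using P'.clear_after[of "t1 - p" p] by auto
  have "{p<..t} \<inter> passages D = {}" "t \<notin> passages D" "curve D t \<notin> domain_of T"
    using t t1 e(2)[of t] by (auto simp: disjoint_iff)
  then show "h (arc_out D p) = h' (arc_out D' p)"
    using P.arc_out_eq[OF t(1)] P'.arc_out_eq[OF t(1,3)] m by (simp add: match_def)
qed

lemma crossing_isect_outer:
  assumes v: "v \<in> classical D" "v \<notin> domain_of T" and m: "match h h'" "match c c'"
  shows "P'.crossing_isect h' c' v = P.crossing_isect h c v"
  using match_passage[OF P.outer_params(1)[OF v] m(1)] match_passage[OF P.outer_params(2)[OF v] m(1)]
    match_passage[OF P.outer_params(1)[OF v] m(2)] match_passage[OF P.outer_params(2)[OF v] m(2)]
  by (simp add: P.crossing_isect_def P'.crossing_isect_def outer_params[OF v])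

lemma intersection_by_inside:
  assumes c: "P.int_cycle c" "P'.int_cycle c'" and m: "match h h'" "match c c'"
    and inside: "(\<Sum>w \<in> classical D \<inter> domain_of T. P.crossing_isect h c w)
      = (\<Sum>w \<in> classical D' \<inter> domain_of T. P'.crossing_isect h' c' w)"
  shows "intersection_number D h c = intersection_number D' h' c'"
proof -
  have split: "sum g (classical E) = sum g (classical E - domain_of T) + sum g (classical E \<inter> domain_of T)"
    if "finite (classical E)" for E and g :: "complex \<Rightarrow> int"
    using sum.Int_Diff[OF that, of g "domain_of T"] by simp
  have "(\<Sum>w \<in> classical D - domain_of T. P.crossing_isect h c w) = (\<Sum>w \<in> classical D' - domain_of T. P'.crossing_isect h' c' w)"
    unfolding outer_classical using crossing_isect_outer m by (intro sum.cong) auto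
  then show ?thesis
    unfolding P.intersection_cycle[OF c(1)] P'.intersection_cycle[OF c(2)]
      split[OF P.finite_classical] split[OF P'.finite_classical] inside by simp
qed

text \<open>
  The same margin can be chosen for both diagrams, with end points outside of the region.
\<close>

lemma margins:
  assumes i: "i < n"
  obtains a b where "P.margin i a b" "P'.margin i a b"
    "curve D a \<notin> domain_of T" "curve D b \<notin> domain_of T" "a \<notin> passages D" "b \<notin> passages D"
proof -
  note ends = P.strand_ends_clear[OF i] P'.strand_ends_clear[OF i]
  obtain e where e: "e < start T i" "\<And>t. e < t \<Longrightarrow> t < start T i \<Longrightarrow> curve D t \<notin> domain_of T"
    using P.outside_before[OF i] unfolding eventually_at_left_field by blast
  obtain a1 where a1: "a1 < start T i" "start T i - (start T i - e) < a1" "{a1..<start T i} \<inter> passages D = {}"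
    using P.clear_before[of "start T i - e" "start T i"] e(1) by auto
  obtain a where a: "a < start T i" "start T i - (start T i - a1) < a" "{a..<start T i} \<inter> passages D' = {}"
    using P'.clear_before[of "start T i - a1" "start T i"] a1(1) by auto
  have A: "{a..start T i} \<inter> passages D = {}" "{a..start T i} \<inter> passages D' = {}" "curve D a \<notin> domain_of T"
    using a a1 e(2)[of a] ends by (auto simp: disjoint_iff order.order_iff_strict)
  obtain e where e: "stop T i < e" "\<And>t. stop T i < t \<Longrightarrow> t < e \<Longrightarrow> curve D t \<notin> domain_of T"
    using P.outside_after[OF i] unfolding eventually_at_right_field by blast
  obtain b1 where b1: "stop T i < b1" "b1 < stop T i + (e - stop T i)" "{stop T i<..b1} \<inter> passages D = {}"
    using P.clear_after[of "e - stop T i" "stop T i"] e(1) by auto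
  obtain b where b: "stop T i < b" "b < stop T i + (b1 - stop T i)" "{stop T i<..b} \<inter> passages D' = {}"
    using P'.clear_after[of "b1 - stop T i" "stop T i"] b1(1) by auto
  have B: "{stop T i..b} \<inter> passages D = {}" "{stop T i..b} \<inter> passages D' = {}" "curve D b \<notin> domain_of T"
    using b b1 e(2)[of b] ends by (auto simp: disjoint_iff order.order_iff_strict)
  have "a \<notin> passages D" "b \<notin> passages D" using A(1) B(1) a(1) b(1) by (auto simp: disjoint_iff)
  then show ?thesis using that[of a b] A B a(1) b(1) by (simp add: P.margin_def P'.margin_def)
qed

lemma match_left_half_outer:
  assumes v: "v \<in> classical D" "v \<notin> domain_of T"
  shows "match (left_half D v) (left_half D' v)"
  unfolding match_def
proof (intro allI impI)
  fix t assume t: "curve D t \<notin> domain_of T" "t \<notin> passages D"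
  have "v \<in> classical D'" "t \<notin> passages D'" using outer_classical_iff v outer_passages t by auto
  then show "left_half D v (arc_at D t) = left_half D' v (arc_at D' t)"
    using P.left_half_at[OF v(1) t(2)] P'.left_half_at outer_params[OF v] by simp
qed

lemma match_whole: "match (whole D) (whole D')"
  unfolding match_def using outer_passages P.arc_at_in P'.arc_at_in by (auto simp: whole_def)

lemma match_minus_half:
  assumes "match (left_half D u) (left_half D' u')" "writhe D u = writhe D' u'"
    "u \<in> classical D" "u' \<in> classical D'"
  shows "match (minus_half D u) (minus_half D' u')"
  using assms unfolding match_def minus_half_def
  by (auto simp: P.right_half_at P'.right_half_at outer_passages)

end

context diagram
begin

text \<open>
  By the cycle condition the jump along the NW strand is the negative of this one.
\<close>

definition jump :: "(real set \<Rightarrow> int) \<Rightarrow> complex \<Rightarrow> int" where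
  "jump c w = c (arc_out D (ne_param D w)) - c (arc_in D (ne_param D w))"

lemma cycle_out:
  assumes "int_cycle c" "w \<in> classical D"
  shows "c (arc_out D (ne_param D w)) = c (arc_in D (ne_param D w)) + jump c w"
    "c (arc_out D (nw_param D w)) = c (arc_in D (nw_param D w)) - jump c w"
  using assms by (auto simp: int_cycle_def jump_def)

lemma jump_whole: "jump (whole D) w = 0"
  by (simp add: jump_def whole_def)

lemma jump_left_half:
  assumes "v \<in> classical D" "w \<in> classical D"
  shows "jump (left_half D v) w = - of_bool (v = w)"
proof (cases "v = w")
  case True
  then show ?thesis using left_half_turn[OF assms(1)] by (simp add: jump_def)
next
  case False
  then show ?thesis
    using left_half_through[OF assms(1)] params_of_other[OF assms(2,1)] frac_params[OF assms(2)]
    by (simp add: jump_def)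
qed

lemma jump_minus_half:
  assumes "v \<in> classical D" "w \<in> classical D"
  shows "jump (minus_half D v) w = writhe D v * of_bool (v = w)"
  using jump_left_half[OF assms]
  by (auto simp: minus_half_def jump_def right_half_eq[OF assms(1)] writhe_def)

end

section \<open>Boundary values\<close>

lemma limit_agree:
  fixes g g' :: "real \<Rightarrow> complex"
  assumes "isCont g t" "isCont g' t" "F \<le> at t" "F \<noteq> bot" "eventually (\<lambda>s. g' s = g s) F"
  shows "g' t = g t"
proof -
  have "(g \<longlongrightarrow> g t) F" "(g' \<longlongrightarrow> g' t) F"
    using assms(1-3) by (auto simp: isCont_def intro: filterlim_mono)
  then show ?thesis
    using tendsto_unique[OF assms(4), of g "g t" "g' t"] Lim_transform_eventually[of g' "g' t" F g] assms(5)
    by auto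
qed

text \<open>
  The curves agree just outside of the region, hence by continuity also where the strands begin
  and end.
\<close>

lemma local_move_boundary:
  assumes lm: "local_move D D' T n f f'" and i: "i < n" and x: "x \<in> {-1, 1}"
  shows "f' i x = f i x"
proof -
  interpret P: picture_no_ends D T n f
    by unfold_locales (use lm in \<open>auto simp: local_move_def\<close>)
  interpret P': picture_no_ends D' T n f'
    by unfold_locales (use lm in \<open>auto simp: local_move_def\<close>)
  have ag: "curve D t \<notin> domain_of T \<Longrightarrow> curve D' t = curve D t" for t
    using lm by (auto simp: local_move_def)
  have "curve D' (start T i) = curve D (start T i)"
    by (rule limit_agree[OF P.isCont_curve P'.isCont_curve, of "at_left (start T i)"])
      (auto intro: eventually_mono[OF P.outside_before[OF i]] simp: ag at_within_le_at)
  moreover have "curve D' (stop T i) = curve D (stop T i)"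
    by (rule limit_agree[OF P.isCont_curve P'.isCont_curve, of "at_right (stop T i)"])
      (auto intro: eventually_mono[OF P.outside_after[OF i]] simp: ag at_within_le_at)
  moreover have "P.st i (- dir T i) = start T i" "P.st i (dir T i) = stop T i"
    using P.dir_cases[OF i] by (auto simp: strand_time_def field_simps)
  then have "P.st i x = start T i \<or> P.st i x = stop T i" using P.dir_cases[OF i] x by auto
  ultimately have eq: "curve D' (P.st i x) = curve D (P.st i x)" by auto
  have xx: "x \<in> {-1..1}" using x by auto
  have "emb T (Complex x (f' i x)) = emb T (Complex x (f i x))"
    using eq P.curve_st(1)[OF i xx] P'.curve_st(1)[OF i xx] by (simp add: graph_point_def)
  then have "Complex x (f' i x) = Complex x (f i x)"
    using inj_onD[OF P.emb_inj] P.in_square[OF i xx] P'.in_square[OF i xx] by blast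
  then show ?thesis by simp
qed

lemma local_move_pairI:
  assumes lm: "local_move D D' T n f f'"
    and ends: "\<And>i j x. i < n \<Longrightarrow> j < n \<Longrightarrow> i \<noteq> j \<Longrightarrow> x \<in> {-1, 1} \<Longrightarrow> f i x \<noteq> f j x"
  shows "picture_pair D D' T n f f'"
proof -
  have e': "f' i x \<noteq> f' j x" if "i < n" "j < n" "i \<noteq> j" "x \<in> {-1, 1}" for i j x
    using ends[OF that] local_move_boundary[OF lm _ that(4)] that by simp
  show ?thesis
    by unfold_locales (use lm ends e' in \<open>simp_all add: local_move_def\<close>)
qed

context picture_pair
begin

definition vanish :: "(real set \<Rightarrow> int) \<Rightarrow> bool" where
  "vanish h \<longleftrightarrow> (\<forall>t. curve D t \<notin> domain_of T \<longrightarrow> t \<notin> passages D \<longrightarrow> h (arc_at D t) = 0)"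

text \<open>
  At an outer crossing the cycle runs along outer arcs only.
\<close>

lemma vanish_inside:
  assumes c: "P.int_cycle c" and h: "vanish h"
  shows "intersection_number D h c = (\<Sum>w \<in> classical D \<inter> domain_of T. P.crossing_isect h c w)"
proof -
  have z: "h (arc_in D p) = 0" "h (arc_out D p) = 0" if p: "curve D p \<notin> domain_of T" for p
  proof -
    have "match h (\<lambda>_. 0)" using h by (simp add: vanish_def match_def)
    then show "h (arc_in D p) = 0" "h (arc_out D p) = 0" using match_passage[OF p] by auto
  qed
  have "P.crossing_isect h c w = 0" if "w \<in> classical D - domain_of T" for w
    using P.outer_params[of w] that z by (simp add: P.crossing_isect_def)
  then have "(\<Sum>w \<in> classical D - domain_of T. P.crossing_isect h c w) = 0" by simp
  then show ?thesis
    using P.intersection_cycle[OF c, of h] sum.Int_Diff[OF P.finite_classical, of "P.crossing_isect h c" "domain_of T"]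
    by linarith
qed

end

section \<open>The second Reidemeister move\<close>

text \<open>
  The difference of the two strands has slopes of opposite signs at its two zeros. Hence strand 0
  is the NE strand at one crossing, called \<open>A\<close>, and strand 1 at the other, called \<open>B\<close>. The
  relative order of \<open>A\<close> and \<open>B\<close> along the strands is left open.
\<close>

locale R2_pair = picture_pair D D' T "2::nat" f f' for D D' T f f' +
  fixes xA xB :: real
  assumes xs: "xA \<in> {-1..1}" "xB \<in> {-1..1}" "xA \<noteq> xB"
    and meet: "\<And>z. z \<in> {-1..1} \<Longrightarrow> f 0 z = f 1 z \<longleftrightarrow> z = xA \<or> z = xB"
    and no_meet: "\<And>z. z \<in> {-1..1} \<Longrightarrow> f' 0 z \<noteq> f' 1 z"
    and ne_A: "ne_param D (graph_point T f 0 xA) = frac (strand_time T 0 xA)"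
    and nw_A: "nw_param D (graph_point T f 0 xA) = frac (strand_time T 1 xA)"
    and ne_B: "ne_param D (graph_point T f 0 xB) = frac (strand_time T 1 xB)"
    and nw_B: "nw_param D (graph_point T f 0 xB) = frac (strand_time T 0 xB)"
begin

abbreviation "A \<equiv> graph_point T f 0 xA"
abbreviation "B \<equiv> graph_point T f 0 xB"

lemma AB: "A \<in> classical D" "B \<in> classical D" "A \<in> domain_of T" "B \<in> domain_of T" "A \<noteq> B"
  using P.meet_classical[of 0 1 xA] P.meet_classical[of 0 1 xB] P.meet_domain[of 0] meet xs
    P.graph_point_inj[of 0 0 xA xB] by auto

lemma inside_D: "classical D \<inter> domain_of T = {A, B}"
proof -
  have "v \<in> {A, B}" if v: "v \<in> classical D" "v \<in> domain_of T" for v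
  proof -
    obtain i j x where *: "i < 2" "j < 2" "i \<noteq> j" "x \<in> {-1..1}" "f i x = f j x" "v = graph_point T f i x"
      using P.classical_inside[OF v] by metis
    then have eq: "f 0 x = f 1 x" by (auto simp: less_2_cases_iff)
    then have "x = xA \<or> x = xB" using meet *(4) by blast
    moreover have "v = graph_point T f 0 x"
      using *(1,6) P.meet_same_point[OF eq] by (auto simp: less_2_cases_iff)
    ultimately show ?thesis by auto
  qed
  then show ?thesis using AB by auto
qed

lemma inside_D': "classical D' \<inter> domain_of T = {}"
proof -
  have False if v: "v \<in> classical D'" "v \<in> domain_of T" for v
  proof -
    obtain i j x where *: "i < 2" "j < 2" "i \<noteq> j" "x \<in> {-1..1}" "f' i x = f' j x"
      using P'.classical_inside[OF v] by metis
    then show False using no_meet[of x] by (auto simp: less_2_cases_iff)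
  qed
  then show ?thesis by blast
qed

lemma writhe_AB: "writhe D B = - writhe D A"
proof -
  have "layer T 0 \<noteq> layer T 1"
    using P.region unfolding is_region_def inj_on_def by fastforce
  moreover have eq: "f 1 xA = f 0 xA" "f 0 xB = f 1 xB" using meet xs by metis+
  have "frac (P.st 0 xA) \<in> over D \<longleftrightarrow> layer T 1 < layer T 0"
    "frac (P.st 1 xB) \<in> over D \<longleftrightarrow> layer T 0 < layer T 1"
    using P.over_crossing[OF _ _ _ xs(1) eq(1)] P.over_crossing[OF _ _ _ xs(2) eq(2)] by simp_all
  ultimately show ?thesis by (auto simp: writhe_def ne_A ne_B)
qed

lemma walk:
  assumes i: "i < 2" and ab: "P.margin i a b"
  shows "(arc_in D (P.st i xA) = arc_at D a \<and> arc_out D (P.st i xA) = arc_in D (P.st i xB) \<and>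
      arc_out D (P.st i xB) = arc_at D b) \<or>
    (arc_in D (P.st i xB) = arc_at D a \<and> arc_out D (P.st i xB) = arc_in D (P.st i xA) \<and>
      arc_out D (P.st i xA) = arc_at D b)"
proof -
  have only: "z = xA \<or> z = xB" if "z \<in> {-1..1}" "j < 2" "j \<noteq> i" "f j z = f i z" for z j
    using meet[of z] that i by (auto simp: less_2_cases_iff)
  have "P.st i xA \<noteq> P.st i xB" using P.st_inj[OF i i xs(1,2)] xs(3) by auto
  then consider "P.st i xA < P.st i xB" | "P.st i xB < P.st i xA" by linarith
  then show ?thesis
  proof cases
    case 1
    then show ?thesis using P.strand_walk[OF i ab xs(1,2) 1] only by blast
  next
    case 2
    have "z = xB \<or> z = xA" if "z \<in> {-1..1}" "j < 2" "j \<noteq> i" "f j z = f i z" for z j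
      using only[OF that] by blast
    then show ?thesis using P.strand_walk[OF i ab xs(2,1) 2] by blast
  qed
qed

lemma match_exit:
  assumes m: "match h h'" and i: "i < 2" and ab: "P.margin i a b" "P'.margin i a b"
    "curve D a \<notin> domain_of T" "curve D b \<notin> domain_of T" "a \<notin> passages D" "b \<notin> passages D"
  shows "h (arc_at D b) = h (arc_at D a)"
proof -
  have "arc_at D' b = arc_at D' a"
    by (rule P'.strand_walk_uncrossed[OF i ab(2)]) (use no_meet i in \<open>auto simp: less_2_cases_iff\<close>, metis+)
  then show ?thesis using m ab by (simp add: match_def)
qed

lemma crossing_isect_AB:
  "P.crossing_isect h c A = h (arc_in D (P.st 0 xA)) * c (arc_in D (P.st 1 xA))
     - h (arc_out D (P.st 1 xA)) * c (arc_out D (P.st 0 xA))"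
  "P.crossing_isect h c B = h (arc_in D (P.st 1 xB)) * c (arc_in D (P.st 0 xB))
     - h (arc_out D (P.st 0 xB)) * c (arc_out D (P.st 1 xB))"
  by (simp_all add: P.crossing_isect_def ne_A nw_A ne_B nw_B)

text \<open>
  On the other side of the move each strand runs along a single arc, so both cycles leave the
  region with the value with which they enter it. In each of the four orders in which the two
  strands can pass \<open>A\<close> and \<open>B\<close>, the contributions of \<open>A\<close> and \<open>B\<close> then cancel.
\<close>

theorem R2_intersection:
  assumes c: "P.int_cycle c" "P'.int_cycle c'" and m: "match h h'" "match c c'"
  shows "intersection_number D h c = intersection_number D' h' c'"
proof (rule intersection_by_inside[OF c m])
  obtain a0 b0 where m0: "P.margin 0 a0 b0" "P'.margin 0 a0 b0"
    "curve D a0 \<notin> domain_of T" "curve D b0 \<notin> domain_of T" "a0 \<notin> passages D" "b0 \<notin> passages D"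
    using margins[of 0] by auto
  obtain a1 b1 where m1: "P.margin 1 a1 b1" "P'.margin 1 a1 b1"
    "curve D a1 \<notin> domain_of T" "curve D b1 \<notin> domain_of T" "a1 \<notin> passages D" "b1 \<notin> passages D"
    using margins[of 1] by auto
  have ex: "h (arc_at D b0) = h (arc_at D a0)" "c (arc_at D b0) = c (arc_at D a0)"
    "h (arc_at D b1) = h (arc_at D a1)" "c (arc_at D b1) = c (arc_at D a1)"
    using match_exit[OF m(1) _ m0] match_exit[OF m(2) _ m0] match_exit[OF m(1) _ m1] match_exit[OF m(2) _ m1]
    by auto
  have "P.crossing_isect h c A + P.crossing_isect h c B = 0"
    unfolding crossing_isect_AB
    using walk[OF _ m0(1)] walk[OF _ m1(1)] ex by auto
  then show "(\<Sum>w \<in> classical D \<inter> domain_of T. P.crossing_isect h c w)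
      = (\<Sum>w \<in> classical D' \<inter> domain_of T. P'.crossing_isect h' c' w)"
    using AB by (simp add: inside_D inside_D')
qed

text \<open>
  A cycle that vanishes outside is supported on the bigon between \<open>A\<close> and \<open>B\<close>, so it is a multiple
  of the boundary of a disc. In coordinates: if both strands meet the same crossing first, the
  contributions cancel. If strand 0 meets \<open>A\<close> first and strand 1 meets \<open>B\<close> first, only values of
  the vanishing cycle outside of the bigon enter. In the remaining case the sum is a multiple of
  the difference of what the other cycle carries into the region and out of it.
\<close>

theorem R2_vanish:
  assumes h: "P.int_cycle h" and c: "P.int_cycle c" and v: "vanish h"
  shows "intersection_number D h c = 0"
proof -
  obtain a0 b0 where m0: "P.margin 0 a0 b0" "P'.margin 0 a0 b0"
    "curve D a0 \<notin> domain_of T" "curve D b0 \<notin> domain_of T" "a0 \<notin> passages D" "b0 \<notin> passages D"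
    using margins[of 0] by auto
  obtain a1 b1 where m1: "P.margin 1 a1 b1" "P'.margin 1 a1 b1"
    "curve D a1 \<notin> domain_of T" "curve D b1 \<notin> domain_of T" "a1 \<notin> passages D" "b1 \<notin> passages D"
    using margins[of 1] by auto
  have ex: "h (arc_at D a0) = 0" "h (arc_at D b0) = 0" "h (arc_at D a1) = 0" "h (arc_at D b1) = 0"
    using v m0 m1 by (simp_all add: vanish_def)
  have cyc: "g (arc_in D (P.st 0 xA)) + g (arc_in D (P.st 1 xA)) = g (arc_out D (P.st 0 xA)) + g (arc_out D (P.st 1 xA))"
    "g (arc_in D (P.st 1 xB)) + g (arc_in D (P.st 0 xB)) = g (arc_out D (P.st 1 xB)) + g (arc_out D (P.st 0 xB))"
    if "P.int_cycle g" for g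
    using that AB(1,2) unfolding P.int_cycle_def by (force simp: ne_A nw_A ne_B nw_B)+
  consider
    "arc_in D (P.st 0 xA) = arc_at D a0 \<and> arc_out D (P.st 0 xA) = arc_in D (P.st 0 xB) \<and> arc_out D (P.st 0 xB) = arc_at D b0"
    | "arc_in D (P.st 0 xB) = arc_at D a0 \<and> arc_out D (P.st 0 xB) = arc_in D (P.st 0 xA) \<and> arc_out D (P.st 0 xA) = arc_at D b0"
    using walk[OF _ m0(1)] by auto
  then have "P.crossing_isect h c A + P.crossing_isect h c B = 0"
  proof cases
    case 1
    then show ?thesis unfolding crossing_isect_AB using walk[OF _ m1(1)] ex by auto
  next
    case 2
    consider
      "arc_in D (P.st 1 xA) = arc_at D a1 \<and> arc_out D (P.st 1 xA) = arc_in D (P.st 1 xB) \<and> arc_out D (P.st 1 xB) = arc_at D b1"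
      | "arc_in D (P.st 1 xB) = arc_at D a1 \<and> arc_out D (P.st 1 xB) = arc_in D (P.st 1 xA) \<and> arc_out D (P.st 1 xA) = arc_at D b1"
      using walk[OF _ m1(1)] by auto
    then show ?thesis
    proof cases
      case 1
      have hm: "h (arc_in D (P.st 1 xB)) = h (arc_in D (P.st 0 xA))" using cyc(1)[OF h] 1 2 ex by simp
      have cs: "c (arc_at D b0) + c (arc_at D b1) = c (arc_at D a0) + c (arc_at D a1)"
        using cyc[OF c] 1 2 by simp
      have "P.crossing_isect h c A + P.crossing_isect h c B
        = h (arc_in D (P.st 0 xA)) * (c (arc_at D a0) + c (arc_at D a1) - (c (arc_at D b0) + c (arc_at D b1)))"
        unfolding crossing_isect_AB using 1 2 hm by (simp add: algebra_simps)
      then show ?thesis using cs by simp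
    next
      case other: 2
      show ?thesis unfolding crossing_isect_AB using 2 other ex by simp
    qed
  qed
  then show ?thesis using vanish_inside[OF c v] AB by (simp add: inside_D)
qed

text \<open>
  Outside of the region one half goes from strand 1 to strand 0 and the other one from strand 0 to
  strand 1.
\<close>

lemma left_half_AB:
  assumes t: "curve D t \<notin> domain_of T" "t \<notin> passages D"
  shows "left_half D A (arc_at D t) + left_half D B (arc_at D t) = 1"
  using P.left_half_outside[OF AB(1) ne_A nw_A _ _ _ xs(1,1) t]
    P.left_half_outside[OF AB(2) ne_B nw_B _ _ _ xs(2,2) t] P.between_starts_flip[of 0 1 t] t by simp

lemma pair_halves:
  assumes c: "P.int_cycle c"
  shows "intersection_number D (left_half D A) c + intersection_number D (left_half D B) c
    = intersection_number D (whole D) c"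
proof -
  let ?h = "\<lambda>a. (left_half D A a + left_half D B a) + (- 1) * whole D a"
  have "P.int_cycle ?h"
    by (intro P.int_cycle_add P.int_cycle_scale P.int_cycle_left_half P.int_cycle_whole AB)
  moreover have "vanish ?h"
    using left_half_AB by (auto simp: vanish_def whole_def P.arc_at_in)
  ultimately have "intersection_number D ?h c = 0" using R2_vanish c by blast
  then show ?thesis
    unfolding P.intersection_add_left[OF c] P.intersection_scale_left[OF c] by simp
qed

lemma minus_half_AB:
  assumes t: "curve D t \<notin> domain_of T" "t \<notin> passages D"
  shows "writhe D A * minus_half D A (arc_at D t) + writhe D B * minus_half D B (arc_at D t) = 0"
proof -
  have "writhe D A = 1 \<or> writhe D A = -1" by (simp add: writhe_def)
  then show ?thesis
    using left_half_AB[OF t] P.right_half_at[OF AB(1) t(2)] P.right_half_at[OF AB(2) t(2)] writhe_AB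
    by (auto simp: minus_half_def)
qed

text \<open>
  As the writhes are opposite, the combination \<open>sgn(A) D\<^sup>-\<^sub>A + sgn(B) D\<^sup>-\<^sub>B\<close> vanishes outside. It
  corresponds to the cycle 0 on the other side of the move.
\<close>

lemma minus_halves_pair:
  assumes m: "match h h'"
  shows "writhe D A * intersection_number D h (minus_half D A)
    + writhe D B * intersection_number D h (minus_half D B) = 0"
proof -
  let ?c = "\<lambda>a. writhe D A * minus_half D A a + writhe D B * minus_half D B a"
  have cA: "P.int_cycle (minus_half D A)" and cB: "P.int_cycle (minus_half D B)"
    using P.int_cycle_minus_half AB by blast+
  have "intersection_number D h ?c = intersection_number D' h' (\<lambda>_. 0)"
    by (rule R2_intersection[OF _ _ m])
      (use minus_half_AB cA cB in \<open>auto simp: match_def P'.int_cycle_def intro!: P.int_cycle_add P.int_cycle_scale\<close>)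
  also have "\<dots> = 0"
    by (subst P'.intersection_cycle) (auto simp: P'.int_cycle_def P'.crossing_isect_def)
  finally show ?thesis
    using P.intersection_add_right[OF P.int_cycle_scale[OF cA] P.int_cycle_scale[OF cB]]
      P.intersection_scale_right[OF cA] P.intersection_scale_right[OF cB] by simp
qed

end

lemma R2_moveE:
  assumes "R2_move D D' T"
  obtains f f' xA xB where "R2_pair D D' T f f' xA xB"
proof -
  obtain f f' where lm: "local_move D D' T 2 f f'"
    and two: "card {x \<in> {-1..1}. f 0 x = f 1 x} = 2" and none: "{x \<in> {-1..1}. f' 0 x = f' 1 x} = {}"
    using assms by (auto simp: R2_move_def)
  have ends: "f i x \<noteq> f j x" if "i < 2" "j < 2" "i \<noteq> j" "x \<in> {-1, 1}" for i j x
  proof -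
    have "x \<in> {-1..1}" using that(4) by auto
    then have "f' 0 x \<noteq> f' 1 x" using none by blast
    then show ?thesis using local_move_boundary[OF lm _ that(4)] that(1-3)
      by (auto simp: less_2_cases_iff)
  qed
  interpret picture_pair D D' T 2 f f' by (rule local_move_pairI[OF lm ends])
  obtain p q where "{x \<in> {-1..1}. f 0 x = f 1 x} = {p, q}" "p \<noteq> q"
    using two by (auto simp: card_2_iff)
  then obtain x1 x2 where x: "x1 < x2" "{x \<in> {-1..1}. f 0 x = f 1 x} = {x1, x2}"
    by (metis insert_commute linorder_neqE)
  have xs: "x1 \<in> {-1..1}" "x2 \<in> {-1..1}" "f 0 x1 = f 1 x1" "f 0 x2 = f 1 x2"
    using x(2) by blast+
  have meet: "f 0 z = f 1 z \<longleftrightarrow> z = x1 \<or> z = x2" if "z \<in> {-1..1}" for z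
    using x(2) that by blast
  \<comment> \<open>Between the two zeros the sign of the difference is constant; it determines both slopes.\<close>
  define y where "y = (x1 + x2) / 2"
  have y: "x1 < y" "y < x2" using x(1) by (auto simp: y_def)
  have "if dir T 0 * dir T 1 * (f 1 y - f 0 y) > 0
    then P.params_are (graph_point T f 0 x1) (frac (P.st 0 x1)) (frac (P.st 1 x1))
    else P.params_are (graph_point T f 0 x1) (frac (P.st 1 x1)) (frac (P.st 0 x1))"
    by (rule P.params_right) (use xs meet y in auto)
  moreover have "if dir T 0 * dir T 1 * (f 1 y - f 0 y) < 0
    then P.params_are (graph_point T f 0 x2) (frac (P.st 0 x2)) (frac (P.st 1 x2))
    else P.params_are (graph_point T f 0 x2) (frac (P.st 1 x2)) (frac (P.st 0 x2))"
    by (rule P.params_left) (use xs meet y in auto)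
  moreover have "dir T 0 * dir T 1 * (f 1 y - f 0 y) \<noteq> 0"
    using P.dir_cases[of 0] P.dir_cases[of 1] meet[of y] y xs by auto
  ultimately have "R2_pair D D' T f f' x1 x2 \<or> R2_pair D D' T f f' x2 x1"
    using xs y meet none picture_pair_axioms
    unfolding R2_pair_def R2_pair_axioms_def by (auto split: if_splits)
  then show ?thesis using that by blast
qed

section \<open>The third Reidemeister move\<close>

definition sgn_bool :: "bool \<Rightarrow> int" where "sgn_bool b = (if b then 1 else -1)"

text \<open>
  The contribution of one crossing of two strands, the first one being the NE strand iff \<open>s\<close>
  holds. The arguments are the values of two cycles before the crossing on both strands, and the
  jumps \<open>r\<close>, \<open>r'\<close> of the cycles.
\<close>

definition cross_term :: "bool \<Rightarrow> int \<Rightarrow> int \<Rightarrow> int \<Rightarrow> int \<Rightarrow> int \<Rightarrow> int \<Rightarrow> int" where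
  "cross_term s a b r a' b' r' = (if s then a * b' - (b - r) * (a' + r') else b * a' - (a - r) * (b' + r'))"

text \<open>
  The contribution of a whole triangle. Strand \<open>i\<close> runs from left to right iff \<open>oi\<close> holds; \<open>g\<close>
  says whether the strands are ordered upwards by their indices at the right end or at the left
  end of the region, and \<open>c\<close> whether the crossings appear from left to right in the order 01, 02,
  12 or in the reverse order. \<open>Hi\<close>, \<open>Ki\<close> are the values with which
  the two cycles enter on strand \<open>i\<close>, and \<open>rij\<close>, \<open>pij\<close> their jumps at the crossings. Strand \<open>i\<close>
  meets its two crossings in the order of their indices iff \<open>oi = c\<close>; the value before the second
  one includes the jump at the first one.
\<close>

definition triangle_form ::
  "bool \<Rightarrow> bool \<Rightarrow> bool \<Rightarrow> bool \<Rightarrow> bool \<Rightarrow> int \<Rightarrow> int \<Rightarrow> int \<Rightarrow> int \<Rightarrow> int \<Rightarrow> int \<Rightarrow>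
   int \<Rightarrow> int \<Rightarrow> int \<Rightarrow> int \<Rightarrow> int \<Rightarrow> int \<Rightarrow> int" where
  "triangle_form o0 o1 o2 g c H0 H1 H2 r01 r02 r12 K0 K1 K2 p01 p02 p12 =
    (let s01 = ((o0 = o1) = g); s02 = ((o0 = o2) = g); s12 = ((o1 = o2) = g) in
      cross_term s01 (if o0 = c then H0 else H0 + sgn_bool s02 * r02) (if o1 = c then H1 else H1 + sgn_bool s12 * r12) r01
         (if o0 = c then K0 else K0 + sgn_bool s02 * p02) (if o1 = c then K1 else K1 + sgn_bool s12 * p12) p01
    + cross_term s02 (if o0 = c then H0 + sgn_bool s01 * r01 else H0) (if o2 = c then H2 else H2 - sgn_bool s12 * r12) r02
         (if o0 = c then K0 + sgn_bool s01 * p01 else K0) (if o2 = c then K2 else K2 - sgn_bool s12 * p12) p02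
    + cross_term s12 (if o1 = c then H1 - sgn_bool s01 * r01 else H1) (if o2 = c then H2 - sgn_bool s02 * r02 else H2) r12
         (if o1 = c then K1 - sgn_bool s01 * p01 else K1) (if o2 = c then K2 - sgn_bool s02 * p02 else K2) p12)"

text \<open>
  The third Reidemeister move: only the order of the crossings changes.
\<close>

lemma triangle_form_swap:
  "triangle_form o0 o1 o2 g (\<not> c) H0 H1 H2 r01 r02 r12 K0 K1 K2 p01 p02 p12
    = triangle_form o0 o1 o2 g c H0 H1 H2 r01 r02 r12 K0 K1 K2 p01 p02 p12"
  by (cases o0; cases o1; cases o2; cases g; cases c;
      simp add: triangle_form_def cross_term_def sgn_bool_def Let_def algebra_simps)

text \<open>
  The jumps are those of \<open>t\<close> times the cycle around the triangle, which enters with value 0 on all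
  strands and also leaves with value 0.
\<close>

lemma triangle_form_closed:
  "triangle_form o0 o1 o2 g c 0 0 0 (sgn_bool ((o0 = o1) = g) * t) (- sgn_bool ((o0 = o2) = g) * t)
    (sgn_bool ((o1 = o2) = g) * t) K0 K1 K2 p01 p02 p12 = 0"
  by (cases o0; cases o1; cases o2; cases g; cases c)
      (simp_all add: triangle_form_def cross_term_def sgn_bool_def Let_def algebra_simps)

locale R3_picture = picture D T "3::nat" f for D T f +
  fixes X :: "nat \<Rightarrow> nat \<Rightarrow> real" and c :: bool
  assumes meet_X: "\<And>i j. i < 3 \<Longrightarrow> j < 3 \<Longrightarrow> i \<noteq> j \<Longrightarrow> {x \<in> {-1..1}. f i x = f j x} = {X i j}"
    and order_X: "if c then X 0 1 < X 0 2 \<and> X 0 2 < X 1 2 else X 1 2 < X 0 2 \<and> X 0 2 < X 0 1"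
begin

declare One_nat_def [simp del]

abbreviation corner :: "nat \<Rightarrow> nat \<Rightarrow> complex" where "corner i j \<equiv> graph_point T f i (X i j)"
abbreviation corner_time :: "nat \<Rightarrow> nat \<Rightarrow> real" where "corner_time i j \<equiv> strand_time T i (X i j)"
abbreviation forward :: "nat \<Rightarrow> bool" where "forward i \<equiv> dir T i = 1"

definition rises :: "nat \<Rightarrow> nat \<Rightarrow> bool" where "rises i j \<longleftrightarrow> f j 1 - f i 1 > 0"
text \<open>
  Whether strand \<open>i\<close> is the NE strand at its crossing with \<open>j\<close>: of two strands that run in the same
  direction, the NE strand ends to the right of the other one; reversing one of them exchanges the
  roles.
\<close>

definition is_ne :: "nat \<Rightarrow> nat \<Rightarrow> bool" where "is_ne i j \<longleftrightarrow> (forward i = forward j) = rises i j"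

lemma X_props:
  assumes "i < 3" "j < 3" "i \<noteq> j"
  shows "X i j \<in> {-1..1}" "f i (X i j) = f j (X i j)" "X j i = X i j"
    "\<And>z. z \<in> {-1..1} \<Longrightarrow> f i z = f j z \<longleftrightarrow> z = X i j"
proof -
  show "X i j \<in> {-1..1}" "f i (X i j) = f j (X i j)" using meet_X[OF assms] by blast+
  have "{x \<in> {-1..1}. f i x = f j x} = {x \<in> {-1..1}. f j x = f i x}" by auto
  then show "X j i = X i j" using meet_X[OF assms] meet_X[OF assms(2,1) assms(3)[symmetric]] by simp
  show "f i z = f j z \<longleftrightarrow> z = X i j" if "z \<in> {-1..1}" for z using meet_X[OF assms] that by blast
qed

lemma X_inner:
  assumes "i < 3" "j < 3" "i \<noteq> j"
  shows "-1 < X i j" "X i j < 1"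
  using meet_inner[OF assms X_props(1,2)[OF assms]] by auto

lemma rises_right:
  assumes ij: "i < 3" "j < 3" "i \<noteq> j" and y: "X i j < y" "y \<le> 1"
  shows "f j y - f i y > 0 \<longleftrightarrow> rises i j"
  unfolding rises_def
proof (rule no_zero_same_sign[where g = "\<lambda>y. f j y - f i y"])
  show "continuous_on {y..1} (\<lambda>y. f j y - f i y)"
    using ij y X_inner(1)[OF ij]
    by (intro continuous_on_diff continuous_on_subset[OF strand_continuous]) auto
  show "f j z - f i z \<noteq> 0" if "z \<in> {y..1}" for z
    using X_props(4)[OF ij, of z] X_inner[OF ij] y that by auto
qed (use y in auto)

lemma rises_left:
  assumes ij: "i < 3" "j < 3" "i \<noteq> j" and y: "-1 \<le> y" "y < X i j"
  shows "f j y - f i y < 0 \<longleftrightarrow> rises i j"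
proof -
  obtain m where m: "((\<lambda>y. f j y - f i y) has_real_derivative m) (at (X i j))" "m \<noteq> 0"
    using crossing_slope[OF ij X_props(1,2)[OF ij]] by metis
  have cont: "continuous_on S (\<lambda>y. f j y - f i y)" if "S \<subseteq> {-1..1}" for S
    using ij that by (intro continuous_on_diff continuous_on_subset[OF strand_continuous]) auto
  have zero: "f j (X i j) - f i (X i j) = 0" using X_props(2)[OF ij] by simp
  have nonzero: "f j z - f i z \<noteq> 0" if "z \<in> {-1..1}" "z \<noteq> X i j" for z
    using X_props(4)[OF ij that(1)] that(2) by auto
  note inner = X_inner[OF ij]
  have "m > 0 \<longleftrightarrow> f j y - f i y < 0"
  proof (rule deriv_sign_left[OF m zero y(2)])
    show "continuous_on {y..X i j} (\<lambda>y. f j y - f i y)" by (rule cont) (use inner y in auto)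
    show "f j z - f i z \<noteq> 0" if "z \<in> {y..<X i j}" for z using nonzero[of z] that inner y by auto
  qed
  moreover have "m > 0 \<longleftrightarrow> f j 1 - f i 1 > 0"
  proof (rule deriv_sign_right[OF m zero inner(2)])
    show "continuous_on {X i j..1} (\<lambda>y. f j y - f i y)" by (rule cont) (use inner in auto)
    show "f j z - f i z \<noteq> 0" if "z \<in> {X i j<..1}" for z using nonzero[of z] that inner by auto
  qed
  ultimately show ?thesis by (simp add: rises_def)
qed

text \<open>
  If 0 and 1 change places at their crossing in one direction, the other pairs do so in the same
  direction: where strand 2 meets strand 0, its position relative to strand 1 is that of strand 0,
  and where 0 meets 1, both have the same position relative to 2.
\<close>

lemma rises_eq: "rises 0 2 = rises 0 1" "rises 1 2 = rises 0 1"
proof -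
  have in01: "-1 < X 0 1" "X 0 1 < 1" and in02: "-1 < X 0 2" "X 0 2 < 1"
    using X_inner[of 0 1] X_inner[of 0 2] by auto
  have e02: "f 0 (X 0 2) = f 2 (X 0 2)" and e01: "f 0 (X 0 1) = f 1 (X 0 1)"
    using X_props(2)[of 0 2] X_props(2)[of 0 1] by auto
  have n: "f 0 (X 0 2) \<noteq> f 1 (X 0 2)" "f 0 (X 0 1) \<noteq> f 2 (X 0 1)"
    using X_props(4)[of 0 1 "X 0 2"] X_props(4)[of 0 2 "X 0 1"] in01 in02 order_X
    by (auto split: if_splits)
  have "rises 0 2 = rises 0 1 \<and> rises 1 2 = rises 0 1"
  proof (cases c)
    case True
    then have o: "X 0 1 < X 0 2" "X 0 2 < X 1 2" "X 0 1 < X 1 2" using order_X by auto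
    have "rises 1 2 \<longleftrightarrow> rises 0 1"
      using rises_right[of 0 1 "X 0 2"] rises_left[of 1 2 "X 0 2"] o in02 e02 n by auto
    moreover have "rises 1 2 \<longleftrightarrow> rises 0 2"
      using rises_left[of 0 2 "X 0 1"] rises_left[of 1 2 "X 0 1"] o in01 e01 n by auto
    ultimately show ?thesis by blast
  next
    case False
    then have o: "X 1 2 < X 0 2" "X 0 2 < X 0 1" "X 1 2 < X 0 1" using order_X by auto
    have "rises 1 2 \<longleftrightarrow> rises 0 1"
      using rises_left[of 0 1 "X 0 2"] rises_right[of 1 2 "X 0 2"] o in02 e02 n by auto
    moreover have "rises 1 2 \<longleftrightarrow> rises 0 2"
      using rises_right[of 0 2 "X 0 1"] rises_right[of 1 2 "X 0 1"] o in01 e01 n by auto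
    ultimately show ?thesis by blast
  qed
  then show "rises 0 2 = rises 0 1" "rises 1 2 = rises 0 1" by auto
qed

lemma is_ne_eq:
  "is_ne 0 1 = ((forward 0 = forward 1) = rises 0 1)" "is_ne 0 2 = ((forward 0 = forward 2) = rises 0 1)"
  "is_ne 1 2 = ((forward 1 = forward 2) = rises 0 1)"
  by (simp_all add: is_ne_def rises_eq)

lemma is_ne_flip:
  assumes "i < 3" "j < 3" "i \<noteq> j"
  shows "is_ne j i \<longleftrightarrow> \<not> is_ne i j"
  using ends[OF assms, of 1] by (auto simp: is_ne_def rises_def)

lemma corner_sym:
  assumes "i < 3" "j < 3" "i \<noteq> j"
  shows "corner j i = corner i j"
  using X_props(2,3)[OF assms] by (simp add: graph_point_def)

lemma corner_classical: "i < 3 \<Longrightarrow> j < 3 \<Longrightarrow> i \<noteq> j \<Longrightarrow> corner i j \<in> classical D"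
  using meet_classical X_props by blast

lemma corner_domain: "i < 3 \<Longrightarrow> j < 3 \<Longrightarrow> i \<noteq> j \<Longrightarrow> corner i j \<in> domain_of T"
  using meet_domain X_props by blast

lemma corner_params:
  assumes ij: "i < 3" "j < 3" "i \<noteq> j"
  shows "if is_ne i j then params_are (corner i j) (frac (corner_time i j)) (frac (corner_time j i))
    else params_are (corner i j) (frac (corner_time j i)) (frac (corner_time i j))"
proof -
  have "if dir T i * dir T j * (f j 1 - f i 1) > 0
    then params_are (corner i j) (frac (corner_time i j)) (frac (st j (X i j)))
    else params_are (corner i j) (frac (st j (X i j))) (frac (corner_time i j))"
    by (rule params_right[OF ij X_props(1,2)[OF ij]]) (use X_props[OF ij] X_inner[OF ij] in auto)
  moreover have "dir T i * dir T j * (f j 1 - f i 1) > 0 \<longleftrightarrow> is_ne i j"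
    using ends[OF ij, of 1] dir_cases[OF ij(1)] dir_cases[OF ij(2)] by (auto simp: is_ne_def rises_def)
  ultimately show ?thesis using X_props(3)[OF ij] by simp
qed

lemma corner_writhe:
  assumes ij: "i < 3" "j < 3" "i \<noteq> j"
  shows "writhe D (corner i j) = (if is_ne i j = (layer T j < layer T i) then 1 else - 1)"
proof -
  note x = X_props[OF ij]
  have lay: "layer T i \<noteq> layer T j"
    using region ij unfolding is_region_def inj_on_def by blast
  have "frac (corner_time i j) \<in> over D \<longleftrightarrow> layer T j < layer T i" "frac (corner_time j i) \<in> over D \<longleftrightarrow> layer T i < layer T j"
    using over_crossing[OF ij(2,1) ij(3)[symmetric] x(1) x(2)[symmetric]] over_crossing[OF ij x(1,2)] x(3)
    by simp_all
  then show ?thesis using corner_params[OF ij] lay by (auto simp: writhe_def split: if_splits)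
qed

lemma X_distinct: "X 0 1 \<noteq> X 0 2" "X 0 1 \<noteq> X 1 2" "X 0 2 \<noteq> X 1 2"
  using order_X by (auto split: if_splits)

lemma corner_distinct: "corner 0 1 \<noteq> corner 0 2" "corner 0 1 \<noteq> corner 1 2" "corner 0 2 \<noteq> corner 1 2"
  using graph_point_inj[of 0 0 "X 0 1" "X 0 2"] graph_point_inj[of 0 1 "X 0 1" "X 1 2"]
    graph_point_inj[of 0 1 "X 0 2" "X 1 2"] X_props(1) X_distinct by auto

lemma inside_corners: "classical D \<inter> domain_of T = {corner 0 1, corner 0 2, corner 1 2}"
proof -
  have "v \<in> {corner 0 1, corner 0 2, corner 1 2}" if v: "v \<in> classical D" "v \<in> domain_of T" for v
  proof -
    obtain i j x where *: "i < 3" "j < 3" "i \<noteq> j" "x \<in> {-1..1}" "f i x = f j x" "v = graph_point T f i x"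
      using classical_inside[OF v] by metis
    then have "v = corner i j" using X_props(4)[OF *(1-4)] by simp
    moreover have ind: "i = 0 \<and> j = 1 \<or> i = 1 \<and> j = 0 \<or> i = 0 \<and> j = 2 \<or> i = 2 \<and> j = 0 \<or>
      i = 1 \<and> j = 2 \<or> i = 2 \<and> j = 1" using *(1-3) by auto
    moreover have "corner i j \<in> {corner 0 1, corner 0 2, corner 1 2}"
      using * ind corner_sym[of 0 1] corner_sym[of 0 2] corner_sym[of 1 2] by auto
    ultimately show ?thesis by simp
  qed
  then show ?thesis using corner_classical corner_domain by auto
qed

lemma corner_time_order:
  "corner_time 0 1 < corner_time 0 2 \<longleftrightarrow> forward 0 = c" "corner_time 1 0 < corner_time 1 2 \<longleftrightarrow> forward 1 = c" "corner_time 2 0 < corner_time 2 1 \<longleftrightarrow> forward 2 = c"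
  "corner_time 0 2 < corner_time 0 1 \<longleftrightarrow> forward 0 \<noteq> c" "corner_time 1 2 < corner_time 1 0 \<longleftrightarrow> forward 1 \<noteq> c" "corner_time 2 1 < corner_time 2 0 \<longleftrightarrow> forward 2 \<noteq> c"
proof -
  have sym: "X 1 0 = X 0 1" "X 2 0 = X 0 2" "X 2 1 = X 1 2"
    using X_props(3)[of 0 1] X_props(3)[of 0 2] X_props(3)[of 1 2] by auto
  show "corner_time 0 1 < corner_time 0 2 \<longleftrightarrow> forward 0 = c" "corner_time 1 0 < corner_time 1 2 \<longleftrightarrow> forward 1 = c" "corner_time 2 0 < corner_time 2 1 \<longleftrightarrow> forward 2 = c"
    "corner_time 0 2 < corner_time 0 1 \<longleftrightarrow> forward 0 \<noteq> c" "corner_time 1 2 < corner_time 1 0 \<longleftrightarrow> forward 1 \<noteq> c" "corner_time 2 1 < corner_time 2 0 \<longleftrightarrow> forward 2 \<noteq> c"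
    unfolding sym using order_X dir_cases[of 0] dir_cases[of 1] dir_cases[of 2]
    by (auto simp: st_less split: if_splits)
qed

lemma pass_value:
  assumes h: "int_cycle h" and ij: "i < 3" "j < 3" "i \<noteq> j"
  shows "h (arc_out D (corner_time i j)) = h (arc_in D (corner_time i j)) + sgn_bool (is_ne i j) * jump h (corner i j)"
  using cycle_out[OF h corner_classical[OF ij]] corner_params[OF ij] by (auto simp: sgn_bool_def split: if_splits)

lemma strand_values:
  assumes h: "int_cycle h" and i: "i < 3" and j: "j < 3" "j \<noteq> i" and k: "k < 3" "k \<noteq> i" "k \<noteq> j"
    and ab: "margin i a b"
  shows "h (arc_in D (corner_time i j)) = (if corner_time i j < corner_time i k then h (arc_at D a)
      else h (arc_at D a) + sgn_bool (is_ne i k) * jump h (corner i k))" (is ?first)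
    and "h (arc_at D b) = h (arc_at D a) + sgn_bool (is_ne i j) * jump h (corner i j) + sgn_bool (is_ne i k) * jump h (corner i k)" (is ?total)
proof -
  have only: "z = X i j \<or> z = X i k" if "z \<in> {-1..1}" "l < 3" "l \<noteq> i" "f l z = f i z" for z l
  proof -
    have "l = j \<or> l = k" using that(2,3) i j k by auto
    then show ?thesis
      using X_props(4)[OF i j(1) j(2)[symmetric] that(1)] X_props(4)[OF i k(1) k(2)[symmetric] that(1)] that(4)
      by auto
  qed
  have only': "z = X i k \<or> z = X i j" if "z \<in> {-1..1}" "l < 3" "l \<noteq> i" "f l z = f i z" for z l
    using only[OF that] by blast
  note xj = X_props(1)[OF i j(1) j(2)[symmetric]] and xk = X_props(1)[OF i k(1) k(2)[symmetric]]
  note pj = pass_value[OF h i j(1) j(2)[symmetric]] and pk = pass_value[OF h i k(1) k(2)[symmetric]]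
  have "i = 0 \<and> (j = 1 \<and> k = 2 \<or> j = 2 \<and> k = 1) \<or> i = 1 \<and> (j = 0 \<and> k = 2 \<or> j = 2 \<and> k = 0)
    \<or> i = 2 \<and> (j = 0 \<and> k = 1 \<or> j = 1 \<and> k = 0)" using i j k by auto
  then have "corner_time i j < corner_time i k \<or> corner_time i k < corner_time i j" using corner_time_order by auto
  then consider "corner_time i j < corner_time i k" | "corner_time i k < corner_time i j" "\<not> corner_time i j < corner_time i k" by force
  then have "?first \<and> ?total"
  proof cases
    case 1
    then show ?thesis using strand_walk[OF i ab xj xk 1] only pj pk by simp
  next
    case 2
    then show ?thesis using strand_walk[OF i ab xk xj 2(1)] only' pj pk by simp
  qed
  then show ?first ?total by auto
qed

lemma crossing_isect_corner:
  assumes h: "int_cycle h" and k: "int_cycle k" and ij: "i < 3" "j < 3" "i \<noteq> j"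
  shows "crossing_isect h k (corner i j) = cross_term (is_ne i j)
    (h (arc_in D (corner_time i j))) (h (arc_in D (corner_time j i))) (jump h (corner i j))
    (k (arc_in D (corner_time i j))) (k (arc_in D (corner_time j i))) (jump k (corner i j))"
  using cycle_out[OF h corner_classical[OF ij]] cycle_out[OF k corner_classical[OF ij]] corner_params[OF ij]
  by (auto simp: crossing_isect_def cross_term_def split: if_splits)

lemma sgn_bool_not: "sgn_bool (\<not> b) = - sgn_bool b"
  by (simp add: sgn_bool_def)

text \<open>
  The values on the sides of the triangle are eliminated in favour of entry values and jumps.
\<close>

lemma triangle_sum:
  assumes h: "int_cycle h" and k: "int_cycle k"
    and m: "margin 0 a0 b0" "margin 1 a1 b1" "margin 2 a2 b2"
  shows "(\<Sum>w \<in> classical D \<inter> domain_of T. crossing_isect h k w) =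
    triangle_form (forward 0) (forward 1) (forward 2) (rises 0 1) c
      (h (arc_at D a0)) (h (arc_at D a1)) (h (arc_at D a2)) (jump h (corner 0 1)) (jump h (corner 0 2)) (jump h (corner 1 2))
      (k (arc_at D a0)) (k (arc_at D a1)) (k (arc_at D a2)) (jump k (corner 0 1)) (jump k (corner 0 2)) (jump k (corner 1 2))"
proof -
  have sum: "(\<Sum>w \<in> classical D \<inter> domain_of T. crossing_isect h k w)
    = crossing_isect h k (corner 0 1) + crossing_isect h k (corner 0 2) + crossing_isect h k (corner 1 2)"
    unfolding inside_corners using corner_distinct by simp
  have sym: "corner 1 0 = corner 0 1" "corner 2 0 = corner 0 2" "corner 2 1 = corner 1 2"
    using corner_sym[of 0 1] corner_sym[of 0 2] corner_sym[of 1 2] by auto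
  have flip: "is_ne 1 0 = (\<not> is_ne 0 1)" "is_ne 2 0 = (\<not> is_ne 0 2)" "is_ne 2 1 = (\<not> is_ne 1 2)"
    using is_ne_flip[of 0 1] is_ne_flip[of 0 2] is_ne_flip[of 1 2] by auto
  have v: "g (arc_in D (corner_time 0 1)) = (if forward 0 = c then g (arc_at D a0) else g (arc_at D a0) + sgn_bool (is_ne 0 2) * jump g (corner 0 2))"
    "g (arc_in D (corner_time 0 2)) = (if forward 0 = c then g (arc_at D a0) + sgn_bool (is_ne 0 1) * jump g (corner 0 1) else g (arc_at D a0))"
    "g (arc_in D (corner_time 1 0)) = (if forward 1 = c then g (arc_at D a1) else g (arc_at D a1) + sgn_bool (is_ne 1 2) * jump g (corner 1 2))"
    "g (arc_in D (corner_time 1 2)) = (if forward 1 = c then g (arc_at D a1) - sgn_bool (is_ne 0 1) * jump g (corner 0 1) else g (arc_at D a1))"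
    "g (arc_in D (corner_time 2 0)) = (if forward 2 = c then g (arc_at D a2) else g (arc_at D a2) - sgn_bool (is_ne 1 2) * jump g (corner 1 2))"
    "g (arc_in D (corner_time 2 1)) = (if forward 2 = c then g (arc_at D a2) - sgn_bool (is_ne 0 2) * jump g (corner 0 2) else g (arc_at D a2))"
    if g: "int_cycle g" for g
    using strand_values(1)[OF g, of 0 1 2, OF _ _ _ _ _ _ m(1)] strand_values(1)[OF g, of 0 2 1, OF _ _ _ _ _ _ m(1)]
      strand_values(1)[OF g, of 1 0 2, OF _ _ _ _ _ _ m(2)] strand_values(1)[OF g, of 1 2 0, OF _ _ _ _ _ _ m(2)]
      strand_values(1)[OF g, of 2 0 1, OF _ _ _ _ _ _ m(3)] strand_values(1)[OF g, of 2 1 0, OF _ _ _ _ _ _ m(3)]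
    by (simp_all add: corner_time_order sym flip sgn_bool_not)
  have i: "crossing_isect h k (corner 0 1) = cross_term (is_ne 0 1)
    (h (arc_in D (corner_time 0 1))) (h (arc_in D (corner_time 1 0))) (jump h (corner 0 1))
    (k (arc_in D (corner_time 0 1))) (k (arc_in D (corner_time 1 0))) (jump k (corner 0 1))"
    "crossing_isect h k (corner 0 2) = cross_term (is_ne 0 2)
    (h (arc_in D (corner_time 0 2))) (h (arc_in D (corner_time 2 0))) (jump h (corner 0 2))
    (k (arc_in D (corner_time 0 2))) (k (arc_in D (corner_time 2 0))) (jump k (corner 0 2))"
    "crossing_isect h k (corner 1 2) = cross_term (is_ne 1 2)
    (h (arc_in D (corner_time 1 2))) (h (arc_in D (corner_time 2 1))) (jump h (corner 1 2))
    (k (arc_in D (corner_time 1 2))) (k (arc_in D (corner_time 2 1))) (jump k (corner 1 2))"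
    by (rule crossing_isect_corner[OF h k]; simp)+
  show ?thesis
    unfolding sum i v[OF h] v[OF k] triangle_form_def Let_def is_ne_eq[symmetric] ..
qed

lemma left_half_corner:
  assumes ij: "i < 3" "j < 3" "i \<noteq> j" and t: "curve D t \<notin> domain_of T" "t \<notin> passages D"
  shows "left_half D (corner i j) (arc_at D t) =
    of_bool (t \<in> (if is_ne i j then between (start T j) (start T i) else between (start T i) (start T j)))"
proof -
  note p = corner_params[OF ij] and x = X_props[OF ij]
  have x': "X j i \<in> {-1..1}" using x(1,3) by simp
  show ?thesis
  proof (cases "is_ne i j")
    case True
    then have "ne_param D (corner i j) = frac (corner_time i j)" "nw_param D (corner i j) = frac (corner_time j i)" using p by auto
    then show ?thesis
      using True left_half_outside[OF corner_classical[OF ij] _ _ ij x(1) x' t] by simp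
  next
    case False
    then have "ne_param D (corner i j) = frac (corner_time j i)" "nw_param D (corner i j) = frac (corner_time i j)" using p by auto
    then show ?thesis
      using False left_half_outside[OF corner_classical[OF ij] _ _ ij(2,1) ij(3)[symmetric] x' x(1) t] by simp
  qed
qed

text \<open>
  Outside of the region the half of a corner goes from its NW strand to its NE strand. With their
  signs, and up to multiples of the whole diagram, the three halves join to a closed path through
  the three strands; such a path passes every outer point equally often.
\<close>

lemma triangle_halves:
  obtains m :: int where "\<And>t. curve D t \<notin> domain_of T \<Longrightarrow> t \<notin> passages D \<Longrightarrow>
    triangle_sign T X 0 1 2 * left_half D (corner 0 1) (arc_at D t)
    + triangle_sign T X 0 2 1 * left_half D (corner 0 2) (arc_at D t)
    + triangle_sign T X 1 2 0 * left_half D (corner 1 2) (arc_at D t) = m"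
proof -
  obtain k where k: "\<And>t. curve D t \<notin> domain_of T \<Longrightarrow>
    of_bool (t \<in> between (start T 0) (start T 1)) + of_bool (t \<in> between (start T 1) (start T 2))
      + of_bool (t \<in> between (start T 2) (start T 0)) = (k :: int)"
    using between_starts_three by auto
  have signs: "triangle_sign T X 0 1 2 = (if (forward 0 = c) = (forward 1 = c) then - 1 else 1)"
    "triangle_sign T X 0 2 1 = (if (forward 0 = c) \<noteq> (forward 2 = c) then - 1 else 1)"
    "triangle_sign T X 1 2 0 = (if (forward 1 = c) = (forward 2 = c) then - 1 else 1)"
    using corner_time_order unfolding triangle_sign_def side_leaves_def by auto
  \<comment> \<open>The half at \<open>ij\<close> is \<open>\<beta>\<^sub>j\<^sub>i\<close> or \<open>\<beta>\<^sub>i\<^sub>j = 1 - \<beta>\<^sub>j\<^sub>i\<close>, where \<open>\<beta>\<^sub>i\<^sub>j\<close> is 1 between strand \<open>i\<close> and strand \<open>j\<close>. With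
    the signs the sum is \<open>\<plusminus>(\<beta>\<^sub>1\<^sub>0 + \<beta>\<^sub>2\<^sub>1 - \<beta>\<^sub>2\<^sub>0)\<close> plus a constant, and \<open>\<beta>\<^sub>0\<^sub>1 + \<beta>\<^sub>1\<^sub>2 + \<beta>\<^sub>2\<^sub>0 = k\<close>.\<close>
  define m where "m = triangle_sign T X 0 1 2 * sgn_bool (is_ne 0 1) * (2 - k)
    + (if is_ne 0 1 then 0 else triangle_sign T X 0 1 2) + (if is_ne 0 2 then 0 else triangle_sign T X 0 2 1)
    + (if is_ne 1 2 then 0 else triangle_sign T X 1 2 0)"
  show ?thesis
  proof
    fix t assume t: "curve D t \<notin> domain_of T" "t \<notin> passages D"
    have flips: "t \<in> between (start T 1) (start T 0) \<longleftrightarrow> t \<notin> between (start T 0) (start T 1)"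
      "t \<in> between (start T 2) (start T 1) \<longleftrightarrow> t \<notin> between (start T 1) (start T 2)"
      "t \<in> between (start T 2) (start T 0) \<longleftrightarrow> t \<notin> between (start T 0) (start T 2)"
      using between_starts_flip[of 0 1 t] between_starts_flip[of 1 2 t] between_starts_flip[of 0 2 t] t(1) by auto
    define b01 b12 b02 where "b01 = (of_bool (t \<in> between (start T 0) (start T 1)) :: int)"
      and "b12 = (of_bool (t \<in> between (start T 1) (start T 2)) :: int)"
      and "b02 = (of_bool (t \<in> between (start T 0) (start T 2)) :: int)"
    have k': "k = b01 + b12 + (1 - b02)"
      using k[OF t(1)] by (simp add: flips(3) b01_def b12_def b02_def of_bool_not_iff)
    have l: "left_half D (corner 0 1) (arc_at D t) = (if is_ne 0 1 then 1 - b01 else b01)"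
      "left_half D (corner 0 2) (arc_at D t) = (if is_ne 0 2 then 1 - b02 else b02)"
      "left_half D (corner 1 2) (arc_at D t) = (if is_ne 1 2 then 1 - b12 else b12)"
      using left_half_corner[OF _ _ _ t, of 0 1] left_half_corner[OF _ _ _ t, of 0 2] left_half_corner[OF _ _ _ t, of 1 2]
      by (simp_all add: flips b01_def b12_def b02_def of_bool_not_iff)
    show "triangle_sign T X 0 1 2 * left_half D (corner 0 1) (arc_at D t)
      + triangle_sign T X 0 2 1 * left_half D (corner 0 2) (arc_at D t)
      + triangle_sign T X 1 2 0 * left_half D (corner 1 2) (arc_at D t) = m"
      unfolding m_def l signs k' is_ne_eq
      by (cases "forward 0"; cases "forward 1"; cases "forward 2"; cases "rises 0 1"; cases c; simp add: sgn_bool_def)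
  qed
qed

end

text \<open>
  The crossings appear in opposite orders in the two pictures, which are otherwise alike.
\<close>

locale R3_pair = picture_pair D D' T "3::nat" f f' + Q: R3_picture D T f X c + Q': R3_picture D' T f' X' "\<not> c"
  for D D' T f f' X X' c +
  assumes same_right_end: "\<And>i. i < 3 \<Longrightarrow> f' i 1 = f i 1"
begin

declare One_nat_def [simp del]

lemma rises_same: "i < 3 \<Longrightarrow> j < 3 \<Longrightarrow> Q'.rises i j = Q.rises i j"
  by (simp add: Q.rises_def Q'.rises_def same_right_end)

lemma is_ne_same: "i < 3 \<Longrightarrow> j < 3 \<Longrightarrow> Q'.is_ne i j = Q.is_ne i j"
  by (simp add: Q.is_ne_def Q'.is_ne_def rises_same)

lemma writhe_same: "i < 3 \<Longrightarrow> j < 3 \<Longrightarrow> i \<noteq> j \<Longrightarrow> writhe D' (Q'.corner i j) = writhe D (Q.corner i j)"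
  by (simp add: Q.corner_writhe Q'.corner_writhe is_ne_same)

lemma match_left_half_corner:
  assumes "i < 3" "j < 3" "i \<noteq> j"
  shows "match (left_half D (Q.corner i j)) (left_half D' (Q'.corner i j))"
  unfolding match_def
  using Q.left_half_corner[OF assms] Q'.left_half_corner[OF assms] is_ne_same[OF assms(1,2)]
  by (simp add: inside_same outer_passages)

text \<open>
  Both sides of the move have the same entry values, jumps, directions and signs of crossings; they
  differ only in the order of the crossings, to which the triangle form is insensitive.
\<close>

theorem R3_intersection:
  assumes h: "P.int_cycle h" "P'.int_cycle h'" and k: "P.int_cycle k" "P'.int_cycle k'"
    and m: "match h h'" "match k k'"
    and jumps: "\<And>i j. i < 3 \<Longrightarrow> j < 3 \<Longrightarrow> i \<noteq> j \<Longrightarrow> P'.jump h' (Q'.corner i j) = P.jump h (Q.corner i j)"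
      "\<And>i j. i < 3 \<Longrightarrow> j < 3 \<Longrightarrow> i \<noteq> j \<Longrightarrow> P'.jump k' (Q'.corner i j) = P.jump k (Q.corner i j)"
  shows "intersection_number D h k = intersection_number D' h' k'"
proof (rule intersection_by_inside[OF k m])
  obtain a0 b0 where m0: "P.margin 0 a0 b0" "P'.margin 0 a0 b0"
    "curve D a0 \<notin> domain_of T" "curve D b0 \<notin> domain_of T" "a0 \<notin> passages D" "b0 \<notin> passages D"
    using margins[of 0] by auto
  obtain a1 b1 where m1: "P.margin 1 a1 b1" "P'.margin 1 a1 b1"
    "curve D a1 \<notin> domain_of T" "curve D b1 \<notin> domain_of T" "a1 \<notin> passages D" "b1 \<notin> passages D"
    using margins[of 1] by auto
  obtain a2 b2 where m2: "P.margin 2 a2 b2" "P'.margin 2 a2 b2"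
    "curve D a2 \<notin> domain_of T" "curve D b2 \<notin> domain_of T" "a2 \<notin> passages D" "b2 \<notin> passages D"
    using margins[of 2] by auto
  have a: "h' (arc_at D' a) = h (arc_at D a)" "k' (arc_at D' a) = k (arc_at D a)"
    if "curve D a \<notin> domain_of T" "a \<notin> passages D" for a
    using m that by (auto simp: match_def)
  show "(\<Sum>w \<in> classical D \<inter> domain_of T. P.crossing_isect h k w)
      = (\<Sum>w \<in> classical D' \<inter> domain_of T. P'.crossing_isect h' k' w)"
    unfolding Q.triangle_sum[OF h(1) k(1) m0(1) m1(1) m2(1)] Q'.triangle_sum[OF h(2) k(2) m0(2) m1(2) m2(2)]
      triangle_form_swap
    using a[OF m0(3,5)] a[OF m1(3,5)] a[OF m2(3,5)] rises_same[of 0 1] jumps(1)[of 0 1] jumps(1)[of 0 2]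
      jumps(1)[of 1 2] jumps(2)[of 0 1] jumps(2)[of 0 2] jumps(2)[of 1 2] by simp
qed

text \<open>
  A cycle that enters and leaves with value 0 on all strands is a multiple of the boundary of
  the triangle.
\<close>

theorem R3_vanish:
  assumes h: "P.int_cycle h" and k: "P.int_cycle k" and v: "vanish h"
  shows "intersection_number D h k = 0"
proof -
  obtain a0 b0 where m0: "P.margin 0 a0 b0" "P'.margin 0 a0 b0"
    "curve D a0 \<notin> domain_of T" "curve D b0 \<notin> domain_of T" "a0 \<notin> passages D" "b0 \<notin> passages D"
    using margins[of 0] by auto
  obtain a1 b1 where m1: "P.margin 1 a1 b1" "P'.margin 1 a1 b1"
    "curve D a1 \<notin> domain_of T" "curve D b1 \<notin> domain_of T" "a1 \<notin> passages D" "b1 \<notin> passages D"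
    using margins[of 1] by auto
  obtain a2 b2 where m2: "P.margin 2 a2 b2" "P'.margin 2 a2 b2"
    "curve D a2 \<notin> domain_of T" "curve D b2 \<notin> domain_of T" "a2 \<notin> passages D" "b2 \<notin> passages D"
    using margins[of 2] by auto
  have z: "h (arc_at D a0) = 0" "h (arc_at D b0) = 0" "h (arc_at D a1) = 0" "h (arc_at D b1) = 0"
    "h (arc_at D a2) = 0"
    using v m0 m1 m2 by (simp_all add: vanish_def)
  \<comment> \<open>The value on the side of the triangle that lies on strand 0 determines the other two sides.\<close>
  define t where "t = sgn_bool (Q.is_ne 0 1) * P.jump h (Q.corner 0 1)"
  have sq': "sgn_bool b * (sgn_bool b * x) = x" for b x by (simp add: sgn_bool_def)
  have "t + sgn_bool (Q.is_ne 0 2) * P.jump h (Q.corner 0 2) = 0"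
    using Q.strand_values(2)[OF h, of 0 1 2, OF _ _ _ _ _ _ m0(1)] z by (simp add: t_def)
  then have r02: "P.jump h (Q.corner 0 2) = - sgn_bool (Q.is_ne 0 2) * t"
    using sq'[of "Q.is_ne 0 2"] by (metis add_eq_0_iff minus_minus mult_minus_left mult_minus_right)
  have "- t + sgn_bool (Q.is_ne 1 2) * P.jump h (Q.corner 1 2) = 0"
    using Q.strand_values(2)[OF h, of 1 0 2, OF _ _ _ _ _ _ m1(1)] z Q.corner_sym[of 0 1] Q.is_ne_flip[of 0 1]
    by (simp add: t_def Q.sgn_bool_not)
  then have r12: "P.jump h (Q.corner 1 2) = sgn_bool (Q.is_ne 1 2) * t"
    using sq'[of "Q.is_ne 1 2"] by (metis add_eq_0_iff minus_minus mult_minus_left mult_minus_right)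
  have r01: "P.jump h (Q.corner 0 1) = sgn_bool (Q.is_ne 0 1) * t" by (simp add: t_def sq')
  have "(\<Sum>w \<in> classical D \<inter> domain_of T. P.crossing_isect h k w) = 0"
    unfolding Q.triangle_sum[OF h k m0(1) m1(1) m2(1)] z r01 r02 r12
    by (simp only: Q.is_ne_eq triangle_form_closed)
  then show ?thesis using vanish_inside[OF k v] by simp
qed

lemma triangle_halves_intersection:
  obtains m :: int where "\<And>k. P.int_cycle k \<Longrightarrow>
    triangle_sign T X 0 1 2 * intersection_number D (left_half D (Q.corner 0 1)) k
    + triangle_sign T X 0 2 1 * intersection_number D (left_half D (Q.corner 0 2)) k
    + triangle_sign T X 1 2 0 * intersection_number D (left_half D (Q.corner 1 2)) k
    = m * intersection_number D (whole D) k"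
proof -
  obtain m where m: "\<And>t. curve D t \<notin> domain_of T \<Longrightarrow> t \<notin> passages D \<Longrightarrow>
    triangle_sign T X 0 1 2 * left_half D (Q.corner 0 1) (arc_at D t)
    + triangle_sign T X 0 2 1 * left_half D (Q.corner 0 2) (arc_at D t)
    + triangle_sign T X 1 2 0 * left_half D (Q.corner 1 2) (arc_at D t) = m"
    using Q.triangle_halves by blast
  let ?h = "\<lambda>a. ((triangle_sign T X 0 1 2 * left_half D (Q.corner 0 1) a
    + triangle_sign T X 0 2 1 * left_half D (Q.corner 0 2) a)
    + triangle_sign T X 1 2 0 * left_half D (Q.corner 1 2) a) + (- m) * whole D a"
  have cyc: "P.int_cycle ?h"
    by (intro P.int_cycle_add P.int_cycle_scale P.int_cycle_left_half P.int_cycle_whole Q.corner_classical) auto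
  have van: "vanish ?h"
    using m by (auto simp: vanish_def whole_def P.arc_at_in)
  show ?thesis
  proof
    fix k assume k: "P.int_cycle k"
    have "intersection_number D ?h k = 0" by (rule R3_vanish[OF cyc k van])
    then show "triangle_sign T X 0 1 2 * intersection_number D (left_half D (Q.corner 0 1)) k
      + triangle_sign T X 0 2 1 * intersection_number D (left_half D (Q.corner 0 2)) k
      + triangle_sign T X 1 2 0 * intersection_number D (left_half D (Q.corner 1 2)) k
      = m * intersection_number D (whole D) k"
      unfolding P.intersection_add_left[OF k] P.intersection_scale_left[OF k] by simp
  qed
qed

end

lemma R3_moveE:
  assumes "R3_move D D' T f f' X X'"
  obtains c where "R3_pair D D' T f f' X X' c"
proof -
  have lm: "local_move D D' T 3 f f'"
    and X: "\<And>i j. i < 3 \<Longrightarrow> j < 3 \<Longrightarrow> i \<noteq> j \<Longrightarrow> {x \<in> {-1..1}. f i x = f j x} = {X i j}"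
    and X': "\<And>i j. i < 3 \<Longrightarrow> j < 3 \<Longrightarrow> i \<noteq> j \<Longrightarrow> {x \<in> {-1..1}. f' i x = f' j x} = {X' i j}"
    and order: "X 0 1 < X 0 2 \<and> X 0 2 < X 1 2 \<and> X' 1 2 < X' 0 2 \<and> X' 0 2 < X' 0 1 \<or>
      X' 0 1 < X' 0 2 \<and> X' 0 2 < X' 1 2 \<and> X 1 2 < X 0 2 \<and> X 0 2 < X 0 1"
    using assms unfolding R3_move_def by blast+
  have sym: "X j i = X i j" if "i < 3" "j < 3" "i \<noteq> j" for i j
  proof -
    have "{x \<in> {-1..1}. f i x = f j x} = {x \<in> {-1..1}. f j x = f i x}" by auto
    then show ?thesis using X[OF that] X[OF that(2,1) that(3)[symmetric]] by simp
  qed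
  have rng: "X i j \<in> {-1..1}" "X' i j \<in> {-1..1}" if "i < 3" "j < 3" "i \<noteq> j" for i j
    using eqset_imp_iff[OF X[OF that], of "X i j"] eqset_imp_iff[OF X'[OF that], of "X' i j"] by auto
  have ends: "f i x \<noteq> f j x" if ij: "i < 3" "j < 3" "i \<noteq> j" and x: "x \<in> {-1, 1}" for i j x
  proof
    assume eq: "f i x = f j x"
    then have eq': "f' i x = f' j x" using local_move_boundary[OF lm _ x] ij by simp
    have "x \<in> {-1..1}" using x by auto
    have at: "x = X i j" "x = X' i j"
      using eqset_imp_iff[OF X[OF ij], of x] eqset_imp_iff[OF X'[OF ij], of x] eq eq' \<open>x \<in> {-1..1}\<close> by auto
    have at': "x = X j i" "x = X' j i"
      using eqset_imp_iff[OF X[OF ij(2,1) ij(3)[symmetric]], of x]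
        eqset_imp_iff[OF X'[OF ij(2,1) ij(3)[symmetric]], of x] eq eq' \<open>x \<in> {-1..1}\<close> by auto
    have "i = 0 \<and> j = 1 \<or> i = 1 \<and> j = 0 \<or> i = 0 \<and> j = 2 \<or> i = 2 \<and> j = 0 \<or> i = 1 \<and> j = 2 \<or> i = 2 \<and> j = 1"
      using ij by auto
    then have "x = X 0 1 \<and> x = X' 0 1 \<or> x = X 0 2 \<and> x = X' 0 2 \<or> x = X 1 2 \<and> x = X' 1 2"
      using at at' by auto
    then show False
      using order x rng[of 0 1] rng[of 0 2] rng[of 1 2] by auto
  qed
  interpret picture_pair D D' T 3 f f' by (rule local_move_pairI[OF lm ends])
  \<comment> \<open>\<open>c\<close> records in which of the two orders the crossings of \<open>D\<close> appear.\<close>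
  define c where "c \<longleftrightarrow> X 0 1 < X 0 2"
  have oX: "if c then X 0 1 < X 0 2 \<and> X 0 2 < X 1 2 else X 1 2 < X 0 2 \<and> X 0 2 < X 0 1"
    and oX': "if \<not> c then X' 0 1 < X' 0 2 \<and> X' 0 2 < X' 1 2 else X' 1 2 < X' 0 2 \<and> X' 0 2 < X' 0 1"
    using order by (auto simp: c_def)
  have end1: "f' i 1 = f i 1" if "i < 3" for i using local_move_boundary[OF lm that, of 1] by simp
  have "R3_pair D D' T f f' X X' c"
    by unfold_locales (rule X X' oX oX' end1; assumption)+
  then show ?thesis using that by blast
qed

section \<open>Isotopies and detour moves\<close>

text \<open>
  The Jacobian determinant never vanishes during the isotopy and is 1 at the beginning.
\<close>

lemma ambient_isotopy_end:
  assumes "ambient_isotopy H"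
  obtains L where "(H 1 has_derivative L) (at z)" "wedge (L 1) (L \<i>) > 0"
proof -
  obtain H' where d: "\<And>s z. s \<in> {0..1} \<Longrightarrow> (H s has_derivative H' s z) (at z)"
    and nz: "\<And>s z. s \<in> {0..1} \<Longrightarrow> wedge (H' s z 1) (H' s z \<i>) \<noteq> 0"
    and c: "\<And>w. continuous_on ({0..1} \<times> UNIV) (\<lambda>(s, z). H' s z w)"
    using assms unfolding ambient_isotopy_def by blast
  have c': "continuous_on {0..1} (\<lambda>s. H' s z w)" for w
  proof -
    have "continuous_on {0..1} (\<lambda>s::real. (s, z))" by (intro continuous_intros)
    then have "continuous_on {0..1} (\<lambda>s. case (s, z) of (s, z) \<Rightarrow> H' s z w)"
      by (rule continuous_on_compose2[OF c[of w]]) auto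
    then show ?thesis by simp
  qed
  have "continuous_on {0..1} (\<lambda>s. wedge (H' s z 1) (H' s z \<i>))"
    unfolding wedge_def by (intro continuous_intros c')
  then have "wedge (H' 0 z 1) (H' 0 z \<i>) > 0 \<longleftrightarrow> wedge (H' 1 z 1) (H' 1 z \<i>) > 0"
    using nz by (intro no_zero_same_sign[where g = "\<lambda>s. wedge (H' s z 1) (H' s z \<i>)"]) auto
  moreover have "H' 0 z = (\<lambda>x. x)"
  proof (rule has_derivative_unique)
    show "(H 0 has_derivative H' 0 z) (at z)" using d by simp
    have "H 0 = (\<lambda>z. z)" using assms by (auto simp: ambient_isotopy_def)
    then show "(H 0 has_derivative (\<lambda>x. x)) (at z)" by simp
  qed
  ultimately have "wedge (H' 1 z 1) (H' 1 z \<i>) > 0" by (simp add: wedge_def)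
  then show ?thesis using that d[of 1 z] by auto
qed

locale isotopy_pair = P: diagram D + P': diagram D' for D D' :: vdiag +
  fixes H :: "real \<Rightarrow> complex \<Rightarrow> complex" and r :: "real \<Rightarrow> real"
  assumes move: "isotopy_move D D' H r"
begin

lemma r_deriv: obtains r' where "\<And>t. (r has_real_derivative r' t) (at t)" "\<And>t. r' t > 0"
  using move unfolding isotopy_move_def circle_reparam_def by blast

lemma r_mono: "r a < r b \<longleftrightarrow> a < b"
proof -
  have "r a < r b" if "a < b" for a b
  proof -
    obtain r' where "\<And>t. (r has_real_derivative r' t) (at t)" "\<And>t. r' t > 0" using r_deriv by blast
    then show ?thesis using DERIV_pos_imp_increasing[OF that, of r] by blast
  qed
  then show ?thesis by (metis less_asym linorder_neqE_linordered_idom)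
qed

lemma r_shift: "r (t + of_int n) = r t + of_int n"
proof -
  have *: "r (t + 1) = r t + 1" for t
    using move by (simp add: isotopy_move_def circle_reparam_def)
  show ?thesis
  proof (induction n rule: int_induct[where k = 0])
    case (step1 i)
    then show ?case using *[of "t + of_int i"] by (simp add: algebra_simps)
  next
    case (step2 i)
    then show ?case using *[of "t + of_int (i - 1)"] by (simp add: algebra_simps)
  qed simp
qed

lemma r_surj: obtains t where "r t = y"
proof -
  obtain n where n: "r 0 \<le> y + of_int n" "y + of_int n < r 0 + 1" by (rule representative_after)
  obtain r' where "\<And>t. (r has_real_derivative r' t) (at t)" using r_deriv by blast
  then have "continuous_on {0..1} r"
    by (meson DERIV_isCont continuous_at_imp_continuous_on)
  moreover have "r 1 = r 0 + 1" using r_shift[of 0 1] by simp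
  ultimately obtain t where "r t = y + of_int n" using IVT'[of r 0 "y + of_int n" 1] n by auto
  then have "r (t + of_int (- n)) = y" by (simp only: r_shift)
  then show ?thesis using that by blast
qed

lemma frac_r_frac [simp]: "frac (r (frac t)) = frac (r t)"
  by (simp only: frac_shift[of t] r_shift frac_add_of_int_right)

lemma between_r: "r t \<in> between (r p) (r q) \<longleftrightarrow> t \<in> between p q"
proof -
  obtain n where n: "p \<le> t + of_int n" "t + of_int n < p + 1" by (rule representative_after)
  obtain m where m: "p \<le> q + of_int m" "q + of_int m < p + 1" by (rule representative_after)
  have mono: "r a \<le> r b \<longleftrightarrow> a \<le> b" for a b using r_mono[of b a] by (simp add: not_less[symmetric])
  have one: "r (p + 1) = r p + 1" using r_shift[of p 1] by simp
  have "r t \<in> between (r p) (r q) \<longleftrightarrow> r (t + of_int n) \<in> between (r p) (r (q + of_int m))"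
    by (simp add: r_shift)
  also have "\<dots> \<longleftrightarrow> t + of_int n \<in> between p (q + of_int m)"
    using n m by (subst (1 2) between_iff) (simp_all add: mono r_mono flip: one)
  finally show ?thesis by simp
qed

lemma curve': "curve D' t = H 1 (curve D (r t))"
  using move by (simp add: isotopy_move_def)

lemma over': "t \<in> over D' \<longleftrightarrow> t \<in> {0..<1} \<and> frac (r t) \<in> over D"
  using move by (auto simp: isotopy_move_def)

lemma inj_H: "inj (H 1)"
  using move by (simp add: isotopy_move_def ambient_isotopy_def bij_is_inj)

lemma classical': "classical D' = H 1 ` classical D"
proof
  show "classical D' \<subseteq> H 1 ` classical D"
  proof
    fix v assume "v \<in> classical D'"
    then obtain t where t: "t \<in> over D'" "v = curve D' t" by (auto simp: classical_def)
    then have "v = H 1 (curve D (frac (r t)))" by (simp add: curve')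
    moreover have "curve D (frac (r t)) \<in> classical D"
      unfolding classical_def using t(1) over' by blast
    ultimately show "v \<in> H 1 ` classical D" by blast
  qed
  show "H 1 ` classical D \<subseteq> classical D'"
  proof
    fix v assume "v \<in> H 1 ` classical D"
    then obtain p where p: "p \<in> over D" "v = H 1 (curve D p)" by (auto simp: classical_def)
    obtain t where t: "r t = p" by (rule r_surj)
    have "frac p = p" using P.over_bounds[OF p(1)] by simp
    then have "frac t \<in> over D'" using p(1) t by (simp add: over' frac_lt_1)
    moreover have "curve D' (frac t) = v" using p(2) t curve'[of t] by (simp only: P'.curve_frac)
    ultimately show "v \<in> classical D'" unfolding classical_def by blast
  qed
qed

lemma passages': "t \<in> passages D' \<longleftrightarrow> r t \<in> passages D"
  unfolding passages_def classical' by (simp add: curve' inj_image_mem_iff[OF inj_H])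

lemma params':
  assumes v: "v \<in> classical D"
  shows "frac (r (ne_param D' (H 1 v))) = ne_param D v" "frac (r (nw_param D' (H 1 v))) = nw_param D v"
    "writhe D' (H 1 v) = writhe D v"
proof -
  obtain p where p: "r p = ne_param D v" by (rule r_surj)
  obtain q where q: "r q = nw_param D v" by (rule r_surj)
  have amb: "ambient_isotopy H" using move by (simp add: isotopy_move_def)
  obtain L where L: "(H 1 has_derivative L) (at v)" "wedge (L 1) (L \<i>) > 0"
    using ambient_isotopy_end[OF amb] by blast
  obtain r' where r': "\<And>t. (r has_real_derivative r' t) (at t)" "\<And>t. r' t > 0" using r_deriv by blast
  have vel: "velocity D' t = r' t *\<^sub>R L (velocity D (r t))" if "curve D (r t) = v" for t
  proof -
    have "((curve D \<circ> r) has_vector_derivative r' t *\<^sub>R velocity D (r t)) (at t)"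
      by (rule vector_diff_chain_at)
        (use r'(1) P.has_velocity in \<open>auto simp: has_real_derivative_iff_has_vector_derivative\<close>)
    then have "((H 1 \<circ> (curve D \<circ> r)) has_vector_derivative L (r' t *\<^sub>R velocity D (r t))) (at t)"
      by (rule vector_derivative_diff_chain_within) (use L(1) that has_derivative_at_withinI in auto)
    moreover have "H 1 \<circ> (curve D \<circ> r) = curve D'" by (rule ext) (simp add: curve')
    ultimately have "(curve D' has_vector_derivative L (r' t *\<^sub>R velocity D (r t))) (at t)"
      by (simp only:)
    with P'.has_velocity have "velocity D' t = L (r' t *\<^sub>R velocity D (r t))"
      by (rule vector_derivative_unique_at)
    then show ?thesis using linear_scale[OF has_derivative_linear[OF L(1)]] by simp
  qed
  have c: "curve D (r p) = v" "curve D (r q) = v" using p q P.crossing(3,4)[OF v] by auto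
  have "wedge (velocity D' p) (velocity D' q)
    = r' p * r' q * (wedge (L 1) (L \<i>) * wedge (velocity D (r p)) (velocity D (r q)))"
    unfolding vel[OF c(1)] vel[OF c(2)] wedge_scale
      wedge_linear[OF has_derivative_linear[OF L(1)], of "velocity D (r p)" "velocity D (r q)"] ..
  also have "\<dots> > 0"
    using r'(2) L(2) P.wedge_params[OF v] by (simp add: p q)
  finally have "wedge (velocity D' (frac p)) (velocity D' (frac q)) > 0" by simp
  moreover have cf: "curve D' (frac p) = H 1 v" "curve D' (frac q) = H 1 v"
    using curve'[of p] curve'[of q] c by (simp_all only: P'.curve_frac)
  ultimately have ne: "ne_param D' (H 1 v) = frac p" and nw: "nw_param D' (H 1 v) = frac q"
    using P'.params_eqI[OF _ cf(1) _ cf(2)] by (simp_all add: frac_lt_1)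
  show "frac (r (ne_param D' (H 1 v))) = ne_param D v" "frac (r (nw_param D' (H 1 v))) = nw_param D v"
    using P.frac_params[OF v] by (simp_all add: ne nw p q)
  show "writhe D' (H 1 v) = writhe D v"
    using P.frac_params[OF v] by (simp add: writhe_def ne over' p frac_lt_1)
qed

text \<open>
  Agreement on arcs that correspond under the reparametrisation, expressed through their points.
\<close>

definition match :: "(real set \<Rightarrow> int) \<Rightarrow> (real set \<Rightarrow> int) \<Rightarrow> bool" where
  "match h h' \<longleftrightarrow> (\<forall>t. t \<notin> passages D' \<longrightarrow> h (arc_at D (r t)) = h' (arc_at D' t))"

lemma match_passage:
  assumes m: "match h h'"
  shows "h (arc_in D (r p)) = h' (arc_in D' p)" "h (arc_out D (r p)) = h' (arc_out D' p)"
proof -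
  have le: "r a \<le> r b \<longleftrightarrow> a \<le> b" for a b using r_mono[of b a] by (simp add: not_less[symmetric])
  obtain t where t: "t < p" "{t..<p} \<inter> passages D' = {}" using P'.clear_before[of 1 p] by auto
  have "y \<notin> passages D" if "r t \<le> y" "y < r p" for y
  proof -
    obtain s where "r s = y" by (rule r_surj)
    then show ?thesis using t(2) that passages'[of s] le r_mono by (auto simp: disjoint_iff)
  qed
  then have "arc_in D (r p) = arc_at D (r t)" using t(1) by (intro P.arc_in_eq) (auto simp: r_mono)
  then show "h (arc_in D (r p)) = h' (arc_in D' p)"
    using P'.arc_in_eq[OF t] m t by (auto simp: match_def disjoint_iff)
  obtain t where t: "p < t" "{p<..t} \<inter> passages D' = {}" using P'.clear_after[of 1 p] by auto
  have "y \<notin> passages D" if "r p < y" "y \<le> r t" for y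
  proof -
    obtain s where "r s = y" by (rule r_surj)
    then show ?thesis using t(2) that passages'[of s] le r_mono by (auto simp: disjoint_iff)
  qed
  then have "arc_out D (r p) = arc_at D (r t)" using t(1) by (intro P.arc_out_eq) (auto simp: r_mono)
  then show "h (arc_out D (r p)) = h' (arc_out D' p)"
    using P'.arc_out_eq[OF t] m t by (auto simp: match_def disjoint_iff)
qed

lemma crossing_isect_same:
  assumes v: "v \<in> classical D" and m: "match h h'" "match c c'"
  shows "P'.crossing_isect h' c' (H 1 v) = P.crossing_isect h c v"
proof -
  have *: "arc_in D (ne_param D v) = arc_in D (r (ne_param D' (H 1 v)))"
    "arc_out D (ne_param D v) = arc_out D (r (ne_param D' (H 1 v)))"
    "arc_in D (nw_param D v) = arc_in D (r (nw_param D' (H 1 v)))"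
    "arc_out D (nw_param D v) = arc_out D (r (nw_param D' (H 1 v)))"
    using params'(1,2)[OF v] P.arc_in_frac P.arc_out_frac by metis+
  show ?thesis
    unfolding P.crossing_isect_def P'.crossing_isect_def * match_passage[OF m(1)] match_passage[OF m(2)] ..
qed

lemma intersection_same:
  assumes c: "P.int_cycle c" "P'.int_cycle c'" and m: "match h h'" "match c c'"
  shows "intersection_number D h c = intersection_number D' h' c'"
  unfolding P.intersection_cycle[OF c(1)] P'.intersection_cycle[OF c(2)] classical'
  using crossing_isect_same[OF _ m] by (simp add: sum.reindex inj_on_subset[OF inj_H])

lemma match_left_half:
  assumes v: "v \<in> classical D"
  shows "match (left_half D v) (left_half D' (H 1 v))"
  unfolding match_def
proof (intro allI impI)
  fix t assume t: "t \<notin> passages D'"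
  have "t \<in> between (nw_param D' (H 1 v)) (ne_param D' (H 1 v))
    \<longleftrightarrow> r t \<in> between (frac (r (nw_param D' (H 1 v)))) (frac (r (ne_param D' (H 1 v))))"
    by (simp add: between_r)
  then show "left_half D v (arc_at D (r t)) = left_half D' (H 1 v) (arc_at D' t)"
    using P.left_half_at[OF v] P'.left_half_at[OF _ t] t passages' v
    by (simp add: params'[OF v] classical')
qed

lemma match_whole: "match (whole D) (whole D')"
  unfolding match_def using passages' P.arc_at_in P'.arc_at_in by (auto simp: whole_def)

lemma match_minus_half:
  assumes u: "u \<in> classical D"
  shows "match (minus_half D u) (minus_half D' (H 1 u))"
  using match_left_half[OF u] u passages' unfolding match_def minus_half_def
  by (auto simp: params'(3)[OF u] P.right_half_at P'.right_half_at classical')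

lemma match_corr:
  assumes m: "match h h'" and a: "a \<in> arcs D" "a' \<in> arcs D'" "a = r ` a'"
  shows "h a = h' a'"
proof -
  obtain t where t: "t \<in> a'" using a(2) P'.arc_at_self unfolding arcs_def by blast
  then have "a = arc_at D (r t)" "a' = arc_at D' t"
    using P.arcs_at[OF a(1)] P'.arcs_at[OF a(2)] a(3) by blast+
  then show ?thesis using m P'.arcs_no_passage[OF a(2) t] by (simp add: match_def)
qed

end

text \<open>
  The detoured path contains no passage in either diagram, and near every passage the curves agree.
\<close>

lemma detour_same:
  assumes "detour_move D D'"
  shows "classical D' = classical D" "arcs D' = arcs D"
    "v \<in> classical D \<Longrightarrow> ne_param D' v = ne_param D v" "v \<in> classical D \<Longrightarrow> nw_param D' v = nw_param D v"
    "over D' = over D"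
proof -
  interpret P: diagram D by unfold_locales (use assms in \<open>simp add: detour_move_def\<close>)
  interpret P': diagram D' by unfold_locales (use assms in \<open>simp add: detour_move_def\<close>)
  obtain s e where se: "s < e" "e < s + 1"
    and out: "\<And>t. (\<forall>n::int. t + of_int n \<notin> {s..e}) \<Longrightarrow> curve D' t = curve D t"
    and ov: "over D' = over D"
    and clear: "{s..e} \<inter> passages D = {}" "{s..e} \<inter> passages D' = {}"
    using assms unfolding detour_move_def by blast
  show "over D' = over D" by (rule ov)
  have outside: "t + of_int n \<notin> {s..e}" if "t \<in> passages D \<or> t \<in> passages D'" for t and n :: int
  proof
    assume "t + of_int n \<in> {s..e}"
    moreover have "t + of_int n \<in> passages D \<or> t + of_int n \<in> passages D'" using that by simp
    ultimately show False using clear by blast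
  qed
  have pass: "p \<in> over D \<Longrightarrow> p \<in> passages D" for p by (auto simp: passages_def classical_def)
  have "curve D' p = curve D p" if "p \<in> over D" for p
    using out outside pass[OF that] by blast
  then show cl: "classical D' = classical D" by (auto simp: classical_def ov image_iff)
  have pp: "passages D' = passages D"
  proof -
    have "t \<in> passages D' \<longleftrightarrow> t \<in> passages D" for t
    proof (cases "t \<in> passages D \<or> t \<in> passages D'")
      case True
      then have "curve D' t = curve D t" using out outside by blast
      then show ?thesis by (simp add: passages_def cl)
    qed blast
    then show ?thesis by blast
  qed
  then have "arc_at D' t = arc_at D t" for t by (simp add: arc_at_def)
  then show "arcs D' = arcs D" by (simp add: arcs_def pp)
  have vel: "velocity D' p = velocity D p" if p: "p \<in> passages D" for p
  proof -
    have out_p: "p \<notin> {s + of_int n..e + of_int n}" for n :: int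
      using outside[of p "- n"] p by auto
    have "eventually (\<lambda>t. \<forall>n::int. t \<notin> {s + of_int n..e + of_int n}) (at_left p)"
      by (rule eventually_left_gap[OF se(2)]) (use out_p in blast)
    then obtain a where a: "a < p"
      "\<And>t. a < t \<Longrightarrow> t < p \<Longrightarrow> \<forall>n::int. t \<notin> {s + of_int n..e + of_int n}"
      unfolding eventually_at_left_field by blast
    have "eventually (\<lambda>t. \<forall>n::int. t \<notin> {s + of_int n..e + of_int n}) (at_right p)"
      by (rule eventually_right_gap[OF se(2)]) (use out_p in blast)
    then obtain b where b: "p < b"
      "\<And>t. p < t \<Longrightarrow> t < b \<Longrightarrow> \<forall>n::int. t \<notin> {s + of_int n..e + of_int n}"
      unfolding eventually_at_right_field by blast
    have same: "curve D' t = curve D t" if "\<forall>n::int. t \<notin> {s + of_int n..e + of_int n}" for t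
    proof (rule out, rule allI)
      fix n :: int show "t + of_int n \<notin> {s..e}" using that[rule_format, of "- n"] by auto
    qed
    have same_near: "curve D t = curve D' t" if "t \<in> {a<..<b}" for t
    proof -
      have "\<forall>n::int. t \<notin> {s + of_int n..e + of_int n}"
        using a(2)[of t] b(2)[of t] out_p that by (cases t p rule: linorder_cases) auto
      then show ?thesis using same by simp
    qed
    have "(curve D' has_vector_derivative velocity D p) (at p)"
      by (rule has_vector_derivative_transform_within_open[OF P.has_velocity, where S = "{a<..<b}"])
        (use a(1) b(1) same_near in auto)
    with P'.has_velocity show ?thesis by (rule vector_derivative_unique_at)
  qed
  show "ne_param D' v = ne_param D v" "nw_param D' v = nw_param D v" if v: "v \<in> classical D"
  proof -
    have "curve D' p = curve D p" if "p \<in> passages D" for p using out outside that by blast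
    then show "ne_param D' v = ne_param D v" "nw_param D' v = nw_param D v"
      using P'.params_eqI[of "ne_param D v" v "nw_param D v"] P.crossing[OF v]
        vel P.params_passages[OF v] by auto
  qed
qed

section \<open>What a move does to crossings, halves and intersection numbers\<close>

text \<open>
  \<open>V\<close> and \<open>S\<close> are the crossings and arcs of \<open>D\<close> that have a counterpart after a move. Either every
  crossing has one, or exactly the two crossings of a bigon do not, and then their contributions
  to all the relevant exponents cancel.
\<close>

definition leftover :: "vdiag \<Rightarrow> complex set \<Rightarrow> real set set \<Rightarrow> bool" where
  "leftover D V S \<longleftrightarrow> classical D \<subseteq> V \<or>
    (\<exists>D2 T A B. R2_move D D2 T \<and> classical D - V = {A, B} \<and> A \<noteq> B \<and>
      A \<in> domain_of T \<and> B \<in> domain_of T \<and>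
      index_parity D A + index_parity D B = 0 \<and>
      (\<forall>a \<in> S. writhe D A * minus_half D A a + writhe D B * minus_half D B a = 0) \<and>
      (\<forall>v \<in> V. writhe D A * intersection_number D (left_half D v) (minus_half D A) +
        writhe D B * intersection_number D (left_half D v) (minus_half D B) = 0))"

text \<open>
  All that is used of a move. Being symmetric in the two diagrams, it passes to inverse moves.
\<close>

definition transfer ::
  "vdiag \<Rightarrow> vdiag \<Rightarrow> (complex \<times> complex) set \<Rightarrow> (real set \<times> real set) set \<Rightarrow> bool" where
  "transfer D D' F C \<longleftrightarrow> is_diagram D \<and> is_diagram D' \<and>
    F \<subseteq> classical D \<times> classical D' \<and> single_valued F \<and> single_valued (converse F) \<and>
    C \<subseteq> arcs D \<times> arcs D' \<and>
    (\<forall>(v, v') \<in> F. writhe D v = writhe D' v' \<and> index_parity D v = index_parity D' v') \<and>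
    (\<forall>(u, u') \<in> F. \<forall>(a, a') \<in> C. minus_half D u a = minus_half D' u' a') \<and>
    (\<forall>(v, v') \<in> F. \<forall>(u, u') \<in> F. intersection_number D (left_half D v) (minus_half D u)
      = intersection_number D' (left_half D' v') (minus_half D' u')) \<and>
    leftover D (Domain F) (Domain C) \<and> leftover D' (Range F) (Range C)"

lemma transfer_converse:
  assumes "transfer D D' F C"
  shows "transfer D' D (converse F) (converse C)"
proof -
  have "converse F \<subseteq> classical D' \<times> classical D" "converse C \<subseteq> arcs D' \<times> arcs D"
    "\<forall>(v, v') \<in> converse F. writhe D' v = writhe D v' \<and> index_parity D' v = index_parity D v'"
    "\<forall>(u, u') \<in> converse F. \<forall>(a, a') \<in> converse C. minus_half D' u a = minus_half D u' a'"
    "\<forall>(v, v') \<in> converse F. \<forall>(u, u') \<in> converse F. intersection_number D' (left_half D' v) (minus_half D' u)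
      = intersection_number D (left_half D v') (minus_half D u')"
    using assms unfolding transfer_def by (force+)
  then show ?thesis using assms unfolding transfer_def by simp
qed

lemma transfer_isotopy:
  assumes "isotopy_move D D' H r"
  shows "transfer D D' {(v, H 1 v) | v. v \<in> classical D}
    {(a, a'). a \<in> arcs D \<and> a' \<in> arcs D' \<and> a = r ` a'}"
proof -
  interpret isotopy_pair D D' H r by unfold_locales (use assms in \<open>auto simp: isotopy_move_def\<close>)
  let ?F = "{(v, H 1 v) | v. v \<in> classical D}"
  have sub: "?F \<subseteq> classical D \<times> classical D'" by (auto simp: classical')
  have sv: "single_valued ?F" "single_valued (converse ?F)"
    using injD[OF inj_H] by (auto simp: single_valued_def)
  have dom: "Domain ?F = classical D" "Range ?F = classical D'" by (auto simp: classical')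
  have ip: "index_parity D v = index_parity D' (H 1 v)" if "v \<in> classical D" for v
    unfolding index_parity_def
    using intersection_same[OF P.int_cycle_whole P'.int_cycle_whole match_left_half[OF that] match_whole] by simp
  have isec: "intersection_number D (left_half D v) (minus_half D u)
    = intersection_number D' (left_half D' (H 1 v)) (minus_half D' (H 1 u))"
    if "v \<in> classical D" "u \<in> classical D" for u v
    by (rule intersection_same[OF P.int_cycle_minus_half P'.int_cycle_minus_half match_left_half match_minus_half])
      (use that classical' in auto)
  show ?thesis
    unfolding transfer_def
  proof (intro conjI sv sub)
    show "is_diagram D" "is_diagram D'" by (rule P.is_diagram P'.is_diagram)+
    show "leftover D (Domain ?F) S" "leftover D' (Range ?F) S'" for S S'
      unfolding dom by (simp_all add: leftover_def)
    show "\<forall>(u, u') \<in> ?F. \<forall>(a, a') \<in> {(a, a'). a \<in> arcs D \<and> a' \<in> arcs D' \<and> a = r ` a'}.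
      minus_half D u a = minus_half D' u' a'"
      using match_corr[OF match_minus_half] by blast
  qed (use ip isec params'(3) in auto)
qed

lemma transfer_detour:
  assumes "detour_move D D'"
  shows "transfer D D' (Id_on (classical D)) (Id_on (arcs D))"
proof -
  interpret P: diagram D by unfold_locales (use assms in \<open>simp add: detour_move_def\<close>)
  interpret P': diagram D' by unfold_locales (use assms in \<open>simp add: detour_move_def\<close>)
  note same = detour_same[OF assms]
  have lh: "left_half D' v = left_half D v" and rh: "right_half D' v = right_half D v"
    and wr: "writhe D' v = writhe D v" if "v \<in> classical D" for v
    using same that by (simp_all add: left_half_def right_half_def writhe_def)
  have mh: "minus_half D' v = minus_half D v" if "v \<in> classical D" for v
    using lh rh wr that by (simp add: minus_half_def)
  have wh: "whole D' = whole D" using same by (simp add: whole_def)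
  have io: "arc_in D' p = arc_in D p" "arc_out D' p = arc_out D p" for p
    by (simp_all add: arc_in_def arc_out_def same)
  have isec: "intersection_number D' h c = intersection_number D h c" for h c
    unfolding intersection_number_def same(1)
    by (rule sum.cong) (simp_all add: local_intersection_def io same(3,4))
  show ?thesis
    unfolding transfer_def
    by (auto simp: P.is_diagram P'.is_diagram same lh wr mh wh isec index_parity_def leftover_def single_valued_def)
qed

lemma transfer_R2:
  assumes "R2_move D D' T"
  shows "transfer D D' (Id_on (classical D - domain_of T)) (local_arc_corr D D' T)"
proof -
  obtain f f' xA xB where "R2_pair D D' T f f' xA xB" by (rule R2_moveE[OF assms])
  then interpret R2_pair D D' T f f' xA xB .
  let ?F = "Id_on (classical D - domain_of T)"
  have inD': "v \<in> classical D'" if "v \<in> classical D - domain_of T" for v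
    using that outer_classical by blast
  have ip: "index_parity D v = index_parity D' v" if "v \<in> classical D - domain_of T" for v
    unfolding index_parity_def
    using R2_intersection[OF P.int_cycle_whole P'.int_cycle_whole match_left_half_outer match_whole] that by simp
  have mm: "match (minus_half D u) (minus_half D' u)" if "u \<in> classical D - domain_of T" for u
    by (rule match_minus_half[OF match_left_half_outer]) (use that inD' outer_params in auto)
  have isec: "intersection_number D (left_half D v) (minus_half D u)
    = intersection_number D' (left_half D' v) (minus_half D' u)"
    if "v \<in> classical D - domain_of T" "u \<in> classical D - domain_of T" for u v
    by (rule R2_intersection[OF P.int_cycle_minus_half P'.int_cycle_minus_half match_left_half_outer mm])
      (use that inD' in auto)
  have ipAB: "index_parity D A + index_parity D B = 0"
    using pair_halves[OF P.int_cycle_whole] P.intersection_whole_left[OF P.int_cycle_whole]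
    by (simp add: index_parity_def)
  have lo: "leftover D (Domain ?F) (Domain (local_arc_corr D D' T))"
    unfolding leftover_def
  proof (intro disjI2 exI conjI ballI)
    show "R2_move D D' T" by (rule assms)
    show "classical D - Domain ?F = {A, B}" using inside_D by auto
    fix v assume "v \<in> Domain ?F"
    then show "writhe D A * intersection_number D (left_half D v) (minus_half D A) +
        writhe D B * intersection_number D (left_half D v) (minus_half D B) = 0"
      by (intro minus_halves_pair[OF match_left_half_outer]) auto
  next
    fix a assume "a \<in> Domain (local_arc_corr D D' T)"
    then obtain t where t: "a \<in> arcs D" "t \<in> a" "curve D t \<notin> domain_of T"
      by (auto simp: local_arc_corr_def)
    then show "writhe D A * minus_half D A a + writhe D B * minus_half D B a = 0"
      using minus_half_AB[OF t(3)] P.arcs_at[OF t(1,2)] P.arcs_no_passage[OF t(1,2)] by simp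
  qed (use AB ipAB in auto)
  have lo': "leftover D' (Range ?F) S" for S
    using inside_D' outer_classical by (auto simp: leftover_def)
  have corr: "\<forall>(u, u') \<in> ?F. \<forall>(a, a') \<in> local_arc_corr D D' T. minus_half D u a = minus_half D' u' a'"
    using mm unfolding match_corr by auto
  show ?thesis
    unfolding transfer_def
    using P.is_diagram P'.is_diagram ip isec corr lo lo' inD' outer_params
    by (auto simp: single_valued_def local_arc_corr_def)
qed

lemma transfer_R3:
  assumes "R3_move D D' T f f' X X'"
  shows "transfer D D'
    (Id_on (classical D - domain_of T) \<union>
      {(graph_point T f i (X i j), graph_point T f' i (X' i j)) | i j. i < 3 \<and> j < 3 \<and> i \<noteq> j})
    (local_arc_corr D D' T)"
proof -
  obtain c where "R3_pair D D' T f f' X X' c" by (rule R3_moveE[OF assms])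
  then interpret R3_pair D D' T f f' X X' c .
  let ?N = "{(Q.corner i j, Q'.corner i j) | i j. i < 3 \<and> j < 3 \<and> i \<noteq> j}"
  let ?F = "Id_on (classical D - domain_of T) \<union> ?N"
  let ?N3 = "{(Q.corner 0 1, Q'.corner 0 1), (Q.corner 0 2, Q'.corner 0 2), (Q.corner 1 2, Q'.corner 1 2)}"
  have N: "?N = ?N3"
  proof (rule equalityI)
    show "?N \<subseteq> ?N3"
    proof
      fix x assume "x \<in> ?N"
      then obtain i j :: nat where ij: "i < 3" "j < 3" "i \<noteq> j" and x: "x = (Q.corner i j, Q'.corner i j)" by blast
      have "i = 0 \<and> j = 1 \<or> i = 1 \<and> j = 0 \<or> i = 0 \<and> j = 2 \<or> i = 2 \<and> j = 0 \<or>
        i = 1 \<and> j = 2 \<or> i = 2 \<and> j = 1" using ij by auto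
      then have "(Q.corner i j, Q'.corner i j) \<in> ?N3"
        using Q.corner_sym[of 0 1] Q.corner_sym[of 0 2] Q.corner_sym[of 1 2]
          Q'.corner_sym[of 0 1] Q'.corner_sym[of 0 2] Q'.corner_sym[of 1 2] by auto
      then show "x \<in> ?N3" by (simp only: x)
    qed
    have "(Q.corner i j, Q'.corner i j) \<in> ?N" if "i < 3" "j < 3" "i \<noteq> j" for i j using that by blast
    from this[of 0 1] this[of 0 2] this[of 1 2] show "?N3 \<subseteq> ?N" by auto
  qed
  have cases: "(u \<in> classical D \<and> u \<notin> domain_of T \<and> u' = u) \<or>
    (\<exists>i j. i < 3 \<and> j < 3 \<and> i \<noteq> j \<and> u = Q.corner i j \<and> u' = Q'.corner i j)" if "(u, u') \<in> ?F" for u u'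
    using that by blast
  have cl: "u \<in> classical D \<and> u' \<in> classical D'" if "(u, u') \<in> ?F" for u u'
    using cases[OF that] Q.corner_classical Q'.corner_classical outer_classical by blast
  have dom: "Q.corner 0 1 \<in> domain_of T" "Q.corner 0 2 \<in> domain_of T" "Q.corner 1 2 \<in> domain_of T"
    "Q'.corner 0 1 \<in> domain_of T" "Q'.corner 0 2 \<in> domain_of T" "Q'.corner 1 2 \<in> domain_of T"
    using Q.corner_domain Q'.corner_domain by simp_all
  have sv: "single_valued ?F" "single_valued (converse ?F)"
    unfolding N using dom Q.corner_distinct Q'.corner_distinct by (auto simp: single_valued_def)
  have DF: "Domain ?F = classical D" "Range ?F = classical D'"
    unfolding N using Q.inside_corners Q'.inside_corners outer_classical by auto
  have mh: "match (left_half D u) (left_half D' u')" and wr: "writhe D u = writhe D' u'" if "(u, u') \<in> ?F" for u u'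
    using cases[OF that] match_left_half_outer match_left_half_corner outer_params writhe_same by metis+
  have mm: "match (minus_half D u) (minus_half D' u')" if "(u, u') \<in> ?F" for u u'
    by (rule match_minus_half[OF mh[OF that] wr[OF that]]) (use cl[OF that] in auto)
  have eq: "u = w \<longleftrightarrow> u' = w'" if "(u, u') \<in> ?F" "(w, w') \<in> ?F" for u u' w w'
    using sv that unfolding single_valued_def by blast
  have inF: "(Q.corner i j, Q'.corner i j) \<in> ?F" if "i < 3" "j < 3" "i \<noteq> j" for i j using that by blast
  have jl: "P'.jump (left_half D' u') (Q'.corner i j) = P.jump (left_half D u) (Q.corner i j)"
    and jm: "P'.jump (minus_half D' u') (Q'.corner i j) = P.jump (minus_half D u) (Q.corner i j)"
    if u: "(u, u') \<in> ?F" and ij: "i < 3" "j < 3" "i \<noteq> j" for u u' i j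
    using cl[OF u] Q.corner_classical[OF ij] Q'.corner_classical[OF ij] eq[OF u inF[OF ij]] wr[OF u]
    by (simp_all add: P.jump_left_half P'.jump_left_half P.jump_minus_half P'.jump_minus_half)
  have ip: "index_parity D u = index_parity D' u'" if u: "(u, u') \<in> ?F" for u u'
  proof -
    have "intersection_number D (left_half D u) (whole D) = intersection_number D' (left_half D' u') (whole D')"
      by (rule R3_intersection[OF P.int_cycle_left_half P'.int_cycle_left_half
          P.int_cycle_whole P'.int_cycle_whole mh[OF u] match_whole])
        (use cl[OF u] jl[OF u] in \<open>auto simp: P.jump_whole P'.jump_whole\<close>)
    then show ?thesis by (simp add: index_parity_def)
  qed
  have isec: "intersection_number D (left_half D v) (minus_half D u)
    = intersection_number D' (left_half D' v') (minus_half D' u')"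
    if v: "(v, v') \<in> ?F" and u: "(u, u') \<in> ?F" for u u' v v'
    by (rule R3_intersection[OF P.int_cycle_left_half P'.int_cycle_left_half
        P.int_cycle_minus_half P'.int_cycle_minus_half mh[OF v] mm[OF u]])
      (use cl[OF u] cl[OF v] jl[OF v] jm[OF u] in auto)
  show ?thesis
    unfolding transfer_def
  proof (intro conjI sv)
    show "is_diagram D" "is_diagram D'" by (rule P.is_diagram P'.is_diagram)+
    show "?F \<subseteq> classical D \<times> classical D'" using cl by auto
    show "local_arc_corr D D' T \<subseteq> arcs D \<times> arcs D'" by (auto simp: local_arc_corr_def)
    show "leftover D (Domain ?F) S" "leftover D' (Range ?F) S'" for S S'
      unfolding DF by (simp_all add: leftover_def)
    show "\<forall>(v, v') \<in> ?F. writhe D v = writhe D' v' \<and> index_parity D v = index_parity D' v'"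
      using wr ip by blast
    show "\<forall>(u, u') \<in> ?F. \<forall>(a, a') \<in> local_arc_corr D D' T. minus_half D u a = minus_half D' u' a'"
      using mm unfolding match_corr by blast
    show "\<forall>(v, v') \<in> ?F. \<forall>(u, u') \<in> ?F. intersection_number D (left_half D v) (minus_half D u)
      = intersection_number D' (left_half D' v') (minus_half D' u')"
      using isec by blast
  qed
qed

theorem vmove_transfer: "vmove D D' F C \<Longrightarrow> transfer D D' F C"
  by (induction rule: vmove.induct)
    (simp_all only: transfer_isotopy transfer_detour transfer_R2 transfer_R3 transfer_converse)


section \<open>The cycle and the parity of an index\<close>

context comm_group
begin

lemma finprod_int_pow:
  assumes "f \<in> S \<rightarrow> carrier G"
  shows "(\<Otimes>x\<in>S. f x) [^] (k::int) = (\<Otimes>x\<in>S. f x [^] k)"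
  using assms
proof (induction S rule: infinite_finite_induct)
  case (insert x S)
  then have c: "f x \<in> carrier G" "f \<in> S \<rightarrow> carrier G" by auto
  then have "(\<lambda>x. f x [^] k) \<in> S \<rightarrow> carrier G" by auto
  then show ?case using insert c by (simp add: int_pow_distrib Pi_iff)
qed auto

lemma finprod_transfer:
  assumes V: "finite V" "finite V'" "F \<subseteq> V \<times> V'" "single_valued F" "single_valued (converse F)"
    and g: "g \<in> V \<rightarrow> carrier G" "g' \<in> V' \<rightarrow> carrier G"
    and eq: "\<And>u u'. (u, u') \<in> F \<Longrightarrow> g u = g' u'"
    and rest: "(\<Otimes>u\<in>V - Domain F. g u) = \<one>" "(\<Otimes>u\<in>V' - Range F. g' u) = \<one>"
  shows "(\<Otimes>u\<in>V. g u) = (\<Otimes>u\<in>V'. g' u)"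
proof -
  have split: "(\<Otimes>u\<in>W. h u) = (\<Otimes>u\<in>Z. h u)"
    if "finite W" "Z \<subseteq> W" "h \<in> W \<rightarrow> carrier G" "(\<Otimes>u\<in>W - Z. h u) = \<one>" for W Z :: "'z set" and h
  proof -
    have "h \<in> Z \<rightarrow> carrier G" "h \<in> W - Z \<rightarrow> carrier G" "finite Z" "finite (W - Z)"
      using that finite_subset by auto
    then have "(\<Otimes>u\<in>Z \<union> (W - Z). h u) = (\<Otimes>u\<in>Z. h u) \<otimes> (\<Otimes>u\<in>W - Z. h u)"
      by (intro finprod_Un_disjoint) auto
    then show ?thesis using that \<open>h \<in> Z \<rightarrow> carrier G\<close> by (simp add: Un_absorb1 Un_Diff_cancel)
  qed
  define \<phi> where "\<phi> u = (THE u'. (u, u') \<in> F)" for u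
  have \<phi>: "\<phi> u = u'" if "(u, u') \<in> F" for u u'
    unfolding \<phi>_def using that V(4) by (intro the_equality) (auto simp: single_valued_def)
  have img: "\<phi> ` Domain F = Range F" using \<phi> by force
  have inj: "inj_on \<phi> (Domain F)"
    using \<phi> V(5) unfolding inj_on_def single_valued_def by (metis Domain.cases converse.intros)
  have sub: "Domain F \<subseteq> V" "Range F \<subseteq> V'" using V(3) by auto
  have "(\<Otimes>u\<in>Range F. g' u) = (\<Otimes>u\<in>Domain F. g' (\<phi> u))"
    unfolding img[symmetric]
    by (rule finprod_reindex[OF _ inj]) (use g(2) sub img in auto)
  also have "\<dots> = (\<Otimes>u\<in>Domain F. g u)"
    by (rule finprod_cong') (use g(1) sub \<phi> eq in force)+
  finally show ?thesis
    using split[OF V(1) sub(1) g(1) rest(1)] split[OF V(2) sub(2) g(2) rest(2)] by simp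
qed

end

locale knot_with_index = comm_group A for A :: "('g, 'b) monoid_scheme" (structure) +
  fixes K :: "vdiag set" and \<pi> :: "vdiag \<Rightarrow> complex \<Rightarrow> 'g"
  assumes knot: "K \<in> regular_virtual_knots" and index: "knot_index A K \<pi>"
begin

text \<open>
  The multiplicative form of the integral combination of the indices with coefficients \<open>n\<close>.
\<close>

definition weighted :: "vdiag \<Rightarrow> (complex \<Rightarrow> int) \<Rightarrow> 'g" where
  "weighted D n = (\<Otimes>u\<in>classical D. \<pi> D u [^] n u)"

abbreviation reachable :: "vdiag \<Rightarrow> vdiag \<Rightarrow> bool" where
  "reachable \<equiv> (\<lambda>D1 D2. \<exists>F C. vmove D1 D2 F C)\<^sup>*\<^sup>*"

lemma base_diagram: "\<exists>D0 \<in> K. \<forall>D. D \<in> K \<longleftrightarrow> is_diagram D \<and> reachable D0 D"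
proof -
  obtain D0 where D0: "is_diagram D0" "K = move_equiv `` {D0}"
    using knot unfolding regular_virtual_knots_def by (auto elim: quotientE)
  then show ?thesis by (auto simp: move_equiv_def)
qed

lemma diagram_K: "D \<in> K \<Longrightarrow> diagram D"
  using base_diagram unfolding diagram_def by blast

lemma move_K:
  assumes "D \<in> K" "vmove D D' F C"
  shows "D' \<in> K"
proof -
  have "is_diagram D'" using vmove_transfer[OF assms(2)] by (simp add: transfer_def)
  moreover obtain D0 where D0: "\<forall>D. D \<in> K \<longleftrightarrow> is_diagram D \<and> reachable D0 D" using base_diagram by blast
  moreover have "reachable D0 D" using D0 assms(1) by blast
  then have "reachable D0 D'" by (rule rtranclp.rtrancl_into_rtrancl) (use assms(2) in blast)
  ultimately show ?thesis by blast
qed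

lemma \<pi>_carrier: "D \<in> K \<Longrightarrow> v \<in> classical D \<Longrightarrow> \<pi> D v \<in> carrier A"
  using index by (auto simp: knot_index_def)

lemma \<pi>_move: "D \<in> K \<Longrightarrow> vmove D D' F C \<Longrightarrow> (v, v') \<in> F \<Longrightarrow> \<pi> D v = \<pi> D' v'"
  using index unfolding knot_index_def by blast

lemma \<pi>_R2:
  assumes "D \<in> K" "R2_move D D' T" "v1 \<in> classical D" "v1 \<in> domain_of T" "v2 \<in> classical D" "v2 \<in> domain_of T"
  shows "\<pi> D v1 = \<pi> D v2"
  using index assms unfolding knot_index_def by blast

lemma pow_funcset: "D \<in> K \<Longrightarrow> (\<lambda>u. \<pi> D u [^] (n u :: int)) \<in> classical D \<rightarrow> carrier A"
  using \<pi>_carrier by auto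

lemma weighted_closed [simp]: "D \<in> K \<Longrightarrow> weighted D n \<in> carrier A"
  unfolding weighted_def by (rule finprod_closed[OF pow_funcset])

lemma weighted_cong:
  "D \<in> K \<Longrightarrow> (\<And>u. u \<in> classical D \<Longrightarrow> n u = m u) \<Longrightarrow> weighted D n = weighted D m"
  unfolding weighted_def using pow_funcset by (intro finprod_cong') auto

lemma weighted_add:
  assumes D: "D \<in> K"
  shows "weighted D n \<otimes> weighted D m = weighted D (\<lambda>u. n u + m u)"
proof -
  have "weighted D (\<lambda>u. n u + m u) = (\<Otimes>u\<in>classical D. \<pi> D u [^] n u \<otimes> \<pi> D u [^] m u)"
    unfolding weighted_def
    by (rule finprod_cong') (use \<pi>_carrier[OF D] in \<open>auto simp: int_pow_mult\<close>)
  then show ?thesis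
    unfolding weighted_def using finprod_multf[OF pow_funcset[OF D, of n] pow_funcset[OF D, of m]] by simp
qed

lemma weighted_pow:
  assumes D: "D \<in> K"
  shows "weighted D n [^] (k::int) = weighted D (\<lambda>u. k * n u)"
proof -
  have "weighted D n [^] k = (\<Otimes>u\<in>classical D. (\<pi> D u [^] n u) [^] k)"
    unfolding weighted_def by (rule finprod_int_pow[OF pow_funcset[OF D]])
  also have "\<dots> = weighted D (\<lambda>u. k * n u)"
    unfolding weighted_def
    by (rule finprod_cong') (use \<pi>_carrier[OF D] in \<open>auto simp: int_pow_pow mult.commute\<close>)
  finally show ?thesis .
qed

lemma weighted_inv: "D \<in> K \<Longrightarrow> inv (weighted D n) = weighted D (\<lambda>u. - n u)"
  using weighted_pow[of D n "-1"] int_pow_neg[of "weighted D n" 1] by simp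

text \<open>
  The indices of the two crossings of a bigon agree, so only the sum of their exponents matters.
\<close>

lemma leftover_neutral:
  assumes D: "D \<in> K" and lo: "leftover D V S"
    and n: "(\<lambda>u. n u) = (\<lambda>u. index_parity D u)
      \<or> (\<exists>a \<in> S. n = (\<lambda>u. writhe D u * minus_half D u a))
      \<or> (\<exists>v \<in> V. n = (\<lambda>u. writhe D u * intersection_number D (left_half D v) (minus_half D u)))"
  shows "(\<Otimes>u\<in>classical D - V. \<pi> D u [^] n u) = \<one>"
proof (cases "classical D \<subseteq> V")
  case True
  then have "classical D - V = {}" by blast
  then show ?thesis by (simp only: finprod_empty)
next
  case False
  then obtain D2 T v w where *: "R2_move D D2 T" "classical D - V = {v, w}" "v \<noteq> w"
      "v \<in> domain_of T" "w \<in> domain_of T"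
      "index_parity D v + index_parity D w = 0"
      "\<forall>a \<in> S. writhe D v * minus_half D v a + writhe D w * minus_half D w a = 0"
      "\<forall>x \<in> V. writhe D v * intersection_number D (left_half D x) (minus_half D v) +
        writhe D w * intersection_number D (left_half D x) (minus_half D w) = 0"
    using lo unfolding leftover_def by auto
  have vw: "v \<in> classical D" "w \<in> classical D" using *(2) by blast+
  have eq: "\<pi> D w = \<pi> D v" using \<pi>_R2[OF D *(1)] vw *(4,5) by blast
  have "n v + n w = 0" using n *(6-8) by auto
  then have "\<pi> D v [^] n v \<otimes> \<pi> D v [^] n w = \<one>"
    using int_pow_mult[OF \<pi>_carrier[OF D vw(1)], of "n v" "n w"] by simp
  then show ?thesis
    unfolding *(2) using *(3) \<pi>_carrier[OF D vw(1)] by (simp add: eq)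
qed

lemma weighted_transfer:
  assumes D: "D \<in> K" and mv: "vmove D D' F C"
    and n: "\<And>u u'. (u, u') \<in> F \<Longrightarrow> n u = n' u'"
    and rest: "(\<Otimes>u\<in>classical D - Domain F. \<pi> D u [^] (n u :: int)) = \<one>"
      "(\<Otimes>u\<in>classical D' - Range F. \<pi> D' u [^] (n' u :: int)) = \<one>"
  shows "weighted D n = weighted D' n'"
  unfolding weighted_def
proof (rule finprod_transfer[where F = F])
  have tr: "transfer D D' F C" by (rule vmove_transfer[OF mv])
  have D': "D' \<in> K" by (rule move_K[OF D mv])
  show "finite (classical D)" "finite (classical D')"
    using diagram.finite_classical diagram_K D D' by blast+
  show "F \<subseteq> classical D \<times> classical D'" "single_valued F" "single_valued (converse F)"
    using tr by (auto simp: transfer_def)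
  show "(\<lambda>u. \<pi> D u [^] n u) \<in> classical D \<rightarrow> carrier A" "(\<lambda>u. \<pi> D' u [^] n' u) \<in> classical D' \<rightarrow> carrier A"
    using pow_funcset D D' by blast+
  show "\<pi> D u [^] n u = \<pi> D' u' [^] n' u'" if "(u, u') \<in> F" for u u'
    using n[OF that] \<pi>_move[OF D mv that] by simp
qed (rule rest)+

lemma signature_weighted: "D \<in> K \<Longrightarrow> signature A \<pi> D = weighted D (\<lambda>u. - index_parity D u)"
  unfolding signature_def using weighted_inv[of D "index_parity D"] by (simp add: weighted_def)

lemma signature_move:
  assumes D: "D \<in> K" and mv: "vmove D D' F C"
  shows "signature A \<pi> D' = signature A \<pi> D"
proof -
  have tr: "transfer D D' F C" by (rule vmove_transfer[OF mv])
  have D': "D' \<in> K" by (rule move_K[OF D mv])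
  have "weighted D (index_parity D) = weighted D' (index_parity D')"
    by (rule weighted_transfer[OF D mv])
      (use tr leftover_neutral[OF D] leftover_neutral[OF D'] in \<open>auto simp: transfer_def\<close>)
  then show ?thesis by (simp add: signature_def weighted_def)
qed

lemma signature_constant: obtains \<sigma> where "\<sigma> \<in> carrier A" "\<And>D. D \<in> K \<Longrightarrow> signature A \<pi> D = \<sigma>"
proof -
  obtain D0 where D0: "D0 \<in> K" and reach: "\<And>D. D \<in> K \<Longrightarrow> reachable D0 D"
    using base_diagram by blast
  have "D \<in> K \<and> signature A \<pi> D = signature A \<pi> D0" if "reachable D0 D" for D
    using that
  proof (induction rule: rtranclp_induct)
    case base
    then show ?case using D0 by simp
  next
    case (step D D')
    then show ?case using move_K signature_move by metis
  qed
  then have "signature A \<pi> D = signature A \<pi> D0" if "D \<in> K" for D using reach that by blast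
  moreover have "signature A \<pi> D0 \<in> carrier A" using D0 by (simp add: signature_weighted)
  ultimately show ?thesis using that by blast
qed

lemma index_cycle_weighted:
  "a \<in> arcs D \<Longrightarrow> index_cycle A \<pi> D a = weighted D (\<lambda>u. writhe D u * minus_half D u a)"
  by (simp add: index_cycle_def weighted_def)

lemma index_cycle_in_cycles:
  assumes D: "D \<in> K"
  shows "index_cycle A \<pi> D \<in> cycles A D"
proof -
  interpret P: diagram D by (rule diagram_K[OF D])
  have "index_cycle A \<pi> D \<in> chains A D"
    using index_cycle_weighted D by (auto simp: chains_def index_cycle_def PiE_def weighted_def[symmetric])
  moreover have "index_cycle A \<pi> D (arc_in D (ne_param D v)) \<otimes> index_cycle A \<pi> D (arc_in D (nw_param D v)) =
     index_cycle A \<pi> D (arc_out D (ne_param D v)) \<otimes> index_cycle A \<pi> D (arc_out D (nw_param D v))"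
    if v: "v \<in> classical D" for v
  proof -
    have "minus_half D u (arc_in D (ne_param D v)) + minus_half D u (arc_in D (nw_param D v)) =
      minus_half D u (arc_out D (ne_param D v)) + minus_half D u (arc_out D (nw_param D v))"
      if "u \<in> classical D" for u
      using P.int_cycle_minus_half[OF that] v by (simp add: P.int_cycle_def)
    then show ?thesis
      by (simp add: index_cycle_weighted weighted_add[OF D] distrib_left[symmetric] cong: weighted_cong[OF D])
  qed
  ultimately show ?thesis by (simp add: cycles_def)
qed

lemma index_cycle_move:
  assumes D: "D \<in> K" and mv: "vmove D D' F C" and a: "(a, a') \<in> C"
  shows "index_cycle A \<pi> D a = index_cycle A \<pi> D' a'"
proof -
  have tr: "transfer D D' F C" by (rule vmove_transfer[OF mv])
  have D': "D' \<in> K" by (rule move_K[OF D mv])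
  have arcs: "a \<in> arcs D" "a' \<in> arcs D'" using tr a by (auto simp: transfer_def)
  have lo: "leftover D (Domain F) (Domain C)" "leftover D' (Range F) (Range C)"
    using tr by (auto simp: transfer_def)
  have mem: "a \<in> Domain C" "a' \<in> Range C" using a by auto
  have eq: "writhe D u * minus_half D u a = writhe D' u' * minus_half D' u' a'" if "(u, u') \<in> F" for u u'
  proof -
    have "writhe D u = writhe D' u'" "minus_half D u a = minus_half D' u' a'"
      using tr a that unfolding transfer_def by blast+
    then show ?thesis by simp
  qed
  show ?thesis
    unfolding index_cycle_weighted[OF arcs(1)] index_cycle_weighted[OF arcs(2)]
    by (rule weighted_transfer[OF D mv eq leftover_neutral[OF D lo(1)] leftover_neutral[OF D' lo(2)]])
      (use mem in auto)
qed

lemma parity_sum_weighted: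
  "parity_sum A \<pi> D v = weighted D (\<lambda>u. writhe D u * intersection_number D (left_half D v) (minus_half D u))"
  by (simp add: parity_sum_def weighted_def)

lemma parity_sum_move:
  assumes D: "D \<in> K" and mv: "vmove D D' F C" and v: "(v, v') \<in> F"
  shows "parity_sum A \<pi> D v = parity_sum A \<pi> D' v'"
proof -
  have tr: "transfer D D' F C" by (rule vmove_transfer[OF mv])
  have D': "D' \<in> K" by (rule move_K[OF D mv])
  have lo: "leftover D (Domain F) (Domain C)" "leftover D' (Range F) (Range C)"
    using tr by (auto simp: transfer_def)
  have mem: "v \<in> Domain F" "v' \<in> Range F" using v by auto
  have eq: "writhe D u * intersection_number D (left_half D v) (minus_half D u)
    = writhe D' u' * intersection_number D' (left_half D' v') (minus_half D' u')" if "(u, u') \<in> F" for u u'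
  proof -
    have "writhe D u = writhe D' u'" "intersection_number D (left_half D v) (minus_half D u)
      = intersection_number D' (left_half D' v') (minus_half D' u')"
      using tr v that unfolding transfer_def by blast+
    then show ?thesis by simp
  qed
  show ?thesis
    unfolding parity_sum_weighted
    by (rule weighted_transfer[OF D mv eq leftover_neutral[OF D lo(1)] leftover_neutral[OF D' lo(2)]])
      (use mem in auto)
qed

lemma whole_weighted:
  assumes D: "D \<in> K"
  shows "weighted D (\<lambda>u. writhe D u * intersection_number D (whole D) (minus_half D u)) = signature A \<pi> D"
  unfolding signature_weighted[OF D]
  by (rule weighted_cong[OF D]) (simp add: diagram.whole_minus_half[OF diagram_K[OF D]] index_parity_def)

text \<open>
  The two left halves can be replaced by the whole diagram.
\<close>

lemma parity_sum_R2:
  assumes D: "D \<in> K" and mv: "R2_move D D' T"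
    and v: "v1 \<in> classical D \<inter> domain_of T" "v2 \<in> classical D \<inter> domain_of T" "v1 \<noteq> v2"
  shows "parity_sum A \<pi> D v1 \<otimes> parity_sum A \<pi> D v2 = signature A \<pi> D"
proof -
  obtain f f' xA xB where "R2_pair D D' T f f' xA xB" by (rule R2_moveE[OF mv])
  then interpret R: R2_pair D D' T f f' xA xB .
  have v12: "v1 = R.A \<and> v2 = R.B \<or> v1 = R.B \<and> v2 = R.A" using v R.inside_D by auto
  have "parity_sum A \<pi> D v1 \<otimes> parity_sum A \<pi> D v2
    = weighted D (\<lambda>u. writhe D u * intersection_number D (whole D) (minus_half D u))"
    unfolding parity_sum_weighted weighted_add[OF D]
  proof (rule weighted_cong[OF D])
    fix u assume "u \<in> classical D"
    then have "intersection_number D (left_half D R.A) (minus_half D u)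
      + intersection_number D (left_half D R.B) (minus_half D u) = intersection_number D (whole D) (minus_half D u)"
      by (intro R.pair_halves R.P.int_cycle_minus_half)
    then show "writhe D u * intersection_number D (left_half D v1) (minus_half D u)
        + writhe D u * intersection_number D (left_half D v2) (minus_half D u)
      = writhe D u * intersection_number D (whole D) (minus_half D u)"
      using v12 by (auto simp: distrib_left[symmetric] add.commute)
  qed
  then show ?thesis using whole_weighted[OF D] by simp
qed

text \<open>
  The signed sum of the three left halves can be replaced by a multiple of the whole diagram.
\<close>

lemma parity_sum_R3:
  assumes D: "D \<in> K" and mv: "R3_move D D' T f f' X X'"
  obtains m :: int where
    "parity_sum A \<pi> D (graph_point T f 0 (X 0 1)) [^] triangle_sign T X 0 1 2 \<otimes>
     parity_sum A \<pi> D (graph_point T f 0 (X 0 2)) [^] triangle_sign T X 0 2 1 \<otimes>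
     parity_sum A \<pi> D (graph_point T f 1 (X 1 2)) [^] triangle_sign T X 1 2 0 = signature A \<pi> D [^] m"
proof -
  obtain c where "R3_pair D D' T f f' X X' c" by (rule R3_moveE[OF mv])
  then interpret R: R3_pair D D' T f f' X X' c .
  obtain m where m: "\<And>k. R.P.int_cycle k \<Longrightarrow>
    triangle_sign T X 0 1 2 * intersection_number D (left_half D (R.Q.corner 0 1)) k
    + triangle_sign T X 0 2 1 * intersection_number D (left_half D (R.Q.corner 0 2)) k
    + triangle_sign T X 1 2 0 * intersection_number D (left_half D (R.Q.corner 1 2)) k
    = m * intersection_number D (whole D) k"
    using R.triangle_halves_intersection by blast
  have "parity_sum A \<pi> D (R.Q.corner 0 1) [^] triangle_sign T X 0 1 2 \<otimes>
     parity_sum A \<pi> D (R.Q.corner 0 2) [^] triangle_sign T X 0 2 1 \<otimes>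
     parity_sum A \<pi> D (R.Q.corner 1 2) [^] triangle_sign T X 1 2 0
    = weighted D (\<lambda>u. m * (writhe D u * intersection_number D (whole D) (minus_half D u)))"
    unfolding parity_sum_weighted weighted_pow[OF D] weighted_add[OF D]
  proof (rule weighted_cong[OF D])
    fix u assume u: "u \<in> classical D"
    show "triangle_sign T X 0 1 2 * (writhe D u * intersection_number D (left_half D (R.Q.corner 0 1)) (minus_half D u)) +
        triangle_sign T X 0 2 1 * (writhe D u * intersection_number D (left_half D (R.Q.corner 0 2)) (minus_half D u)) +
        triangle_sign T X 1 2 0 * (writhe D u * intersection_number D (left_half D (R.Q.corner 1 2)) (minus_half D u)) =
        m * (writhe D u * intersection_number D (whole D) (minus_half D u))"
      using arg_cong[OF m[OF R.P.int_cycle_minus_half[OF u]], of "\<lambda>x. writhe D u * x"]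
      by (simp add: algebra_simps)
  qed
  also have "\<dots> = signature A \<pi> D [^] m"
    using weighted_pow[OF D, of "\<lambda>u. writhe D u * intersection_number D (whole D) (minus_half D u)" m]
      whole_weighted[OF D] by simp
  finally show ?thesis by (rule that)
qed

theorem index_to_parity_is_parity:
  assumes \<sigma>: "\<sigma> \<in> carrier A" "\<And>D. D \<in> K \<Longrightarrow> signature A \<pi> D = \<sigma>"
  shows "oriented_parity (A Mod generate A {\<sigma>}) K (index_to_parity A \<sigma> \<pi>)"
proof -
  let ?H = "generate A {\<sigma>}"
  let ?p = "index_to_parity A \<sigma> \<pi>"
  have H: "subgroup ?H A" using generate_is_subgroup \<sigma>(1) by simp
  interpret N: normal ?H A by (rule subgroup_imp_normal[OF H])
  have ps: "parity_sum A \<pi> D v \<in> carrier A" if "D \<in> K" for D v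
    using that by (simp add: parity_sum_weighted)
  have H_pow: "?H #> \<sigma> [^] (m::int) = ?H" for m
  proof (rule coset_join2[OF _ H])
    show "\<sigma> [^] m \<in> ?H" using subgroup_int_pow_closed[OF H, of \<sigma> m] by (simp add: generate.incl)
  qed (use \<sigma>(1) in simp)
  then have H_one: "?H #> \<sigma> = ?H" using int_pow_1[OF \<sigma>(1)] by metis
  show ?thesis
    unfolding oriented_parity_def
  proof (intro conjI ballI allI impI)
    show "comm_group (A Mod ?H)" by (rule abelian_FactGroup[OF H])
    show "?p D v \<in> carrier (A Mod ?H)" if "D \<in> K" for D v
      using ps[OF that] by (auto simp: index_to_parity_def carrier_FactGroup)
  next
    fix D D' F C x assume D: "D \<in> K" "vmove D D' F C" "x \<in> F"
    then show "case x of (v, v') \<Rightarrow> ?p D v = ?p D' v'"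
      using parity_sum_move[OF D(1,2)] by (auto simp: index_to_parity_def)
  next
    fix D D' T v1 v2 assume *: "D \<in> K" "R2_move D D' T" "v1 \<in> classical D \<inter> domain_of T"
      "v2 \<in> classical D \<inter> domain_of T" "v1 \<noteq> v2"
    show "?p D v1 \<otimes>\<^bsub>A Mod ?H\<^esub> ?p D v2 = \<one>\<^bsub>A Mod ?H\<^esub>"
      using parity_sum_R2[OF *] \<sigma>(2)[OF *(1)] H_one
      by (simp add: index_to_parity_def N.rcos_sum[OF ps[OF *(1)] ps[OF *(1)]])
  next
    fix D D' T f f' X X' assume *: "D \<in> K" "R3_move D D' T f f' X X'"
    obtain m :: int where m:
      "parity_sum A \<pi> D (graph_point T f 0 (X 0 1)) [^] triangle_sign T X 0 1 2 \<otimes>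
       parity_sum A \<pi> D (graph_point T f 0 (X 0 2)) [^] triangle_sign T X 0 2 1 \<otimes>
       parity_sum A \<pi> D (graph_point T f 1 (X 1 2)) [^] triangle_sign T X 1 2 0 = signature A \<pi> D [^] m"
      by (rule parity_sum_R3[OF *])
    show "?p D (graph_point T f 0 (X 0 1)) [^]\<^bsub>A Mod ?H\<^esub> triangle_sign T X 0 1 2 \<otimes>\<^bsub>A Mod ?H\<^esub>
        ?p D (graph_point T f 0 (X 0 2)) [^]\<^bsub>A Mod ?H\<^esub> triangle_sign T X 0 2 1 \<otimes>\<^bsub>A Mod ?H\<^esub>
        ?p D (graph_point T f 1 (X 1 2)) [^]\<^bsub>A Mod ?H\<^esub> triangle_sign T X 1 2 0 = \<one>\<^bsub>A Mod ?H\<^esub>"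
      using m \<sigma>(2)[OF *(1)] H_pow
      by (simp add: index_to_parity_def N.FactGroup_int_pow[OF ps[OF *(1)]] N.rcos_sum ps[OF *(1)])
  qed
qed

end

theorem theorem7:
  fixes A :: "('g, 'b) monoid_scheme" and K :: "vdiag set"
    and \<pi> :: "vdiag \<Rightarrow> complex \<Rightarrow> 'g"
  assumes "comm_group A"
    and "K \<in> regular_virtual_knots"
    and "knot_index A K \<pi>"
  shows "invariant_cycle A K (index_cycle A \<pi>) \<and>
    (\<exists>\<sigma> \<in> carrier A. (\<forall>D \<in> K. signature A \<pi> D = \<sigma>) \<and>
       oriented_parity (A Mod generate A {\<sigma>}) K (index_to_parity A \<sigma> \<pi>))"
proof -
  interpret knot_with_index A K \<pi>
    using assms by (intro knot_with_index.intro knot_with_index_axioms.intro)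
  have "invariant_cycle A K (index_cycle A \<pi>)"
    unfolding invariant_cycle_def using index_cycle_in_cycles index_cycle_move by blast
  moreover obtain \<sigma> where "\<sigma> \<in> carrier A" "\<And>D. D \<in> K \<Longrightarrow> signature A \<pi> D = \<sigma>"
    using signature_constant by blast
  ultimately show ?thesis using index_to_parity_is_parity by blast
qed

end
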